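(* Let $V$ be a vector space of dimension $3$ over a field $k$ of characteristic $\ne 2$, and let $\zeta\in GL(V)$. Let $R$ be a Hecke symmetry on $V$ such that the identity map of $V$ extends to an isomorphism of algebras $\mathbb{S}(V,R)\cong \mathbb{S}(V)_\zeta$. Then $R$ commutes with $\zeta\otimes\zeta$. As a consequence, $R$ is the twist $R=(R_1)_\zeta$ of a Hecke symmetry $R_1$ on $V$ (commuting with $\zeta\otimes\zeta$) whose associated $R_1$-symmetric algebra $\mathbb{S}(V,R_1)$ equals the ordinary symmetric algebra $\mathbb{S}(V)$ (i.e. $\mathrm{Im}(R_1-q\,\mathrm{Id})$ is spanned by the tensors $x\otimes y-y\otimes x$).
   Context: For a finite-dimensional vector space $V$ over a field $k$, a Hecke symmetry on $V$ with parameter $0\ne q\in k$ is a linear operator $R:V\otimes V\to V\otimes V$ satisfying the braid equation $(R\otimes\mathrm{Id}_V)(\mathrm{Id}_V\otimes R)(R\otimes\mathrm{Id}_V)=(\mathrm{Id}_V\otimes R)(R\otimes\mathrm{Id}_V)(\mathrm{Id}_V\otimes R)$ and the Hecke relation $(R-q\,\mathrm{Id}_{V\otimes V})(R+\mathrm{Id}_{V\otimes V})=0$. The $R$-symmetric algebra $\mathbb{S}(V,R)$ is the quotient of the tensor algebra $T(V)$ by the two-sided ideal generated by $\mathrm{Im}(R-q\,\mathrm{Id}_{V\otimes V})\subset V^{\otimes 2}$. For a $\mathbb{Z}$-graded algebra $A=\bigoplus A_n$ and a grading-preserving automorphism $\sigma$, the twist $A_\sigma$ is the algebra with the same underlying graded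 space and multiplication $a\cdot_\sigma b=a\,\sigma^n(b)$ for $a\in A_n$, $b\in A$. $\mathbb{S}(V)$ denotes the symmetric algebra of $V$, and $\mathbb{S}(V)_\zeta$ denotes the twist of $\mathbb{S}(V)$ by the automorphism extending $\zeta$; it is generated by $V$ in degree $1$. If $\zeta\otimes\zeta$ commutes with a Hecke symmetry $R$, the twist of $R$ by $\zeta$ is $R_\zeta=(\zeta\otimes\mathrm{Id}_V)\circ R\circ(\zeta^{-1}\otimes\mathrm{Id}_V)$, which is again a Hecke symmetry with the same parameter. *)

theory Defs
  imports Main
begin

text \<open>Concrete model: V = k^'n with basis indexed by a finite type 'n (CARD('n) = dim V).
  A linear operator on a space with basis indexed by 'i is a matrix 'i => 'i => 'k,
  acting by (A t) i = sum_j A i j * t j.  V tensor V has basis indexed by 'n x 'n.\<close>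

definition idm :: "'i \<Rightarrow> 'i \<Rightarrow> 'k::field" where
  "idm i j = (if i = j then 1 else 0)"

definition mmul :: "('i::finite \<Rightarrow> 'j \<Rightarrow> 'k::field) \<Rightarrow> ('j \<Rightarrow> 'l \<Rightarrow> 'k) \<Rightarrow> 'i \<Rightarrow> 'l \<Rightarrow> 'k" where
  "mmul A B i l = (\<Sum>j\<in>UNIV. A i j * B j l)"

definition mapply :: "('i \<Rightarrow> 'j::finite \<Rightarrow> 'k::field) \<Rightarrow> ('j \<Rightarrow> 'k) \<Rightarrow> 'i \<Rightarrow> 'k" where
  "mapply A t i = (\<Sum>j\<in>UNIV. A i j * t j)"

definition mimage :: "('i \<Rightarrow> 'j::finite \<Rightarrow> 'k::field) \<Rightarrow> ('i \<Rightarrow> 'k) set" where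
  "mimage A = range (mapply A)"

definition invertible_mat :: "('i::finite \<Rightarrow> 'i \<Rightarrow> 'k::field) \<Rightarrow> bool" where
  "invertible_mat A \<longleftrightarrow> (\<exists>B. mmul A B = idm \<and> mmul B A = idm)"

definition minv :: "('i::finite \<Rightarrow> 'i \<Rightarrow> 'k::field) \<Rightarrow> 'i \<Rightarrow> 'i \<Rightarrow> 'k" where
  "minv A = (SOME B. mmul A B = idm \<and> mmul B A = idm)"

fun mpow :: "('i::finite \<Rightarrow> 'i \<Rightarrow> 'k::field) \<Rightarrow> nat \<Rightarrow> 'i \<Rightarrow> 'i \<Rightarrow> 'k" where
  "mpow A 0 = idm"
| "mpow A (Suc n) = mmul A (mpow A n)"

definition tensor_op :: "('n \<Rightarrow> 'n \<Rightarrow> 'k::field) \<Rightarrow> ('n \<Rightarrow> 'n \<Rightarrow> 'k) \<Rightarrow> ('n \<times> 'n) \<Rightarrow> ('n \<times> 'n) \<Rightarrow> 'k" where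
  "tensor_op A B = (\<lambda>(a, b) (c, d). A a c * B b d)"

definition R_12 :: "(('n \<times> 'n) \<Rightarrow> ('n \<times> 'n) \<Rightarrow> 'k::field) \<Rightarrow> ('n \<times> 'n \<times> 'n) \<Rightarrow> ('n \<times> 'n \<times> 'n) \<Rightarrow> 'k" where
  "R_12 R = (\<lambda>(a, b, c) (a', b', c'). R (a, b) (a', b') * idm c c')"

definition R_23 :: "(('n \<times> 'n) \<Rightarrow> ('n \<times> 'n) \<Rightarrow> 'k::field) \<Rightarrow> ('n \<times> 'n \<times> 'n) \<Rightarrow> ('n \<times> 'n \<times> 'n) \<Rightarrow> 'k" where
  "R_23 R = (\<lambda>(a, b, c) (a', b', c'). idm a a' * R (b, c) (b', c'))"

definition hecke_symmetry :: "'k::field \<Rightarrow> (('n::finite \<times> 'n) \<Rightarrow> ('n \<times> 'n) \<Rightarrow> 'k) \<Rightarrow> bool" where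
  "hecke_symmetry q R \<longleftrightarrow>
     mmul (R_12 R) (mmul (R_23 R) (R_12 R)) = mmul (R_23 R) (mmul (R_12 R) (R_23 R)) \<and>
     mmul (\<lambda>i j. R i j - q * idm i j) (\<lambda>i j. R i j + idm i j) = (\<lambda>i j. 0)"

definition R_relations :: "'k::field \<Rightarrow> (('n::finite \<times> 'n) \<Rightarrow> ('n \<times> 'n) \<Rightarrow> 'k) \<Rightarrow> (('n \<times> 'n) \<Rightarrow> 'k) set" where
  "R_relations q R = mimage (\<lambda>i j. R i j - q * idm i j)"

definition twist_R :: "('n::finite \<Rightarrow> 'n \<Rightarrow> 'k::field) \<Rightarrow> (('n \<times> 'n) \<Rightarrow> ('n \<times> 'n) \<Rightarrow> 'k) \<Rightarrow> ('n \<times> 'n) \<Rightarrow> ('n \<times> 'n) \<Rightarrow> 'k" where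
  "twist_R \<zeta> R = mmul (tensor_op \<zeta> idm) (mmul R (tensor_op (minv \<zeta>) idm))"

definition alt_tensors :: "(('n \<times> 'n) \<Rightarrow> 'k::field) set" where
  "alt_tensors = {(\<lambda>(c, d). x c * y d - y c * x d) | x y. True}"

definition lin_span :: "('i \<Rightarrow> 'k::field) set \<Rightarrow> ('i \<Rightarrow> 'k) set" where
  "lin_span S = {t. \<exists>F c. finite F \<and> F \<subseteq> S \<and> t = (\<lambda>p. \<Sum>s\<in>F. c s * s p)}"

text \<open>Tensor algebra T(V): finitely supported functions on words over the basis 'n;
  the word [a1,...,an] stands for e_a1 tensor ... tensor e_an.\<close>
definition fin_supp :: "('n list \<Rightarrow> 'k::zero) \<Rightarrow> bool" where
  "fin_supp f \<longleftrightarrow> finite {w. f w \<noteq> 0}"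

definition tmul :: "('n list \<Rightarrow> 'k::field) \<Rightarrow> ('n list \<Rightarrow> 'k) \<Rightarrow> 'n list \<Rightarrow> 'k" where
  "tmul a b w = (\<Sum>i\<le>length w. a (take i w) * b (drop i w))"

definition emb2 :: "(('n \<times> 'n) \<Rightarrow> 'k::zero) \<Rightarrow> 'n list \<Rightarrow> 'k" where
  "emb2 t w = (case w of [a, b] \<Rightarrow> t (a, b) | _ \<Rightarrow> 0)"

inductive_set gen_ideal :: "('n list \<Rightarrow> 'k::field) set \<Rightarrow> ('n list \<Rightarrow> 'k) set"
  for G where
  gen: "g \<in> G \<Longrightarrow> g \<in> gen_ideal G"
| zero: "(\<lambda>w. 0) \<in> gen_ideal G"
| add: "x \<in> gen_ideal G \<Longrightarrow> y \<in> gen_ideal G \<Longrightarrow> (\<lambda>w. x w + y w) \<in> gen_ideal G"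
| mult: "x \<in> gen_ideal G \<Longrightarrow> fin_supp a \<Longrightarrow> fin_supp b \<Longrightarrow> tmul a (tmul x b) \<in> gen_ideal G"

definition kernel_SR :: "'k::field \<Rightarrow> (('n::finite \<times> 'n) \<Rightarrow> ('n \<times> 'n) \<Rightarrow> 'k) \<Rightarrow> ('n list \<Rightarrow> 'k) set" where
  "kernel_SR q R = gen_ideal (emb2 ` R_relations q R)"

definition kernel_S :: "('n::finite list \<Rightarrow> 'k::field) set" where
  "kernel_S = gen_ideal (emb2 ` alt_tensors)"

text \<open>The linear map T(V) -> T(V) acting on degree n as Id tensor zeta tensor zeta^2 tensor ...
  tensor zeta^(n-1).  The algebra map T(V) -> S(V)_zeta extending Id_V sends
  v1...vn to v1 * zeta(v2) * ... * zeta^(n-1)(vn) in S(V), hence is the composite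
  T(V) -> T(V) -> S(V) of this map with the canonical projection.\<close>
definition twist_tensor :: "('n::finite \<Rightarrow> 'n \<Rightarrow> 'k::field) \<Rightarrow> ('n list \<Rightarrow> 'k) \<Rightarrow> 'n list \<Rightarrow> 'k" where
  "twist_tensor \<zeta> t w =
     (\<Sum>u\<in>{u. length u = length w}. (\<Prod>i<length w. mpow \<zeta> i (w ! i) (u ! i)) * t u)"

definition kernel_S_twisted :: "('n::finite \<Rightarrow> 'n \<Rightarrow> 'k::field) \<Rightarrow> ('n list \<Rightarrow> 'k) set" where
  "kernel_S_twisted \<zeta> = {t. fin_supp t \<and> twist_tensor \<zeta> t \<in> kernel_S}"

text \<open>The identity of V extends to an algebra isomorphism S(V,R) = S(V)_zeta iff both
  are the same quotient of T(V), i.e. the kernels of the canonical maps from T(V) agree.\<close>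
definition id_extends_to_iso :: "'k::field \<Rightarrow> (('n::finite \<times> 'n) \<Rightarrow> ('n \<times> 'n) \<Rightarrow> 'k) \<Rightarrow> ('n \<Rightarrow> 'n \<Rightarrow> 'k) \<Rightarrow> bool" where
  "id_extends_to_iso q R \<zeta> \<longleftrightarrow> kernel_SR q R = kernel_S_twisted \<zeta>"

end

theory Submission
  imports Defs "HOL-Library.Function_Algebras"
begin

text \<open>Put \<open>A = R - q\<close>, so that \<open>A\<^sup>2 = -(1+q) A\<close>, and let \<open>W = Im A\<close>. The hypothesis says
  \<open>W = (1 \<otimes> \<zeta>\<inverse>) \<Lambda>\<^sup>2V\<close>; hence \<open>A\<close> amounts to a trilinear form \<open>F\<close>, and the claim to
  \<open>F(\<zeta>x, \<zeta>y, \<zeta>z) = det \<zeta> \<cdot> F(x, y, z)\<close>. Since \<open>W \<otimes> V \<inter> V \<otimes> W\<close> is a line spanned by a tensor \<open>\<upsilon>\<close>,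
  the braid equation yields operators \<open>m, m'\<close> on \<open>V\<close> with \<open>A\<^sub>1\<^sub>2A\<^sub>2\<^sub>3 = q + \<upsilon> m\<close> on \<open>W \<otimes> V\<close> and
  \<open>A\<^sub>2\<^sub>3A\<^sub>1\<^sub>2 = q + \<upsilon> m'\<close> on \<open>V \<otimes> W\<close>, and these make \<open>F\<close> cyclically invariant up to powers of \<open>\<zeta>\<close> and an
  operator \<open>\<rho>\<close>. Let \<open>T\<^sub>k\<close> be the form \<open>F(x, \<zeta>\<inverse>y, z)\<close> transformed by \<open>\<zeta>\<^sup>k\<close>. Then \<open>T\<^sub>k\<close> is symmetric in its
  first two arguments up to a multiple of the volume form, the cyclic symmetry takes \<open>T\<^sub>k\<close> to \<open>T\<^sub>k\<^sub>+\<^sub>2\<close>,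
  and \<open>T\<^sub>k\<^sub>+\<^sub>3 = T\<^sub>k\<close>. Playing the transposition off against the 3-cycle, and both against the quadratic
  relation between \<open>T\<^sub>k\<close> and \<open>T\<^sub>k\<^sub>+\<^sub>1\<close> that comes from \<open>A\<^sub>1\<^sub>2A\<^sub>2\<^sub>3 = q + \<upsilon> m\<close>, forces \<open>T\<^sub>1 = T\<^sub>0\<close>.\<close>


section \<open>Vectors and the volume form in dimension 3\<close>

text \<open>Two points stay hidden behind the overview. First, \<rho> comes from an operator
  \<open>G\<close>: moving a vector across \<upsilon> by the braiding applies a multiple of
  \<open>G\<close>, so \<open>G\<close> \<otimes> \<open>G\<close> commutes with \<open>R\<close>
  and preserves \<open>W\<close>. This only gives \<rho> \<zeta>^-1 = \<kappa> \<zeta>^-1 \<rho> for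
  some scalar \<kappa>, and the relations between the \<open>T k\<close> carry powers of \<kappa>
  until \<kappa> = 1 is known. They force \<kappa>^3 = 1; if \<kappa> \<noteq> 1, a fixed vector of
  \<rho> produces an eigenbasis, on which one instance of the quadratic relation fails. Second, the
  quadratic relation is linearized. Applying \<rho>^2 to one argument of each factor raises both
  indices at the cost of volume terms, so subtracting two instances leaves a relation linear in the
  \<open>T k\<close>, and a second subtraction one in the differences of consecutive forms. It kills
  these unless the characteristic is 3 and \<rho> is unipotent. That case is treated separately, and
  so is q = -1, where antisymmetrizing \<open>T k\<close> no longer recovers the volume
  form.\<close>

definition smul :: "'k::field \<Rightarrow> ('n \<Rightarrow> 'k) \<Rightarrow> 'n \<Rightarrow> 'k" (infixr "*v" 75)
  where "c *v x = (\<lambda>i. c * x i)"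

lemma smul_apply: "(c *v x) i = c * x i"
  by (simp add: smul_def)

definition dot :: "('n::finite \<Rightarrow> 'k::field) \<Rightarrow> ('n \<Rightarrow> 'k) \<Rightarrow> 'k"
  where "dot x y = (\<Sum>i\<in>UNIV. x i * y i)"

definition linear_fun :: "(('n \<Rightarrow> 'k::field) \<Rightarrow> 'k) \<Rightarrow> bool" where
  "linear_fun f \<longleftrightarrow> (\<forall>x y. f (x + y) = f x + f y) \<and> (\<forall>c x. f (c *v x) = c * f x)"

definition linear_op :: "(('n \<Rightarrow> 'k::field) \<Rightarrow> 'm \<Rightarrow> 'k) \<Rightarrow> bool" where
  "linear_op f \<longleftrightarrow> (\<forall>x y. f (x + y) = f x + f y) \<and> (\<forall>c x. f (c *v x) = c *v f x)"

definition trilinear :: "(('n \<Rightarrow> 'k::field) \<Rightarrow> ('n \<Rightarrow> 'k) \<Rightarrow> ('n \<Rightarrow> 'k) \<Rightarrow> 'k) \<Rightarrow> bool" where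
  "trilinear f \<longleftrightarrow> (\<forall>y z. linear_fun (\<lambda>x. f x y z)) \<and> (\<forall>x z. linear_fun (\<lambda>y. f x y z))
     \<and> (\<forall>x y. linear_fun (f x y))"

lemma linear_funD:
  assumes "linear_fun f"
  shows "f (x + y) = f x + f y" "f (c *v x) = c * f x" "f (x - y) = f x - f y" "f 0 = 0"
proof -
  show *: "f (x + y) = f x + f y" for x y using assms by (simp add: linear_fun_def)
  show **: "f (c *v x) = c * f x" for c x using assms by (simp add: linear_fun_def)
  show "f (x - y) = f x - f y" using *[of "x - y" y] by simp
  have "f 0 + f 0 = f 0 + 0" using *[of 0 0] by (metis add.right_neutral)
  then show "f 0 = 0" by (simp only: add_left_cancel)
qed

lemma linear_opD:
  assumes "linear_op f"
  shows "f (x + y) = f x + f y" "f (c *v x) = c *v f x" "f (x - y) = f x - f y" "f 0 = 0"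
proof -
  show *: "f (x + y) = f x + f y" for x y using assms by (simp add: linear_op_def)
  show **: "f (c *v x) = c *v f x" for c x using assms by (simp add: linear_op_def)
  show "f (x - y) = f x - f y" using *[of "x - y" y] by simp
  have "f 0 + f 0 = f 0 + 0" using *[of 0 0] by (metis add.right_neutral)
  then show "f 0 = 0" by (simp only: add_left_cancel)
qed

lemma trilinearD:
  assumes "trilinear f"
  shows "f (x + x') y z = f x y z + f x' y z" "f (c *v x) y z = c * f x y z"
    "f (x - x') y z = f x y z - f x' y z" "f 0 y z = 0"
    "f x (y + y') z = f x y z + f x y' z" "f x (c *v y) z = c * f x y z"
    "f x (y - y') z = f x y z - f x y' z" "f x 0 z = 0"
    "f x y (z + z') = f x y z + f x y z'" "f x y (c *v z) = c * f x y z"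
    "f x y (z - z') = f x y z - f x y z'" "f x y 0 = 0"
proof -
  have "linear_fun (\<lambda>x. f x y z)" for y z using assms by (simp add: trilinear_def)
  from linear_funD[OF this] show "f (x + x') y z = f x y z + f x' y z" "f (c *v x) y z = c * f x y z"
    "f (x - x') y z = f x y z - f x' y z" "f 0 y z = 0" .
  have "linear_fun (\<lambda>y. f x y z)" for x z using assms by (simp add: trilinear_def)
  from linear_funD[OF this] show "f x (y + y') z = f x y z + f x y' z" "f x (c *v y) z = c * f x y z"
    "f x (y - y') z = f x y z - f x y' z" "f x 0 z = 0" .
  have "linear_fun (f x y)" for x y using assms by (simp add: trilinear_def)
  from linear_funD[OF this] show "f x y (z + z') = f x y z + f x y z'" "f x y (c *v z) = c * f x y z"
    "f x y (z - z') = f x y z - f x y z'" "f x y 0 = 0" .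
qed

locale three =
  fixes i0 i1 i2 :: "'n::finite"
  assumes distinct: "i0 \<noteq> i1" "i0 \<noteq> i2" "i1 \<noteq> i2"
    and UNIV3: "(UNIV :: 'n set) = {i0, i1, i2}"
begin

lemma sum3: "(\<Sum>i\<in>UNIV. f i) = f i0 + f i1 + (f i2 :: 'b::comm_monoid_add)"
  using distinct by (simp add: UNIV3 add.assoc)

lemma all3: "(\<forall>i. P i) \<longleftrightarrow> P i0 \<and> P i1 \<and> P i2"
  using UNIV3 by (metis UNIV_I empty_iff insert_iff)

lemma eq3: "x = y \<longleftrightarrow> x i0 = y i0 \<and> x i1 = y i1 \<and> x i2 = y i2"
  unfolding fun_eq_iff by (rule all3)

lemma distinct': "i1 \<noteq> i0" "i2 \<noteq> i0" "i2 \<noteq> i1"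
  using distinct by auto

definition crs :: "('n \<Rightarrow> 'k::field) \<Rightarrow> ('n \<Rightarrow> 'k) \<Rightarrow> 'n \<Rightarrow> 'k" where
  "crs x y = (\<lambda>i. if i = i0 then x i1 * y i2 - x i2 * y i1
     else if i = i1 then x i2 * y i0 - x i0 * y i2 else x i0 * y i1 - x i1 * y i0)"

lemma crs_nth:
  "crs x y i0 = x i1 * y i2 - x i2 * y i1"
  "crs x y i1 = x i2 * y i0 - x i0 * y i2"
  "crs x y i2 = x i0 * y i1 - x i1 * y i0"
  using distinct by (auto simp: crs_def)

lemma dot3: "dot x y = x i0 * y i0 + x i1 * y i1 + x i2 * y i2"
  by (simp add: dot_def sum3)

definition vol :: "('n \<Rightarrow> 'k::field) \<Rightarrow> ('n \<Rightarrow> 'k) \<Rightarrow> ('n \<Rightarrow> 'k) \<Rightarrow> 'k" where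
  "vol x y z = dot (crs x y) z"

lemmas coords = vol_def dot3 crs_nth eq3 plus_fun_apply minus_apply uminus_apply zero_fun_apply smul_apply

lemma trilinear_vol: "trilinear (vol :: ('n \<Rightarrow> 'k::field) \<Rightarrow> _)"
  unfolding trilinear_def linear_fun_def by (simp add: coords algebra_simps)

lemma vol_alt [simp]: "vol x x y = 0" "vol x y x = 0" "vol y x x = 0"
  by (simp_all add: coords algebra_simps)

lemma vol_swap: "vol y x z = - vol x y z" "vol x z y = - vol x y z" "vol z y x = - vol x y z"
  by (simp_all add: coords algebra_simps)

lemma vol_cyc: "vol y z x = vol x y z"
  by (simp add: coords algebra_simps)

lemma crs_crs: "crs (crs x y) z = dot x z *v y - dot y z *v x"
  by (simp add: coords algebra_simps)

lemma vol4: "vol b c d *v a - vol a c d *v b + vol a b d *v c - vol a b c *v d = 0"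
  by (simp add: coords algebra_simps)

text \<open>\<open>f\<close> applied to Cramer's relation \<open>vol4\<close>. When
  \<open>f a = 0\<close> and \<open>vol a c d = 1\<close> it expresses \<open>f b\<close> by
  \<open>f c\<close> and \<open>f d\<close>; \<open>D_rho_step\<close> eliminates two auxiliary
  vectors in this way.\<close>

lemma linear_fun_vol4:
  assumes "linear_fun f"
  shows "f a * vol b c d - f b * vol a c d + f c * vol a b d - f d * vol a b c = 0"
proof -
  have "f (vol b c d *v a - vol a c d *v b + vol a b d *v c - vol a b c *v d) = 0"
    using linear_funD(4)[OF assms] by (simp add: vol4)
  then show ?thesis by (simp add: linear_funD[OF assms] mult.commute)
qed

lemma vol_basis: "vol (idm i0) (idm i1) (idm i2) = 1"
  using distinct distinct' by (simp add: coords idm_def)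

lemma vol_eq_0D:
  assumes "\<And>y z. vol x y z = 0"
  shows "x = 0"
  using assms[of "idm i1" "idm i2"] assms[of "idm i2" "idm i0"] assms[of "idm i0" "idm i1"]
    distinct distinct' by (simp add: coords idm_def)

lemma vol_eqI:
  assumes "\<And>x y. vol x y z = vol x y z'"
  shows "z = z'"
  using assms[of "idm i1" "idm i2"] assms[of "idm i2" "idm i0"] assms[of "idm i0" "idm i1"]
    distinct distinct' by (simp add: coords idm_def)

lemma ex_vol_1:
  assumes "x \<noteq> (0 :: 'n \<Rightarrow> 'k::field)"
  obtains y z where "vol x y z = 1"
proof -
  obtain y z where *: "vol x y z \<noteq> 0" using vol_eq_0D[of x] assms by blast
  have "vol x y (inverse (vol x y z) *v z) = 1"
    using * by (simp add: trilinearD[OF trilinear_vol])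
  then show thesis using that by blast
qed

lemma vol_expand:
  "vol x y z *v v = vol v y z *v x + vol x v z *v y + vol x y v *v z"
  by (simp add: coords algebra_simps)

lemma crs_eq_0D:
  assumes "crs x y = 0" and "x \<noteq> 0"
  shows "\<exists>c. y = c *v x"
proof -
  obtain a b where "vol x a b = 1" using ex_vol_1[OF assms(2)] .
  have "vol x y z = 0" for z using assms(1) by (simp add: vol_def dot3)
  then have 1: "vol x a y = 0" "vol x y b = 0" by (simp_all add: vol_swap(2)[of x a y])
  have "vol x a b *v y = vol y a b *v x + vol x y b *v a + vol x a y *v b" by (rule vol_expand)
  then have "y i = (vol y a b *v x) i" for i
    unfolding 1 \<open>vol x a b = 1\<close> by (simp add: smul_def fun_eq_iff)
  then have "y = vol y a b *v x" by (rule ext)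
  then show ?thesis by blast
qed

text \<open>If each vector is an eigenvector, then so is the sum of two basis vectors, and this
  forces their eigenvalues to agree.\<close>

lemma scalar_op:
  assumes f: "linear_op f" and "\<And>x. crs x (f x) = (0 :: 'n \<Rightarrow> 'k::field)"
  shows "\<exists>c. \<forall>x. f x = c *v x"
proof -
  have ei: "idm i \<noteq> (0 :: 'n \<Rightarrow> 'k)" for i by (auto simp: idm_def fun_eq_iff)
  have "\<exists>c. f (idm i) = c *v idm i" for i
    using crs_eq_0D[OF assms(2) ei] by blast
  then obtain c where c: "\<And>i. f (idm i) = c i *v (idm i :: 'n \<Rightarrow> 'k)" by metis
  have add: "f (idm i + idm j) = c i *v idm i + c j *v idm j" for i j
    by (simp add: linear_opD[OF f] c)
  have "c i0 = c i1" "c i0 = c i2"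
    using assms(2)[of "idm i0 + idm i1"] assms(2)[of "idm i0 + idm i2"]
    unfolding add using distinct distinct' by (simp_all add: coords idm_def)
  then have "\<forall>i. c i = c i0" by (intro all3[THEN iffD2]) simp
  then have c0: "c i = c i0" for i by blast
  have "f x = c i0 *v x" for x
  proof -
    have x: "x = x i0 *v idm i0 + x i1 *v idm i1 + x i2 *v idm i2"
      using distinct distinct' by (simp add: coords idm_def)
    have "f x = x i0 *v f (idm i0) + x i1 *v f (idm i1) + x i2 *v f (idm i2)"
      by (subst x) (simp add: linear_opD[OF f])
    also have "\<dots> = c i0 *v x"
      unfolding c c0[of i1] c0[of i2] using distinct distinct' by (simp add: coords idm_def)
    finally show ?thesis .
  qed
  then show ?thesis by blast
qed

end

section \<open>Linear dependence, kernels and nilpotent operators in dimension 3\<close>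

context three
begin

lemma crs_neq_0D:
  assumes "crs x y \<noteq> (0 :: 'n \<Rightarrow> 'k::field)"
  shows "\<exists>z. vol x y z \<noteq> 0"
proof (rule ccontr)
  assume "\<not> ?thesis"
  then have *: "vol x y z = 0" for z by blast
  have "crs x y = 0" using *[of "idm i0"] *[of "idm i1"] *[of "idm i2"] distinct distinct'
    by (simp add: coords idm_def)
  then show False using assms by simp
qed

lemma vol_eq_0_dependent:
  assumes "vol x y z = (0 :: 'k::field)"
  shows "\<exists>a b c. (a, b, c) \<noteq> (0, 0, 0) \<and> a *v x + b *v y + c *v z = 0"
proof (cases "crs y z = 0")
  case True
  show ?thesis
  proof (cases "y = 0")
    case True
    then have "0 *v x + 1 *v y + 0 *v z = 0" by (simp add: smul_def fun_eq_iff)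
    then show ?thesis by (metis prod.inject zero_neq_one)
  next
    case False
    then obtain c where "z = c *v y" using crs_eq_0D[OF \<open>crs y z = 0\<close>] by blast
    then have "0 *v x + c *v y + (- 1) *v z = 0" by (simp add: smul_def fun_eq_iff)
    then show ?thesis by (metis prod.inject zero_neq_one neg_equal_0_iff_equal)
  qed
next
  case False
  then obtain v where "vol y z v \<noteq> 0" using crs_neq_0D by blast
  then have v: "vol v y z \<noteq> 0" by (simp add: vol_cyc)
  have "vol v y z *v x + vol x v z *v y + vol x y v *v z = 0"
    using vol_expand[of x y z v] assms by (simp add: smul_def fun_eq_iff)
  then show ?thesis using v by (metis prod.inject)
qed

lemma singular_op_kernel:
  assumes f: "linear_op (f :: ('n \<Rightarrow> 'k::field) \<Rightarrow> 'n \<Rightarrow> 'k)" and 0: "\<And>x y z. vol (f x) (f y) (f z) = 0"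
  shows "\<exists>x. x \<noteq> 0 \<and> f x = 0"
proof -
  obtain a b c where abc: "(a, b, c) \<noteq> (0, 0, 0)"
    and *: "a *v f (idm i0) + b *v f (idm i1) + c *v f (idm i2) = 0"
    using vol_eq_0_dependent[OF 0] by blast
  define x where "x = a *v idm i0 + b *v idm i1 + c *v (idm i2 :: 'n \<Rightarrow> 'k)"
  have "f x = 0" unfolding x_def by (simp add: linear_opD[OF f] *)
  moreover have "x \<noteq> 0"
    using abc distinct distinct' unfolding x_def by (auto simp: coords idm_def)
  ultimately show ?thesis by blast
qed

text \<open>In dimension 3 a nilpotent operator has at most one Jordan block of size larger than 1.
  If \<open>a\<close> generates that block, then \<open>a\<close>, \<open>f a\<close> and the kernel
  of \<open>f\<close> span the space.\<close>

lemma nilpotent_cyclic: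
  assumes f: "linear_op (f :: ('n \<Rightarrow> 'k::field) \<Rightarrow> 'n \<Rightarrow> 'k)" and fff: "\<And>x. f (f (f x)) = 0"
  shows "\<exists>a. \<forall>v. \<exists>b c. f (v - b *v a - c *v f a) = 0"
proof (cases "\<exists>a. f (f a) \<noteq> 0")
  case True
  then obtain a where a: "f (f a) \<noteq> 0" by blast
  have vol: "vol a (f a) (f (f a)) \<noteq> 0"
  proof
    assume "vol a (f a) (f (f a)) = 0"
    then obtain p q r where nz: "(p, q, r) \<noteq> (0, 0, 0)"
      and e: "p *v a + q *v f a + r *v f (f a) = 0"
      using vol_eq_0_dependent by blast
    have "f (p *v a + q *v f a + r *v f (f a)) = 0" by (simp add: e linear_opD[OF f])
    then have e1: "p *v f a + q *v f (f a) = 0"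
      unfolding linear_opD[OF f] fff by (simp add: smul_def fun_eq_iff)
    have "f (p *v f a + q *v f (f a)) = 0" by (simp add: e1 linear_opD[OF f])
    then have "p *v f (f a) = 0"
      unfolding linear_opD[OF f] fff by (simp add: smul_def fun_eq_iff)
    then have p: "p = 0" using a by (auto simp: smul_def fun_eq_iff)
    then have "q *v f (f a) = 0" using e1 by (simp add: smul_def fun_eq_iff)
    then have q: "q = 0" using a by (auto simp: smul_def fun_eq_iff)
    have "r *v f (f a) = 0" using e p q by (simp add: smul_def fun_eq_iff)
    then have "r = 0" using a by (auto simp: smul_def fun_eq_iff)
    then show False using nz p q by simp
  qed
  let ?d = "vol a (f a) (f (f a))"
  have "f (v - (vol v (f a) (f (f a)) / ?d) *v a - (vol a v (f (f a)) / ?d) *v f a) = 0" for v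
  proof -
    have eq: "v - (vol v (f a) (f (f a)) / ?d) *v a - (vol a v (f (f a)) / ?d) *v f a
      = (vol a (f a) v / ?d) *v f (f a)"
    proof
      fix i
      have "?d * v i = vol v (f a) (f (f a)) * a i + vol a v (f (f a)) * f a i + vol a (f a) v * f (f a) i"
        using vol_expand[of a "f a" "f (f a)" v] by (simp add: smul_def fun_eq_iff)
      then show "(v - (vol v (f a) (f (f a)) / ?d) *v a - (vol a v (f (f a)) / ?d) *v f a) i
        = ((vol a (f a) v / ?d) *v f (f a)) i"
        using vol by (simp add: smul_def field_simps)
    qed
    show ?thesis unfolding eq linear_opD(2)[OF f] fff by (simp add: smul_def fun_eq_iff)
  qed
  then show ?thesis by blast
next
  case False
  then have ff: "f (f x) = 0" for x by blast
  show ?thesis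
  proof (cases "\<exists>a. f a \<noteq> 0")
    case False
    then show ?thesis by simp
  next
    case True
    then obtain a where a: "f a \<noteq> 0" by blast
    have "crs a (f a) \<noteq> 0"
    proof
      assume "crs a (f a) = 0"
      moreover have "a \<noteq> 0" using a linear_opD(4)[OF f] by auto
      ultimately obtain c where c: "f a = c *v a" using crs_eq_0D by blast
      then have "0 = c *v f a" using ff[of a] by (metis linear_opD(2)[OF f])
      then have "c = 0" using a by (auto simp: smul_def fun_eq_iff)
      then show False using a c by (simp add: smul_def fun_eq_iff zero_fun_def)
    qed
    then obtain z where z: "vol a (f a) z \<noteq> 0" using crs_neq_0D by blast
    \<comment> \<open>As f^2 = 0, applying \<open>f\<close> to Cramer's expansion in the basis
      \<open>a\<close>, \<open>f a\<close>, \<open>z\<close> leaves only \<open>f a\<close> and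
      \<open>f z\<close>. Expanding \<open>f z\<close> itself then forces it onto the line of
      \<open>f a\<close>.\<close>
    have "\<exists>b. f z = b *v f a"
    proof -
      have f0: "vol a (f a) z *v f x = vol x (f a) z *v f a + vol a (f a) x *v f z" for x
      proof -
        have "f (vol a (f a) z *v x) = f (vol x (f a) z *v a + vol a x z *v f a + vol a (f a) x *v z)"
          by (rule arg_cong[OF vol_expand])
        then have "vol a (f a) z *v f x = vol x (f a) z *v f a + vol a x z *v 0 + vol a (f a) x *v f z"
          unfolding linear_opD[OF f] ff .
        also have "vol a x z *v 0 = (0 :: 'n \<Rightarrow> 'k)" by (simp add: smul_def fun_eq_iff)
        finally show ?thesis by (simp only: add_0_right)
      qed
      have 1: "vol (f z) (f a) z *v f a + vol a (f a) (f z) *v f z = 0"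
        by (rule trans[OF f0[of "f z", unfolded ff, symmetric]]) (simp add: smul_def fun_eq_iff)
      have 2: "vol a (f a) (f z) = 0"
      proof (rule ccontr)
        assume nz: "vol a (f a) (f z) \<noteq> 0"
        define r where "r = - vol (f z) (f a) z / vol a (f a) (f z)"
        have "f z = r *v f a"
        proof
          fix i
          have "vol (f z) (f a) z * f a i + vol a (f a) (f z) * f z i = 0"
            using 1 by (simp add: smul_def fun_eq_iff)
          then show "f z i = (r *v f a) i"
            using nz unfolding r_def smul_def by (simp add: field_simps eq_neg_iff_add_eq_0)
        qed
        then have "vol a (f a) (f z) = 0" by (simp add: trilinearD[OF trilinear_vol])
        then show False using nz by simp
      qed
      have 3: "vol (f z) (f a) z = 0" using 1 2 a by (auto simp: smul_def fun_eq_iff)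
      have "vol (f a) (f z) x = 0" for x
      proof -
        have "vol a (f a) z *v x = vol x (f a) z *v a + vol a x z *v f a + vol a (f a) x *v z"
          by (rule vol_expand)
        then have "vol (f a) (f z) (vol a (f a) z *v x)
          = vol (f a) (f z) (vol x (f a) z *v a + vol a x z *v f a + vol a (f a) x *v z)" by simp
        moreover have "vol (f a) (f z) a = 0" using 2 by (simp add: vol_cyc[of "f a" "f z" a])
        moreover have "vol (f a) (f z) z = 0" using 3 by (simp add: vol_swap(1)[of "f z"])
        ultimately show ?thesis using z by (simp add: trilinearD[OF trilinear_vol])
      qed
      then have "crs (f a) (f z) = 0" using crs_neq_0D by blast
      then show ?thesis using crs_eq_0D a by blast
    qed
    then obtain b where b: "f z = b *v f a" by blast
    let ?d = "vol a (f a) z"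
    have "f (v - ((vol v (f a) z + vol a (f a) v * b) / ?d) *v a - 0 *v f a) = 0" for v
    proof -
      have "?d *v f v = vol v (f a) z *v f a + vol a (f a) v *v f z"
      proof -
        have "f (?d *v v) = f (vol v (f a) z *v a + vol a v z *v f a + vol a (f a) v *v z)"
          by (rule arg_cong[OF vol_expand])
        then have "?d *v f v = vol v (f a) z *v f a + vol a v z *v 0 + vol a (f a) v *v f z"
          unfolding linear_opD[OF f] ff .
        also have "vol a v z *v 0 = (0 :: 'n \<Rightarrow> 'k)" by (simp add: smul_def fun_eq_iff)
        finally show ?thesis by (simp only: add_0_right)
      qed
      then have "?d * f v i = vol v (f a) z * f a i + vol a (f a) v * (b * f a i)" for i
        unfolding b by (simp add: smul_def fun_eq_iff)
      then show ?thesis using z unfolding linear_opD[OF f] ff by (simp add: smul_def fun_eq_iff field_simps)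
    qed
    then show ?thesis by blast
  qed
qed

text \<open>The characteristic polynomial is X^3 - t X^2 + t X - 1, because for determinant 1 its
  linear coefficient is the trace of the inverse. Hence 1 is a root.\<close>

lemma ex_fixed_vector:
  assumes rho: "linear_op \<rho>" and rhoi: "linear_op \<rho>i"
    and rr: "\<And>x. \<rho> (\<rho>i x) = x" "\<And>x. \<rho>i (\<rho> x) = (x :: 'n \<Rightarrow> 'k::field)"
    and tr: "\<And>x y z. vol (\<rho> x) y z + vol x (\<rho> y) z + vol x y (\<rho> z) = t * vol x y z"
    and tri: "\<And>x y z. vol (\<rho>i x) y z + vol x (\<rho>i y) z + vol x y (\<rho>i z) = t * vol x y z"
    and det: "\<And>x y z. vol (\<rho> x) (\<rho> y) (\<rho> z) = vol x y z"
  obtains x where "x \<noteq> 0" "\<rho> x = x"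
proof -
  have cof: "vol (\<rho> a) (\<rho> b) c = vol a b (\<rho>i c)" "vol (\<rho> a) b (\<rho> c) = vol a (\<rho>i b) c"
    "vol a (\<rho> b) (\<rho> c) = vol (\<rho>i a) b c" for a b c
    using det[of a b "\<rho>i c"] det[of a "\<rho>i b" c] det[of "\<rho>i a" b c] by (simp_all add: rr)
  have N: "linear_op (\<lambda>x. \<rho> x - x)" unfolding linear_op_def linear_opD[OF rho]
    by (simp add: smul_def fun_eq_iff algebra_simps)
  have "vol (\<rho> x - x) (\<rho> y - y) (\<rho> z - z) = 0" for x y z
    using tr[of x y z] tri[of x y z]
    unfolding trilinearD[OF trilinear_vol] cof linear_opD[OF rhoi] rr by algebra
  then obtain x where "x \<noteq> 0" "\<rho> x - x = 0" using singular_op_kernel[OF N] by blast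
  then show thesis using that by simp
qed

end

section \<open>Systems of cyclically related trilinear forms\<close>

text \<open>These are the properties of the forms of \<open>hecke_maps\<close> once the twist scalar
  is 1; \<open>F_invariant\<close> interprets the locale. \<open>tr\<close> and \<open>tri'\<close>
  say that \<rho> and its inverse have the same trace \<open>t\<close>, \<open>TI\<close> is the
  cyclic symmetry, and \<open>TII\<close> is the quadratic relation. By \<open>per\<close> the
  indices matter modulo 3.\<close>

locale cyclic_forms = three i0 i1 i2 for i0 i1 i2 :: "'n::finite" +
  fixes T :: "nat \<Rightarrow> ('n \<Rightarrow> 'k::field) \<Rightarrow> ('n \<Rightarrow> 'k) \<Rightarrow> ('n \<Rightarrow> 'k) \<Rightarrow> 'k"
    and \<rho> \<rho>i :: "('n \<Rightarrow> 'k) \<Rightarrow> 'n \<Rightarrow> 'k" and q t :: 'k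
  assumes two: "(2::'k) \<noteq> 0" and q: "q \<noteq> 0" and t: "q * t = 1 + q + q\<^sup>2"
    and tri: "\<And>k. trilinear (T k)" and nz: "\<exists>a b c. T 0 a b c \<noteq> 0"
    and rho: "linear_op \<rho>" and rhoi: "linear_op \<rho>i"
    and rr: "\<And>x. \<rho> (\<rho>i x) = x" "\<And>x. \<rho>i (\<rho> x) = x"
    and tr: "\<And>x y z. vol (\<rho> x) y z + vol x (\<rho> y) z + vol x y (\<rho> z) = t * vol x y z"
    and tri': "\<And>x y z. vol (\<rho>i x) y z + vol x (\<rho>i y) z + vol x y (\<rho>i z) = t * vol x y z"
    and per: "\<And>k. T (Suc (Suc (Suc k))) = T k"
    and T0: "\<And>k a b c. T k a b c - T k b a c = - (1 + q) * vol a b c"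
    and TI: "\<And>k a b c. T k a b c = T (Suc (Suc k)) c (\<rho> a) b"
    and TII: "\<And>k x y v c d e. T (Suc k) y v d * T k x e c - T (Suc k) y v e * T k x d c
        - T (Suc k) x v d * T k y e c + T (Suc k) x v e * T k y d c
        = q * (vol x y c * vol d e v + vol x y (\<rho>i v) * vol d e c)"
begin

abbreviation "s \<equiv> - (1 + q)"

lemmas T_simps = trilinearD[OF tri] and vol_simps = trilinearD[OF trilinear_vol]
  and rho_simps = linear_opD[OF rho]

lemma swap12: "T k a b c = T k b a c + s * vol a b c"
  using T0[of k a b c] by (simp add: algebra_simps)

text \<open>The 3-cycle \<open>TI\<close> composed with the first transposition is the second
  transposition, except that it also applies \<rho> and raises the index by 2.\<close>

lemma swap23: "T k a b c = T (Suc (Suc k)) (\<rho> a) c b + s * vol (\<rho> a) b c"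
  using TI[of k a b c] swap12[of "Suc (Suc k)" c "\<rho> a" b] by (simp add: vol_cyc[of "\<rho> a" b c, symmetric])

text \<open>Exchanging the last two arguments is an involution, but its realization
  \<open>swap23\<close> carried out twice applies \<rho>^2 and raises the index by 4, that is by 1
  modulo 3. All index shifts below originate here.\<close>

lemma sq1: "T (Suc k) (\<rho> (\<rho> a)) b c = T k a b c + s * (vol (\<rho> (\<rho> a)) b c - vol (\<rho> a) b c)"
  using swap23[of k a b c] swap23[of "Suc (Suc k)" "\<rho> a" c b]
  by (simp add: per vol_swap(2)[of _ b c] algebra_simps)

lemma sq2: "T (Suc k) a (\<rho> (\<rho> b)) c = T k a b c + s * (vol a (\<rho> b) c - vol a b c)"
  using sq1[of k b a c] swap12[of k a b c] swap12[of "Suc k" a "\<rho> (\<rho> b)" c]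
  by (simp add: vol_swap(1)[of a] algebra_simps)

lemma sq3: "T (Suc k) a b (\<rho> (\<rho> c)) = T k a b c + s * (vol (\<rho> a) b (\<rho> (\<rho> c)) - vol (\<rho> a) b (\<rho> c))"
proof -
  have "T (Suc k) a b (\<rho> (\<rho> c)) = T (Suc (Suc (Suc k))) (\<rho> (\<rho> c)) (\<rho> a) b"
    by (rule TI)
  also have "\<dots> = T (Suc (Suc k)) c (\<rho> a) b + s * (vol (\<rho> (\<rho> c)) (\<rho> a) b - vol (\<rho> c) (\<rho> a) b)"
    by (rule sq1)
  finally show ?thesis using TI[of k a b c] by (simp add: vol_cyc[of "\<rho> a" b, symmetric])
qed

lemma rho_rho_rho: "T k (\<rho> a) (\<rho> b) (\<rho> c) = T k a b c"
  using TI[of k a b c] TI[of "Suc (Suc k)" c "\<rho> a" b] TI[of "Suc (Suc (Suc (Suc k)))" b "\<rho> c" "\<rho> a"]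
  by (simp add: per)

text \<open>The repeated arguments kill both volume terms of \<open>TII\<close>;
  \<open>char_three\<close> evaluates this on selected pairs.\<close>

lemma TQ: "T (Suc k) y x x * T k x y x - T (Suc k) y x y * T k x x x
    - T (Suc k) x x x * T k y y x + T (Suc k) x x y * T k y x x = 0"
  using TII[of k y x x x y x] by simp

text \<open>For q = -1 the volume terms in \<open>sq1\<close>, \<open>sq2\<close>,
  \<open>sq3\<close> disappear, so \<rho>^2 in any argument is exactly an index shift. Shifting
  \<open>v\<close> and \<open>c\<close> in \<open>TII\<close> reproduces its left side, and
  comparing the right sides gives an identity between volumes that makes \<rho>^2 a scalar
  \<open>l\<close>.\<close>

lemma case_minus_one:
  assumes "q = - 1"
  shows "T 1 = T 0"
proof -
  define \<theta> where "\<theta> x = \<rho> (\<rho> x)" for x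
  have lin: "linear_op \<theta>" unfolding linear_op_def \<theta>_def by (simp add: rho_simps)
  have T1: "T (Suc k) (\<theta> a) b c = T k a b c" for k a b c using sq1[of k a b c] assms by (simp add: \<theta>_def)
  have T2: "T (Suc k) a (\<theta> b) c = T k a b c" for k a b c using sq2[of k a b c] assms by (simp add: \<theta>_def)
  have T3: "T (Suc k) a b (\<theta> c) = T k a b c" for k a b c using sq3[of k a b c] assms by (simp add: \<theta>_def)
  have ri: "\<rho>i (\<theta> v) = \<rho> v" for v by (simp add: \<theta>_def rr)
  have eq: "vol x y (\<theta> c) * vol d e (\<theta> v) + vol x y (\<rho> v) * vol d e (\<theta> c)
     = vol x y c * vol d e v + vol x y (\<rho>i v) * vol d e c" for x y c d e v
    using TII[of 1 y "\<theta> v" d x e "\<theta> c"] TII[of 0 y v d x e c] q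
    by (simp add: T2[of 1, simplified] T2[of 0, simplified] T3[of 0, simplified] T3[of 1, simplified] ri)
  have "crs c (\<theta> c) = 0" for c
  proof (rule ccontr)
    assume "crs c (\<theta> c) \<noteq> 0"
    then obtain z where z: "vol c (\<theta> c) z \<noteq> 0" using crs_neq_0D by blast
    have "vol c z (\<theta> c) * vol c (\<theta> c) z = 0"
      using eq[of c z c c "\<theta> c" "\<rho>i (\<rho>i z)"] by (simp add: \<theta>_def rr)
    then show False using z by (simp add: vol_swap(2)[of c z "\<theta> c"])
  qed
  then obtain l where l: "\<And>x. \<theta> x = l *v x" using scalar_op[OF lin] by blast
  have "vol (idm i1) (idm i2) (idm i0) = (1::'k)" "vol (idm i2) (idm i0) (idm i1) = (1::'k)"
    using vol_basis vol_cyc by metis+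
  then have l2: "l * l = 1"
    using eq[of "idm i1" "idm i2" "idm i0" "idm i2" "idm i0" "idm i1"]
    by (simp add: l vol_simps)
  have Tl: "T k a b c = l * T (Suc k) a b c" for k a b c
    using T1[of k a b c] by (simp add: l T_simps)
  obtain a b c where nz: "T 0 a b c \<noteq> 0" using nz by blast
  \<comment> \<open>Period 3 gives l^3 = 1, which together with l^2 = 1 leaves l = 1.\<close>
  have "T 0 a b c = l * (l * (l * T 0 a b c))"
    using Tl[of 0 a b c] Tl[of "Suc 0" a b c] Tl[of "Suc (Suc 0)" a b c] per[of 0] by simp
  then have "l = 1" using nz l2 by (simp add: mult.assoc[symmetric])
  then show ?thesis using Tl[of 0] by (simp add: fun_eq_iff)
qed

end

section \<open>The case q \<noteq> -1: differences of consecutive forms\<close>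

context cyclic_forms
begin

lemma s_neq_0: "q \<noteq> - 1 \<Longrightarrow> s \<noteq> 0"
  by (metis add.commute eq_neg_iff_add_eq_0 neg_equal_0_iff_equal)

text \<open>Three cyclic steps make the form invariant under \<rho>; its antisymmetrization, a
  nonzero multiple of \<open>vol\<close>, inherits this.\<close>

lemma vol_rho:
  assumes "q \<noteq> - 1"
  shows "vol (\<rho> a) (\<rho> b) (\<rho> c) = vol a b c"
proof -
  have s: "s \<noteq> 0" using assms by (rule s_neq_0)
  have "s * vol (\<rho> a) (\<rho> b) (\<rho> c) = s * vol a b c"
    using T0[of 0 a b c] T0[of 0 "\<rho> a" "\<rho> b" "\<rho> c"] by (simp only: rho_rho_rho)
  then show ?thesis using s by (simp only: mult_cancel_left) simp
qed

lemma vol_cofactor: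
  assumes "q \<noteq> - 1"
  shows "vol (\<rho> a) (\<rho> b) c = vol a b (\<rho>i c)" "vol (\<rho> a) b (\<rho> c) = vol a (\<rho>i b) c"
    "vol a (\<rho> b) (\<rho> c) = vol (\<rho>i a) b c"
  using vol_rho[OF assms, of a b "\<rho>i c"] vol_rho[OF assms, of a "\<rho>i b" c]
    vol_rho[OF assms, of "\<rho>i a" b c] by (simp_all add: rr)

lemma fixed_vector:
  assumes "q \<noteq> - 1"
  obtains c0 where "c0 \<noteq> 0" "\<rho> c0 = c0"
  using ex_fixed_vector[OF rho rhoi rr tr tri' vol_rho[OF assms]] .

lemma cayley_hamilton:
  assumes "q \<noteq> - 1"
  shows "\<rho> (\<rho> z) - \<rho>i z = t *v (\<rho> z - z)"
proof (rule vol_eqI)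
  fix x y
  show "vol x y (\<rho> (\<rho> z) - \<rho>i z) = vol x y (t *v (\<rho> z - z))"
    using tr[of x y "\<rho> z"] tri'[of x y z]
    unfolding vol_simps vol_cofactor[OF assms] rr by algebra
qed

definition "D k a b c = T (Suc k) a b c - T k a b c"

lemma D_per: "D (Suc (Suc (Suc k))) = D k"
  by (simp add: D_def per fun_eq_iff)

lemma trilinear_D: "trilinear (D k)"
  unfolding trilinear_def linear_fun_def D_def by (simp add: T_simps algebra_simps)

lemmas D_simps = trilinearD[OF trilinear_D]

lemma D_swap12: "D k a b c = D k b a c"
  using swap12[of k a b c] swap12[of "Suc k" a b c] by (simp add: D_def)

lemma D_sq1: "D (Suc k) (\<rho> (\<rho> a)) b c = D k a b c"
  using sq1[of k a b c] sq1[of "Suc k" a b c] by (simp add: D_def)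

lemma D_sq2: "D (Suc k) a (\<rho> (\<rho> b)) c = D k a b c"
  using sq2[of k a b c] sq2[of "Suc k" a b c] by (simp add: D_def)

lemma D_sq3: "D (Suc k) a b (\<rho> (\<rho> c)) = D k a b c"
  using sq3[of k a b c] sq3[of "Suc k" a b c] by (simp add: D_def)

text \<open>At a fixed vector the two volume terms of each shift relation cancel, and what remains
  is T_(k+1) = T_k.\<close>

lemma D_fixed:
  assumes "\<rho> c0 = c0"
  shows "D k c0 b c = 0" "D k a c0 c = 0" "D k a b c0 = 0"
  using sq1[of k c0 b c] sq2[of k a c0 c] sq3[of k a b c0] by (simp_all add: D_def assms)

lemma D_swap23: "D k a b c = D k (\<rho> (\<rho> (\<rho> a))) c b"
proof -
  have "D k a b c = D (Suc (Suc k)) (\<rho> a) c b"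
    using swap23[of k a b c] swap23[of "Suc k" a b c] by (simp add: D_def)
  also have "\<dots> = D (Suc (Suc (Suc k))) (\<rho> (\<rho> (\<rho> a))) c b" by (simp only: D_sq1)
  finally show ?thesis by (simp add: D_per)
qed

lemma D_sum: "D k a b c + D (Suc k) a b c + D (Suc (Suc k)) a b c = 0"
  by (simp add: D_def per)

text \<open>Replacing \<open>v\<close>, \<open>c\<close> by their images under \<rho>^2 and
  \<open>k\<close> by k + 1 changes every factor of \<open>TII\<close> by a volume term. Subtracting
  the original instance removes the products of two forms. The remaining relation \<open>P\<close>
  is linear in the forms, and its right side does not depend on k, so subtracting it for k from that
  for k + 1 gives a homogeneous relation for \<open>D\<close>.\<close>

lemma D_TII:
  "(vol y (\<rho> v) d - vol y v d) * D k x e c + D (Suc k) y v d * (vol (\<rho> x) e (\<rho> (\<rho> c)) - vol (\<rho> x) e (\<rho> c))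
    - ((vol y (\<rho> v) e - vol y v e) * D k x d c + D (Suc k) y v e * (vol (\<rho> x) d (\<rho> (\<rho> c)) - vol (\<rho> x) d (\<rho> c)))
    - ((vol x (\<rho> v) d - vol x v d) * D k y e c + D (Suc k) x v d * (vol (\<rho> y) e (\<rho> (\<rho> c)) - vol (\<rho> y) e (\<rho> c)))
    + ((vol x (\<rho> v) e - vol x v e) * D k y d c + D (Suc k) x v e * (vol (\<rho> y) d (\<rho> (\<rho> c)) - vol (\<rho> y) d (\<rho> c))) = 0"
  if "q \<noteq> - 1"
proof -
  define u where "u y d = vol y (\<rho> v) d - vol y v d" for y d
  define w where "w x e = vol (\<rho> x) e (\<rho> (\<rho> c)) - vol (\<rho> x) e (\<rho> c)" for x e
  have s: "s \<noteq> 0" using that by (rule s_neq_0)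
  have A: "T (Suc k) y (\<rho> (\<rho> v)) d = T k y v d + s * u y d" for k y d
    unfolding sq2 u_def by simp
  have B: "T (Suc k) x e (\<rho> (\<rho> c)) = T k x e c + s * w x e" for k x e
    unfolding sq3 w_def by simp
  define P where "P k = s * (u y d * T k x e c + T (Suc k) y v d * w x e
    - (u y e * T k x d c + T (Suc k) y v e * w x d)
    - (u x d * T k y e c + T (Suc k) x v d * w y e)
    + (u x e * T k y d c + T (Suc k) x v e * w y d))" for k
  have P: "P k =
      q * (vol x y (\<rho> (\<rho> c)) * vol d e (\<rho> (\<rho> v)) + vol x y (\<rho>i (\<rho> (\<rho> v))) * vol d e (\<rho> (\<rho> c)))
      - q * (vol x y c * vol d e v + vol x y (\<rho>i v) * vol d e c)
      - s * s * (u y d * w x e - u y e * w x d - u x d * w y e + u x e * w y d)" for k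
    unfolding TII[of "Suc k" y "\<rho> (\<rho> v)" d x e "\<rho> (\<rho> c)", symmetric]
      TII[of k y v d x e c, symmetric] A B P_def
    by (simp only: algebra_simps)
  have "s * (u y d * D k x e c + D (Suc k) y v d * w x e
    - (u y e * D k x d c + D (Suc k) y v e * w x d)
    - (u x d * D k y e c + D (Suc k) x v d * w y e)
    + (u x e * D k y d c + D (Suc k) x v e * w y d)) = P (Suc k) - P k"
    unfolding P_def D_def by (simp only: algebra_simps)
  also have "\<dots> = 0" by (simp only: P) simp
  finally have "s * (u y d * D k x e c + D (Suc k) y v d * w x e
    - (u y e * D k x d c + D (Suc k) y v e * w x d)
    - (u x d * D k y e c + D (Suc k) x v d * w y e)
    + (u x e * D k y d c + D (Suc k) x v e * w y d)) = 0" .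
  then have "u y d * D k x e c + D (Suc k) y v d * w x e
    - (u y e * D k x d c + D (Suc k) y v e * w x d)
    - (u x d * D k y e c + D (Suc k) x v d * w y e)
    + (u x e * D k y d c + D (Suc k) x v e * w y d) = 0"
    using s by (simp only: mult_eq_0_iff) blast
  then show ?thesis unfolding u_def w_def .
qed

text \<open>In \<open>D_TII\<close> let \<open>x\<close> be a fixed vector of \<rho>: every term in
  which \<open>D\<close> sees \<open>x\<close> drops out, and \<open>linear_fun_vol4\<close>
  contracts the remaining ones over \<open>d\<close> and \<open>e\<close>.\<close>

lemma D_rho_step:
  assumes q1: "q \<noteq> - 1"
  shows "D k y (\<rho> v) c - D k y v c = D (Suc k) y v (\<rho> (\<rho> c)) - D (Suc k) y v (\<rho> c)"
proof -
  obtain c0 where c0: "c0 \<noteq> 0" "\<rho> c0 = c0" using fixed_vector[OF q1] .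
  obtain d e where de: "vol c0 d e = 1" using ex_vol_1[OF c0(1)] .
  define w where "w = \<rho> (\<rho> c) - \<rho> c"
  define u where "u = \<rho> v - v"
  have 1: "D (Suc k) y v d * vol c0 e w - D (Suc k) y v e * vol c0 d w
    - (vol c0 u d * D k y e c - vol c0 u e * D k y d c) = 0"
    using D_TII[OF q1, of y v d k c0 e c] by (simp add: D_fixed[OF c0(2)] c0(2) u_def w_def vol_simps algebra_simps)
  have "linear_fun (\<lambda>x. D k y x c)" using trilinear_D by (simp add: trilinear_def)
  from linear_fun_vol4[OF this, of c0 u d e]
  have 2: "D k y d c * vol c0 u e - D k y e c * vol c0 u d = D k y u c"
    by (simp add: D_fixed[OF c0(2)] de algebra_simps)
  have "linear_fun (D (Suc k) y v)" using trilinear_D by (simp add: trilinear_def)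
  from linear_fun_vol4[OF this, of c0 w d e]
  have 3: "D (Suc k) y v d * vol c0 w e - D (Suc k) y v e * vol c0 w d = D (Suc k) y v w"
    by (simp add: D_fixed[OF c0(2)] de algebra_simps)
  have "D k y u c = D (Suc k) y v w" using 1 2 3
    by (simp add: vol_swap(2)[of c0 w] algebra_simps)
  then show ?thesis by (simp add: u_def w_def D_simps)
qed

text \<open>\<open>D_rho_step\<close> combined with the shift \<open>D_sq3\<close> gives the first
  relation, which treats the last two arguments unequally. \<open>D_swap23\<close> yields its mirror
  image, and the difference of the two is twice the second relation, so 2 has to be invertible.
  Together they let (\<rho> - 1)^2 annihilate the middle argument.\<close>

lemma D_quadratic:
  assumes q1: "q \<noteq> - 1"
  shows "D k y (\<rho> v) (\<rho> c) - 2 * D k y v (\<rho> c) + D k y v c = 0"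
    "D k y (\<rho> v) c = D k y v (\<rho> c)"
    "D k y (\<rho> (\<rho> v)) c - 2 * D k y (\<rho> v) c + D k y v c = 0"
proof -
  have *: "D k y (\<rho> v) (\<rho> c) - 2 * D k y v (\<rho> c) + D k y v c = 0" for k y v c
  proof -
    have 1: "D (Suc k) y (\<rho> v) (\<rho> (\<rho> c)) - D (Suc k) y v (\<rho> (\<rho> c))
      = D (Suc k) y v (\<rho> (\<rho> c)) - D (Suc k) y v (\<rho> c)" for k c
      using D_rho_step[OF q1, of k y v c] by (simp only: D_sq3)
    \<comment> \<open>\<open>1\<close> concerns successor indices only; three steps up is the same
      form by \<open>D_per\<close>.\<close>
    have "D (Suc (Suc (Suc k))) y (\<rho> v) (\<rho> (\<rho> (\<rho>i c))) - D (Suc (Suc (Suc k))) y v (\<rho> (\<rho> (\<rho>i c)))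
      = D (Suc (Suc (Suc k))) y v (\<rho> (\<rho> (\<rho>i c))) - D (Suc (Suc (Suc k))) y v (\<rho> (\<rho>i c))"
      by (rule 1)
    then show ?thesis by (simp add: rr D_per algebra_simps)
  qed
  then show "D k y (\<rho> v) (\<rho> c) - 2 * D k y v (\<rho> c) + D k y v c = 0" .
  have **: "D k y (\<rho> v) (\<rho> c) - 2 * D k y (\<rho> v) c + D k y v c = 0" for v c
    using *[of k "\<rho> (\<rho> (\<rho> y))" c v] by (simp only: D_swap23[symmetric])
  have "2 * (D k y (\<rho> v) c - D k y v (\<rho> c)) = 0" for v c using *[of k y v c] **[of v c] by algebra
  then have eq: "D k y (\<rho> v) c = D k y v (\<rho> c)" for v c using two by simp
  then show "D k y (\<rho> v) c = D k y v (\<rho> c)" .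
  show "D k y (\<rho> (\<rho> v)) c - 2 * D k y (\<rho> v) c + D k y v c = 0"
    using **[of v c] eq[of "\<rho> v" c] by simp
qed

text \<open>The characteristic polynomial factors as (X - 1)(X^2 + (1 - t) X + 1), so
  \<open>u\<close> is fixed by \<rho> and \<open>D\<close> vanishes on it. Subtracting the
  annihilating (X - 1)^2 from the second factor leaves (3 - t) X.\<close>

lemma D_vanish:
  assumes q1: "q \<noteq> - 1"
  shows "(3 - t) * D k y v c = 0"
proof -
  define z where "z = \<rho>i v"
  define u where "u = \<rho> (\<rho> z) + (1 - t) *v \<rho> z + z"
  have ch: "\<rho> (\<rho> (\<rho> z)) = z + t *v (\<rho> (\<rho> z) - \<rho> z)"
    using cayley_hamilton[OF q1, of "\<rho> z"] by (simp only: rr) (simp add: algebra_simps)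
  have "\<rho> u = u" unfolding u_def rho_simps ch by (simp add: smul_def fun_eq_iff algebra_simps)
  then have "D k y u c = 0" by (rule D_fixed)
  then have "D k y (\<rho> (\<rho> z)) c + (1 - t) * D k y (\<rho> z) c + D k y z c = 0"
    by (simp add: u_def D_simps)
  then have "(3 - t) * D k y (\<rho> z) c = 0"
    using D_quadratic(3)[OF q1, of k y z c] by algebra
  then show ?thesis by (simp add: z_def rr)
qed

end

section \<open>Characteristic 3 and the equality of the forms\<close>

context cyclic_forms
begin

text \<open>By \<open>D_quadratic(3)\<close> the value of D_(k+2) at \<rho>^n b is affine in n, and
  by \<open>D_sq2\<close> its values for n = 0, 2, 4 are those of D_(k+2), D_(k+1), D_k at b. These
  form an arithmetic progression, and its sum is 0 by telescoping, so three times the middle term is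
  0.\<close>

lemma D_three:
  assumes "q \<noteq> - 1"
  shows "3 * D k a b c = 0"
proof -
  have 1: "3 * D (Suc k) a b c = 0" for k
    using D_quadratic(3)[OF assms, of "Suc (Suc k)" a b c]
      D_quadratic(3)[OF assms, of "Suc (Suc k)" a "\<rho> b" c]
      D_quadratic(3)[OF assms, of "Suc (Suc k)" a "\<rho> (\<rho> b)" c]
      D_sq2[of k a b c] D_sq2[of "Suc k" a b c] D_sq2[of "Suc k" a "\<rho> (\<rho> b)" c] D_sum[of k a b c]
    by algebra
  show ?thesis using 1[of "Suc (Suc k)"] by (simp only: D_per)
qed

text \<open>With \<open>N = \<rho> - 1\<close> nilpotent, the linear relations leave only the values \<open>D k a a (N a)\<close> and
  \<open>D k a a a\<close> undetermined; evaluating the quadratic relation on the pairs \<open>(a, N\<^sup>2a)\<close>, \<open>(Na, a)\<close> and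
  \<open>(a, Na)\<close> kills them.\<close>
lemma char_three:
  assumes q1: "q \<noteq> - 1" and t3: "t = 3" and three: "(3::'k) = 0"
  shows "D k x y z = 0"
proof -
  \<comment> \<open>In characteristic 3 the polynomial 1 + q + q^2 is (q - 1)^2.\<close>
  have "(q - 1) * (q - 1) = 0" using t t3 by (simp add: power2_eq_square algebra_simps)
  then have q: "q = 1" by simp
  have two': "(2::'k) = - 1" using three by (simp add: eq_neg_iff_add_eq_0)
  have r3: "\<rho> (\<rho> (\<rho> x)) = x" for x
    using cayley_hamilton[OF q1, of "\<rho> x"] t3 three by (simp add: rr smul_def fun_eq_iff)
  have D23: "D k a b c = D k a c b" for k a b c using D_swap23[of k a b c] by (simp only: r3)
  note D12 = D_swap12
  define N where "N x = \<rho> x - x" for x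
  have rN: "\<rho> x = x + N x" for x by (simp add: N_def)
  have N: "linear_op N" unfolding linear_op_def N_def rho_simps
    by (simp add: smul_def fun_eq_iff algebra_simps)
  have N3: "N (N (N x)) = 0" for x
  proof -
    have "N (N (N x)) = \<rho> (\<rho> (\<rho> x)) - x - 3 *v (\<rho> (\<rho> x)) + 3 *v (\<rho> x)"
      unfolding N_def rho_simps by (simp add: smul_def fun_eq_iff algebra_simps)
    then show ?thesis by (simp add: r3 three smul_def fun_eq_iff)
  qed
  have DN: "D k x (N y) z = D k x y (N z)" for k x y z
    unfolding N_def D_simps by (simp add: D_quadratic(2)[OF q1])
  have DNN: "D k x y (N (N z)) = 0" for k x y z
  proof -
    have "D k x (N (N z)) y = 0"
      using D_quadratic(3)[OF q1, of k x z y] unfolding N_def D_simps rho_simps by algebra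
    then show ?thesis by (simp only: D23[of k x y])
  qed
  have DS: "D (Suc k) x y (N z) = D k x y (N z)" for k x y z
    using D_sq3[of k x y "N z"] unfolding rN linear_opD[OF N] D_simps by (simp add: DNN N3 D_simps)
  have DS': "D k x y z = D (Suc k) x y z + 2 * D k x y (N z)" for k x y z
    using D_sq3[of k x y z] unfolding rN linear_opD[OF N] D_simps DNN DS
    by (metis mult_2 add_0_right add.assoc)
  \<comment> \<open>Since \<rho>^2 (N a) = N a + 2 N^2 a, \<open>sq1\<close> at \<open>N a\<close>
    determines the form on the image of N^2, with s = 1 here; \<open>TN1\<close> repeats this at
    \<open>a\<close>. The multiple of 3 makes the characteristic available to
    \<open>algebra\<close>.\<close>
  have TN2: "T (Suc k) (N (N a)) b c = D k (N a) b c - vol (N (N a)) b c" for k a b c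
  proof -
    have "3 * (T (Suc k) (N (N a)) b c + vol (N (N a)) b c) = 0" by (simp add: three)
    then show ?thesis using sq1[of k "N a" b c]
      unfolding D_def q rN linear_opD[OF N] N3 T_simps vol_simps add_0_right by algebra
  qed
  have TN1: "T (Suc k) (N a) b c = D k (N a) b c + D k a b c - vol (N a) b c - 2 * vol (N (N a)) b c" for k a b c
  proof -
    have "3 * (T (Suc k) (N a) b c + vol (N a) b c + vol (N (N a)) b c) = 0" by (simp add: three)
    then show ?thesis using sq1[of k a b c] TN2[of k a b c]
      unfolding D_def[of k a b c] q rN linear_opD[OF N] N3 T_simps vol_simps add_0_right by algebra
  qed
  have sw: "T k y x z = T k x y z + 2 * vol x y z" for k x y z
    using swap12[of k x y z] unfolding q by (simp add: algebra_simps)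
  have TI': "T (Suc (Suc k)) a b c = T (Suc k) c (a + N a) b" for k a b c
    using TI[of "Suc (Suc k)" a b c] by (simp only: per rN)
  have E: "D k a a (N a) = 0" for k a
  proof -
    define f g V E where f: "f = N a" and g: "g = N (N a)" and V: "V = vol g f a" and E: "E = D k a a f"
    have Df: "D k u f f = 0" "D k f u f = 0" "D k f f u = 0" and Dg: "D k u v g = 0" "D k u g v = 0" for u v
      unfolding f g using DN[of k u a "N a"] DNN D12 D23 by metis+
    have Ef: "D k a f a = E" "D k f a a = E" "D k a a f = E" unfolding E using D12 D23 by metis+
    have DSf: "D (Suc k) u v f = D k u v f" "D (Suc k) u f v = D k u v f" "D (Suc k) f u v = D k u v f" for u v
      unfolding f using DS D12 D23 by metis+
    have DSg: "D (Suc k) u v g = 0" "D (Suc k) u g v = 0" for u v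
      unfolding g using DNN D23 by metis+
    have Tg: "T (Suc k) g b c = D k f b c - vol g b c" "T (Suc (Suc k)) g b c = D k b c f - vol g b c" for b c
      unfolding f g TN2 using DSf[of b c] by (simp_all add: f)
    have Tf: "T (Suc k) f b c = D k f b c + D k a b c - vol f b c - 2 * vol g b c"
      "T (Suc (Suc k)) f b c = D k b c f + D (Suc k) a b c - vol f b c - 2 * vol g b c" for b c
      unfolding f g TN1 using DSf[of b c] by (simp_all add: f)
    have vols: "vol f a g = V" "vol a g f = V" "vol f g a = - V" "vol a f g = - V" "vol g a f = - V"
      unfolding V by (simp_all add: coords algebra_simps)
    have 1: "E * E + (E - V) * E = 0"
    proof -
      have "T (Suc (Suc k)) g a a = E" "T (Suc k) g a a = E" "T (Suc k) a g a = E"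
        "T (Suc (Suc k)) g a g = 0" "T (Suc k) g g a = 0"
        using sw[of "Suc k" g a a] by (simp_all add: Tg Ef Df Dg D12[of k a g])
      moreover have "T (Suc (Suc k)) a a g = E - V"
        unfolding TI' T_simps f[symmetric] by (simp add: Tg Ef Df V)
      ultimately show ?thesis using TQ[of "Suc k" g a] by simp
    qed
    have V2: "2 * V = - V" by (simp add: two')
    have 2: "(E - V) * (E - V) + (E + V) * (E - V) = 0"
    proof -
      have a: "T (Suc k) f a f = E + 2 * V" "T (Suc k) f f f = 0" "T (Suc (Suc k)) f f f = 0"
        "T (Suc (Suc k)) f f a = E - 2 * V" "T (Suc (Suc k)) f a f = E + 2 * V"
        by (simp_all add: Tf Ef Df vols V[symmetric] DSf)
      have "T (Suc (Suc k)) a f f = E + 2 * V" "T (Suc k) a f f = E + 2 * V"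
        using sw[of "Suc (Suc k)" f a f] sw[of "Suc k" f a f] a by simp_all
      then show ?thesis using TQ[of "Suc k" a f] a V2 by simp
    qed
    \<comment> \<open>\<open>1\<close> reads 2 E^2 = E V and \<open>2\<close> reads 2 E^2 = 2 E V;
      hence E V = 0.\<close>
    have "2 * (E * E) = 0" using 1 2 by algebra
    then show ?thesis using two by (simp add: E f)
  qed
  have A: "D k a a a = 0" for k a
  proof -
    define f g V where f: "f = N a" and g: "g = N (N a)" and V: "V = vol g f a"
    have Df: "D k u f f = 0" "D k f u f = 0" "D k f f u = 0" and Dg: "D k u v g = 0" "D k u g v = 0" for u v
      unfolding f g using DN[of k u a "N a"] DNN D12 D23 by metis+
    have Ef: "D k a f a = 0" "D k f a a = 0" "D k a a f = 0" unfolding f using E D12 D23 by metis+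
    have DSf: "D (Suc k) u v f = D k u v f" "D (Suc k) u f v = D k u v f" "D (Suc k) f u v = D k u v f" for u v
      unfolding f using DS D12 D23 by metis+
    have DSa: "D (Suc k) a a a = D k a a a" using DS'[of k a a a] Ef by (simp add: f)
    have Tf: "T (Suc k) f b c = D k f b c + D k a b c - vol f b c - 2 * vol g b c"
      "T (Suc (Suc k)) f b c = D k b c f + D (Suc k) a b c - vol f b c - 2 * vol g b c" for b c
      unfolding f g TN1 using DSf[of b c] by (simp_all add: f)
    have vols: "vol f a g = V" "vol a g f = V" "vol f g a = - V" "vol a f g = - V" "vol g a f = - V"
      unfolding V by (simp_all add: coords algebra_simps)
    have a: "T (Suc k) f a a = D k a a a" "T (Suc (Suc k)) f a a = D k a a a"
      "T (Suc k) f f a = - 2 * V" "T (Suc (Suc k)) f a f = 2 * V"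
      by (simp_all add: Tf Ef Df DSf DSa vols V[symmetric])
    have b: "T (Suc k) a f a = D k a a a" using sw[of "Suc k" f a a] a by simp
    have c: "T (Suc (Suc k)) a a f = D k a a a - 2 * V"
      unfolding TI' T_simps f[symmetric] using a by simp
    have d: "T (Suc (Suc k)) a a a = T (Suc k) a a a + D k a a a"
      unfolding DSa[symmetric] by (simp add: D_def)
    \<comment> \<open>The unknown value \<open>T (Suc k) a a a\<close> and all terms in
      \<open>V\<close> cancel, leaving twice a square.\<close>
    have "2 * (D k a a a * D k a a a) = 0" using TQ[of "Suc k" f a] unfolding a b c d by algebra
    then show ?thesis using two by simp
  qed
  \<comment> \<open>Every vector becomes a combination of \<open>a\<close>, \<open>N a\<close> and a
    fixed vector of \<rho>. \<open>D\<close> is zero on the last, so its values on \<open>a\<close>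
    and \<open>N a\<close> decide.\<close>
  obtain a where "\<And>v. \<exists>b c. N (v - b *v a - c *v N a) = 0" using nilpotent_cyclic[OF N N3] by blast
  then obtain \<beta> \<gamma> where ex: "\<And>v. N (v - \<beta> v *v a - \<gamma> v *v N a) = 0" by metis
  define w where "w v = v - \<beta> v *v a - \<gamma> v *v N a" for v
  have dec: "v = \<beta> v *v a + \<gamma> v *v N a + w v" for v by (simp add: w_def)
  have "\<rho> (w v) = w v" for v using ex[of v] by (simp add: w_def[symmetric] rN[of "w v"])
  note Dw = D_fixed[OF this]
  have z: "D k a a a = 0" "D k (N a) a a = 0" "D k a (N a) a = 0" "D k a a (N a) = 0"
    "D k u (N a) (N a) = 0" "D k (N a) u (N a) = 0" "D k (N a) (N a) u = 0" for u
    using A[of k a] E[of k a] DN[of k _ a "N a"] DNN D12 D23 by metis+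
  show ?thesis
    by (subst dec[of x], subst dec[of y], subst dec[of z]) (simp add: D_simps Dw z)
qed

theorem forms_equal: "T 1 = T 0"
proof (cases "q = - 1")
  case True
  then show ?thesis by (rule case_minus_one)
next
  case False
  have "D 0 a b c = 0" for a b c
  proof (cases "t = 3 \<and> (3::'k) = 0")
    case True
    then show ?thesis using char_three[OF False] by blast
  next
    case nt: False
    then show ?thesis
      using D_vanish[OF False, of 0 a b c] D_three[OF False, of 0 a b c] by auto
  qed
  then show ?thesis by (simp add: D_def fun_eq_iff)
qed

end

section \<open>Excluding a nontrivial twist scalar\<close>

context three
begin

text \<open>The shift relation multiplies the form by a power of \<kappa> that depends on the
  eigenvector in the first argument. Comparing it for two eigenvectors kills most components in the
  eigenbasis \<open>i\<close>, \<open>j\<close>, \<open>l\<close>, and the survivors contradict a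
  single instance of \<open>II\<close>.\<close>

lemma twist_scalar_contradiction:
  fixes \<kappa> q :: "'k::field"
  assumes k3: "\<kappa> ^ 3 = 1" and k1: "\<kappa> \<noteq> 1" and q3: "1 + q + q\<^sup>2 = 0"
    and tri: "trilinear T0" "trilinear T1" "trilinear T2"
    and alt: "\<And>a b c. T0 a b c - T0 b a c = - (1 + q) * vol a b c"
      "\<And>a b c. T1 a b c - T1 b a c = - (1 + q) * vol a b c"
      "\<And>a b c. T2 a b c - T2 b a c = - (1 + q) * vol a b c"
    and cyc: "\<And>a b c. T0 a b c = T2 c (\<rho> a) b" "\<And>a b c. T1 a b c = \<kappa> * T0 c (\<rho> a) b"
      "\<And>a b c. T2 a b c = \<kappa>\<^sup>2 * T1 c (\<rho> a) b"
    and II: "\<And>x y v c d e. T1 y v d * T0 x e c - T1 y v e * T0 x d c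
        - T1 x v d * T0 y e c + T1 x v e * T0 y d c
        = q * (vol x y c * vol d e v + \<kappa> * vol x y (\<rho>i v) * vol d e c)"
    and rho: "linear_op \<rho>" and ri: "\<And>x. \<rho>i (\<rho> x) = x"
    and e: "i \<noteq> 0" "\<rho> i = i" "l \<noteq> 0" "\<rho> l = \<kappa> *v l" "j \<noteq> 0" "\<rho> j = \<kappa>\<^sup>2 *v j"
  shows False
proof -
  define s where "s = - (1 + q)"
  note lin = trilinearD[OF tri(1)] trilinearD[OF tri(2)] trilinearD[OF tri(3)]
    trilinearD[OF trilinear_vol] linear_opD[OF rho]
  have kk: "1 + \<kappa> + \<kappa>\<^sup>2 = 0"
  proof -
    have "(\<kappa> - 1) * (1 + \<kappa> + \<kappa>\<^sup>2) = 0" using k3 by (simp add: power2_eq_square power3_eq_cube algebra_simps)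
    then show ?thesis using k1 by simp
  qed
  have k0: "\<kappa> \<noteq> 0" using k3 by auto
  have k2: "\<kappa>\<^sup>2 \<noteq> 1"
  proof
    assume "\<kappa>\<^sup>2 = 1"
    then have "\<kappa> = 1" using k3 by (simp add: power3_eq_cube power2_eq_square)
    then show False using k1 by simp
  qed
  have kn: "\<kappa> * \<kappa> * \<kappa> = 1" using k3 by (simp add: power3_eq_cube)
  have "q ^ 3 = 1 + (q - 1) * (1 + q + q\<^sup>2)" by (simp add: power2_eq_square power3_eq_cube algebra_simps)
  then have qq: "q * q * q = 1" using q3 by (simp add: power3_eq_cube)
  have q0: "q \<noteq> 0" using qq by auto
  have "s = q * q" unfolding s_def using q3 by algebra
  then have s2: "s * s = q" using qq by (simp add: mult.assoc)
  \<comment> \<open>The eigenvalues 1, \<kappa>^2, \<kappa> are distinct, so applying \<rho> twice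
    to a dependency gives an invertible Vandermonde system.\<close>
  have vol0: "vol i j l \<noteq> 0"
  proof
    assume "vol i j l = 0"
    then obtain a b c where nz: "(a, b, c) \<noteq> (0, 0, 0)" and ab: "a *v i + b *v j + c *v l = 0"
      using vol_eq_0_dependent by blast
    have r1: "a *v i + (b * \<kappa>\<^sup>2) *v j + (c * \<kappa>) *v l = 0"
    proof -
      have "\<rho> (a *v i + b *v j + c *v l) = 0" unfolding ab by (simp add: lin)
      then show ?thesis unfolding lin e by (simp add: smul_def mult.assoc)
    qed
    have r2: "a *v i + (b * (\<kappa>\<^sup>2 * \<kappa>\<^sup>2)) *v j + (c * \<kappa> * \<kappa>) *v l = 0"
    proof -
      have "\<rho> (a *v i + (b * \<kappa>\<^sup>2) *v j + (c * \<kappa>) *v l) = 0" unfolding r1 by (simp add: lin)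
      then show ?thesis unfolding lin e by (simp add: smul_def mult.assoc)
    qed
    have "a * i m = 0 \<and> b * j m = 0 \<and> c * l m = 0" for m
    proof -
      have 1: "a * i m + b * j m + c * l m = 0" using ab by (simp add: smul_def fun_eq_iff)
      have 2: "a * i m + \<kappa>\<^sup>2 * (b * j m) + \<kappa> * (c * l m) = 0" using r1 by (simp add: smul_def fun_eq_iff mult_ac)
      have "a * i m + (\<kappa>\<^sup>2 * \<kappa>\<^sup>2) * (b * j m) + \<kappa>\<^sup>2 * (c * l m) = 0"
        using r2 by (simp add: smul_def fun_eq_iff mult_ac power2_eq_square)
      moreover have "\<kappa>\<^sup>2 * \<kappa>\<^sup>2 = \<kappa>" using kn by (simp add: power2_eq_square mult.assoc)
      ultimately have 3: "a * i m + \<kappa> * (b * j m) + \<kappa>\<^sup>2 * (c * l m) = 0" by simp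
      have "(\<kappa> - 1) * (c * l m) = 0 \<and> (\<kappa> - 1) * (b * j m) = 0"
      proof -
        have "(1 - \<kappa>) * (b * j m + (1 + \<kappa>) * (c * l m)) = 0" using 1 3 by algebra
        then have A: "b * j m + (1 + \<kappa>) * (c * l m) = 0" using k1 by simp
        have "(1 - \<kappa>) * ((1 + \<kappa>) * (b * j m) + c * l m) = 0" using 1 2 by algebra
        then have B: "(1 + \<kappa>) * (b * j m) + c * l m = 0" using k1 by simp
        have C: "(\<kappa> - 1) * Y = (1 + \<kappa>) * (X + (1 + \<kappa>) * Y) - ((1 + \<kappa>) * X + Y) - (1 + \<kappa> + \<kappa>\<^sup>2) * Y" for X Y
          by (simp add: power2_eq_square algebra_simps)
        have "(\<kappa> - 1) * (c * l m) = 0" using C[of "c * l m" "b * j m"] unfolding A B kk by simp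
        moreover have "(\<kappa> - 1) * (b * j m) = 0"
          using C[of "b * j m" "c * l m"] A B kk by (simp add: add.commute)
        ultimately show ?thesis ..
      qed
      then show ?thesis using 1 k1 by auto
    qed
    then have "a *v i = 0" "b *v j = 0" "c *v l = 0" by (auto simp: smul_def fun_eq_iff)
    then have "a = 0" "b = 0" "c = 0" using e(1,3,5) by (auto simp: smul_def fun_eq_iff)
    then show False using nz by simp
  qed
  have sw: "T0 a b c = T0 b a c + s * vol a b c" "T1 a b c = T1 b a c + s * vol a b c"
    "T2 a b c = T2 b a c + s * vol a b c" for a b c
    using alt[of a b c] by (simp_all add: s_def algebra_simps)
  \<comment> \<open>The analogue of \<open>sq1\<close>; here \<open>cyc(3)\<close> contributes a
    factor \<kappa>^2.\<close>
  have step: "T0 a b c = \<kappa>\<^sup>2 * (T1 (\<rho> (\<rho> a)) b c - s * vol (\<rho> (\<rho> a)) b c) + s * vol (\<rho> a) b c" for a b c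
  proof -
    have "T0 a b c = T2 (\<rho> a) c b + s * vol (\<rho> a) b c"
      using cyc(1)[of a b c] sw(3)[of c "\<rho> a" b] by (simp add: vol_cyc[of "\<rho> a" b c, symmetric])
    also have "T2 (\<rho> a) c b = \<kappa>\<^sup>2 * T1 b (\<rho> (\<rho> a)) c" by (rule cyc(3))
    also have "T1 b (\<rho> (\<rho> a)) c = T1 (\<rho> (\<rho> a)) b c - s * vol (\<rho> (\<rho> a)) b c"
      using sw(2)[of b "\<rho> (\<rho> a)" c] by (simp add: vol_swap(1)[of b])
    finally show ?thesis .
  qed
  have si: "T0 i b c = \<kappa>\<^sup>2 * T1 i b c + (1 - \<kappa>\<^sup>2) * s * vol i b c" for b c
    unfolding step[of i] e by (simp add: algebra_simps)
  have sj: "T0 j b c = T1 j b c + (\<kappa>\<^sup>2 - 1) * s * vol j b c" for b c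
    using kn unfolding step[of j] e lin by algebra
  have sl: "T0 l b c = \<kappa> * T1 l b c" for b c
    using kn unfolding step[of l] e lin by algebra
  have z1: "T1 j i c = 0" if "vol i j c = 0" for c
  proof -
    have "(\<kappa>\<^sup>2 - 1) * T1 j i c = 0"
      using si[of j c] sj[of i c] sw(1)[of i j c] sw(2)[of i j c] that
      by (simp add: vol_swap(1)[of i] algebra_simps)
    then show ?thesis using k2 by simp
  qed
  have z2: "T1 i l c = 0" if "vol i l c = 0" for c
  proof -
    have "\<kappa> * ((\<kappa> - 1) * T1 i l c) = 0"
      using si[of l c] sl[of i c] sw(1)[of i l c] sw(2)[of i l c] that
      by (simp add: vol_swap(1)[of i] algebra_simps power2_eq_square)
    then show ?thesis using k1 k0 by simp
  qed
  have "T1 j i j = 0" using z1 by simp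
  moreover have "T0 i l l = 0" using si[of l l] z2[of l] by simp
  moreover have "T1 i i j = 0"
    using cyc(2)[of i i j] sj[of i i] z1[of i] by (simp add: e)
  moreover have "T1 i i l = 0"
    using cyc(2)[of i i l] sl[of i i] z2[of i] sw(2)[of i l i] by (simp add: e)
  moreover have "\<rho>i i = i" using ri[of i] e by simp
  \<comment> \<open>The arguments are chosen so that three of the four products in
    \<open>II\<close>, and the term with \<kappa> on its right side, vanish.\<close>
  ultimately have "- (T0 i j l * T1 j i l) = q * (vol i j l * vol i j l)"
    using II[of j i j i l l] by (simp add: vol_cyc[of j l i] algebra_simps)
  moreover have "T1 i j l = 0"
  proof -
    have "(\<kappa>\<^sup>2 - 1) * T1 i j l = 0"
      using si[of j l] sj[of i l] sw(1)[of i j l] sw(2)[of i j l]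
      unfolding vol_swap(1)[of j i l] by algebra
    then show ?thesis using k2 by simp
  qed
  ultimately have "(s * s) * (1 - \<kappa>\<^sup>2) * (vol i j l * vol i j l) = q * (vol i j l * vol i j l)"
    using si[of j l] sw(2)[of i j l] by algebra
  then show False using vol0 s2 q0 k0 by simp
qed

end

section \<open>Tensors and the quadratic relations\<close>

lemma sum_idm:
  "(\<Sum>i\<in>UNIV. (x :: 'n::finite \<Rightarrow> 'k::field) i * idm i j) = x j"
  "(\<Sum>i\<in>UNIV. (x :: 'n::finite \<Rightarrow> 'k::field) i * idm j i) = x j"
  "(\<Sum>i\<in>UNIV. idm i j * (x :: 'n::finite \<Rightarrow> 'k::field) i) = x j"
  "(\<Sum>i\<in>UNIV. idm j i * (x :: 'n::finite \<Rightarrow> 'k::field) i) = x j"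
  by (simp_all add: idm_def if_distrib[of "\<lambda>a. _ * a"] if_distrib[of "\<lambda>a. a * _"] cong: if_cong)

lemma dot_idm: "dot (idm i) x = x i" "dot x (idm i) = x i"
  by (simp_all add: dot_def sum_idm)

lemma dot_commute: "dot x y = dot y x"
  by (simp add: dot_def mult.commute)

lemma linear_fun_dot: "linear_fun (dot x)" "linear_fun (\<lambda>x. dot x y)"
  by (simp_all add: linear_fun_def dot_def smul_def distrib_left distrib_right sum.distrib sum_distrib_left mult_ac)

lemma linear_fun_sum:
  assumes f: "linear_fun f" and "finite I"
  shows "f (\<lambda>j. \<Sum>i\<in>I. k i * t i j) = (\<Sum>i\<in>I. k i * f (t i))"
  using assms(2)
proof (induction I rule: finite_induct)
  case empty
  then show ?case using linear_funD(4)[OF f] by (simp add: zero_fun_def)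
next
  case (insert x I)
  have "(\<lambda>j. \<Sum>i\<in>insert x I. k i * t i j) = k x *v t x + (\<lambda>j. \<Sum>i\<in>I. k i * t i j)"
    using insert by (simp add: smul_def fun_eq_iff)
  then show ?case using insert by (simp add: linear_funD[OF f])
qed

lemma linear_fun_expand:
  assumes "linear_fun (f :: ('n::finite \<Rightarrow> 'k::field) \<Rightarrow> 'k)"
  shows "f x = (\<Sum>i\<in>UNIV. x i * f (idm i))"
proof -
  have "x = (\<lambda>j. \<Sum>i\<in>UNIV. x i * idm i j)" by (simp add: sum_idm)
  then have "f x = f (\<lambda>j. \<Sum>i\<in>UNIV. x i * idm i j)" by simp
  then show ?thesis by (simp add: linear_fun_sum[OF assms])
qed

lemma linear_fun_eqI:
  assumes "linear_fun (f :: ('n::finite \<Rightarrow> 'k::field) \<Rightarrow> 'k)" "linear_fun g" "\<And>i. f (idm i) = g (idm i)"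
  shows "f x = g x"
  unfolding linear_fun_expand[OF assms(1), of x] linear_fun_expand[OF assms(2), of x] by (simp add: assms(3))

lemma linear_op_comp:
  assumes "linear_op f" "linear_op g"
  shows "linear_op (\<lambda>x. f (g x))"
  unfolding linear_op_def by (simp add: linear_opD[OF assms(1)] linear_opD[OF assms(2)])

lemma linear_op_scale: "linear_op f \<Longrightarrow> linear_op (\<lambda>x. c *v f x)"
  unfolding linear_op_def by (simp add: smul_def fun_eq_iff algebra_simps)

lemma dot_eqI:
  assumes "\<And>z. dot x z = dot y z"
  shows "x = y"
  using assms[of "idm i" for i] by (simp add: dot_idm fun_eq_iff)

section \<open>Alternating forms, determinants and traces in dimension 3\<close>

context three
begin

lemma vec_expand: "x = x i0 *v idm i0 + x i1 *v idm i1 + x i2 *v (idm i2 :: 'n \<Rightarrow> 'k::field)"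
  using distinct distinct' by (simp add: coords idm_def)

lemma alternating_eq_vol:
  fixes S :: "('n \<Rightarrow> 'k::field) \<Rightarrow> ('n \<Rightarrow> 'k) \<Rightarrow> ('n \<Rightarrow> 'k) \<Rightarrow> 'k"
  assumes tri: "trilinear S" and alt: "\<And>x z. S x x z = 0" "\<And>x y. S x y y = 0"
  shows "S x y z = S (idm i0) (idm i1) (idm i2) * vol x y z"
proof -
  note lin = trilinearD[OF tri]
  have sw1: "S y x z = - S x y z" for x y z
    using alt(1)[of "x + y" z] alt(1)[of x z] alt(1)[of y z] by (simp add: lin eq_neg_iff_add_eq_0 add.commute)
  have sw2: "S x z y = - S x y z" for x y z
    using alt(2)[of x "y + z"] alt(2)[of x y] alt(2)[of x z] by (simp add: lin eq_neg_iff_add_eq_0 add.commute)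
  have alt3: "S x y x = 0" for x y using sw1[of x y x] alt(2)[of y x] by simp
  let ?e = "S (idm i0) (idm i1) (idm i2)"
  have e: "S (idm i1) (idm i0) (idm i2) = - ?e" "S (idm i0) (idm i2) (idm i1) = - ?e"
    "S (idm i1) (idm i2) (idm i0) = ?e" "S (idm i2) (idm i0) (idm i1) = ?e"
    "S (idm i2) (idm i1) (idm i0) = - ?e"
    using sw1[of "idm i0" "idm i1" "idm i2"] sw2[of "idm i0" "idm i1" "idm i2"]
      sw2[of "idm i1" "idm i0" "idm i2"] sw1[of "idm i0" "idm i2" "idm i1"]
      sw1[of "idm i1" "idm i2" "idm i0"] by simp_all
  show ?thesis
    by (subst vec_expand[of x], subst vec_expand[of y], subst vec_expand[of z])
      (simp add: lin alt alt3 e coords algebra_simps del: eq3)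
qed

lemma ex_det:
  assumes f: "linear_op (f :: ('n \<Rightarrow> 'k::field) \<Rightarrow> 'n \<Rightarrow> 'k)"
  shows "\<exists>c. \<forall>x y z. vol (f x) (f y) (f z) = c * vol x y z"
proof -
  have "trilinear (\<lambda>x y z. vol (f x) (f y) (f z))"
    unfolding trilinear_def linear_fun_def by (simp add: linear_opD[OF f] trilinearD[OF trilinear_vol])
  then show ?thesis using alternating_eq_vol by (metis (no_types, lifting) vol_alt(1) vol_alt(3))
qed

text \<open>The two determinants multiply to 1, so \<open>g\<close> has nonzero determinant and is
  injective.\<close>

lemma left_inverse_right_inverse:
  assumes f: "linear_op (f :: ('n \<Rightarrow> 'k::field) \<Rightarrow> 'n \<Rightarrow> 'k)" and g: "linear_op g"
    and gf: "\<And>x. g (f x) = x"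
  shows "f (g x) = x"
proof -
  obtain c where c: "\<And>x y z. vol (f x) (f y) (f z) = c * vol x y z" using ex_det[OF f] by blast
  obtain c' where c': "\<And>x y z. vol (g x) (g y) (g z) = c' * vol x y z" using ex_det[OF g] by blast
  have "c' * c = 1" using c'[of "f (idm i0)" "f (idm i1)" "f (idm i2)"] c by (simp add: gf vol_basis mult.assoc)
  then have c'0: "c' \<noteq> 0" by auto
  have inj: "x = 0" if "g x = 0" for x
  proof (rule vol_eq_0D)
    show "vol x y z = 0" for y z
      using c'[of x y z] that c'0 by (simp add: trilinearD[OF trilinear_vol])
  qed
  have "g (f (g x) - x) = 0" by (simp add: linear_opD[OF g] gf)
  then have "f (g x) - x = 0" by (rule inj)
  then show ?thesis by simp
qed

lemma trace_vol:
  assumes f: "linear_op (f :: ('n \<Rightarrow> 'k::field) \<Rightarrow> 'n \<Rightarrow> 'k)"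
  shows "vol (f x) y z + vol x (f y) z + vol x y (f z) = (\<Sum>i\<in>UNIV. f (idm i) i) * vol x y z"
proof -
  have exp: "f v = v i0 *v f (idm i0) + v i1 *v f (idm i1) + v i2 *v f (idm i2)" for v
    by (subst vec_expand[of v]) (simp only: linear_opD[OF f])
  show ?thesis
    unfolding exp[of x] exp[of y] exp[of z] sum3 by (simp add: coords algebra_simps del: eq3)
qed

end

text \<open>\<open>Z\<close> is \<zeta>, \<open>Zi\<close> its inverse, \<open>Zt\<close> and
  \<open>Zit\<close> are their transposes acting on covectors, and \<delta> is det \<zeta>.
  Covectors are identified with vectors through \<open>dot\<close>.\<close>

locale twisted = three i0 i1 i2 for i0 i1 i2 :: "'n::finite" +
  fixes Z Zi Zt Zit :: "('n \<Rightarrow> 'k::field) \<Rightarrow> 'n \<Rightarrow> 'k" and \<delta> :: 'k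
  assumes lin: "linear_op Z" "linear_op Zi" "linear_op Zt" "linear_op Zit"
    and inv: "\<And>x. Z (Zi x) = x" "\<And>x. Zi (Z x) = x"
    and adj: "\<And>x y. dot x (Z y) = dot (Zt x) y" "\<And>x y. dot x (Zi y) = dot (Zit x) y"
    and det: "\<And>x y z. vol (Z x) (Z y) (Z z) = \<delta> * vol x y z"
    and dett: "\<And>x y z. vol (Zt x) (Zt y) (Zt z) = \<delta> * vol x y z"
begin

lemma inv_t: "Zt (Zit x) = x" "Zit (Zt x) = x"
  by (rule dot_eqI, simp add: adj[symmetric] inv)+

lemma transpose_idm: "Zt (idm b) i = Z (idm i) b" "Zit (idm b) i = Zi (idm i) b"
  using adj(1)[of "idm b" "idm i"] adj(2)[of "idm b" "idm i"] by (simp_all add: dot_idm)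

lemma delta_neq_0: "\<delta> \<noteq> 0"
  using det[of "Zi (idm i0)" "Zi (idm i1)" "Zi (idm i2)"] by (auto simp: inv vol_basis)

lemma vol_Zit: "vol (Zit x) (Zit y) (Zit z) = inverse \<delta> * vol x y z"
  using dett[of "Zit x" "Zit y" "Zit z"] delta_neq_0 by (simp add: inv_t)

lemma vol_Zi: "vol (Zi x) (Zi y) (Zi z) = inverse \<delta> * vol x y z"
  using det[of "Zi x" "Zi y" "Zi z"] delta_neq_0 by (simp add: inv)

text \<open>For a covector \<open>\<xi>\<close> the tensor \<open>w \<xi>\<close> is the image under \<open>1 \<otimes> \<zeta>\<inverse>\<close> of the
  alternating tensor obtained by contracting the volume form with \<open>\<xi>\<close>; \<open>\<upsilon>\<close> is the image
  of the alternating 3-tensor under \<open>1 \<otimes> \<zeta>\<inverse> \<otimes> \<zeta>\<inverse>\<^sup>2\<close>.\<close>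

definition w :: "('n \<Rightarrow> 'k) \<Rightarrow> 'n \<Rightarrow> 'n \<Rightarrow> 'k" where
  "w \<xi> a b = vol \<xi> (idm a) (Zit (idm b))"

definition \<upsilon> :: "'n \<Rightarrow> 'n \<Rightarrow> 'n \<Rightarrow> 'k" where
  "\<upsilon> a b c = vol (idm a) (Zit (idm b)) (Zit (Zit (idm c)))"

lemma w_linear: "w (x + y) a b = w x a b + w y a b" "w (c *v x) a b = c * w x a b"
  "w (x - y) a b = w x a b - w y a b"
  by (simp_all add: w_def trilinearD[OF trilinear_vol])

lemma linear_fun_w: "linear_fun (\<lambda>\<xi>. w \<xi> a b)"
  by (simp add: linear_fun_def w_linear)

lemma w_Zi: "w \<xi> a = Zi (crs \<xi> (idm a))"
proof
  fix b
  show "w \<xi> a b = Zi (crs \<xi> (idm a)) b"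
    using adj(2)[of "idm b" "crs \<xi> (idm a)"]
    by (simp add: w_def vol_def dot_idm dot_commute[of "crs _ _"])
qed

text \<open>Cross products produce the defining relations (1 \<otimes> \<zeta>^-1)(x \<otimes> y - y
  \<otimes> x) of the twisted symmetric algebra.\<close>

lemma w_crs: "w (crs x y) a b = x a * Zi y b - y a * Zi x b"
proof -
  have "w (crs x y) a b = dot (Zit (idm b)) (x a *v y - y a *v x)"
    unfolding w_def vol_def crs_crs dot_idm by (rule dot_commute)
  then show ?thesis
    by (simp add: adj(2)[symmetric] linear_opD[OF lin(2)] dot_idm smul_apply)
qed

lemma w_eq_crs: "w p b c = crs (Zit (idm c)) p b"
  unfolding w_def by (subst vol_cyc) (simp add: vol_def dot_idm)

lemma bilinear_expand:
  assumes "\<And>y. linear_fun (\<lambda>x. B x y)" "\<And>x. linear_fun (B x)"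
  shows "dot \<alpha> (\<lambda>a. dot \<beta> (\<lambda>b. B (idm a) (idm b))) = B \<alpha> (\<beta> :: 'n \<Rightarrow> 'k)"
proof -
  have 1: "dot \<beta> (\<lambda>b. B x (idm b)) = B x \<beta>" for x
    by (simp add: dot_def linear_fun_expand[OF assms(2), of x \<beta>])
  show ?thesis unfolding 1 by (simp add: dot_def linear_fun_expand[OF assms(1), of \<alpha> \<beta>])
qed

lemma w_pair: "dot \<alpha> (\<lambda>a. dot \<beta> (\<lambda>b. w \<xi> a b)) = vol \<xi> \<alpha> (Zit \<beta>)"
  unfolding w_def
  by (rule bilinear_expand[of "\<lambda>x y. vol \<xi> x (Zit y)"])
    (simp_all add: linear_fun_def trilinearD[OF trilinear_vol] linear_opD[OF lin(4)])

lemma w_inj: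
  assumes "\<And>a b. w x a b = w y a b"
  shows "x = y"
proof -
  have "vol x a b = vol y a b" for a b
    using w_pair[of a "Zt b" x] w_pair[of a "Zt b" y] by (simp add: assms inv_t)
  then have "x - y = 0" by (intro vol_eq_0D) (simp add: trilinearD[OF trilinear_vol])
  then show ?thesis by simp
qed

text \<open>This and the next lemma exhibit \<upsilon> in W \<otimes> V and in V \<otimes> W. The
  factor \<open>inverse \<delta>\<close> of the second form comes from pulling \<zeta>^-1 out of all
  arguments of the volume form.\<close>

lemma upsilon_left: "\<upsilon> a b c = w (Zit (Zit (idm c))) a b"
  unfolding \<upsilon>_def w_def by (simp add: vol_cyc)

lemma upsilon_right: "\<upsilon> a b c = w (inverse \<delta> *v Zt (idm a)) b c"
  using vol_Zit[of "Zt (idm a)" "idm b" "Zit (idm c)"]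
  by (simp add: \<upsilon>_def w_def inv_t trilinearD[OF trilinear_vol])

lemma upsilon_nonzero: "\<exists>a b c. \<upsilon> a b c \<noteq> 0"
proof (rule ccontr)
  assume "\<not> ?thesis"
  then have "w (Zit (Zit (idm c))) a b = w 0 a b" for a b c
    using upsilon_left[of a b c] by (simp add: w_def trilinearD[OF trilinear_vol])
  then have "Zit (Zit (idm c)) = 0" for c by (rule w_inj)
  then have "Zt (Zt (Zit (Zit (idm i0)))) = (0 :: 'n \<Rightarrow> 'k)" by (simp add: linear_opD[OF lin(3)])
  then have "idm i0 i0 = (0::'k)" by (simp add: inv_t)
  then show False by (simp add: idm_def)
qed

text \<open>In terms of subspaces: \<open>W \<otimes> V \<inter> V \<otimes> W\<close> is spanned by \<open>\<upsilon>\<close>.\<close>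
lemma multiple_of_upsilon:
  assumes left: "\<And>c. \<exists>\<xi>. \<forall>a b. u a b c = w \<xi> a b" and right: "\<And>a. \<exists>\<xi>. \<forall>b c. u a b c = w \<xi> b c"
  shows "\<exists>l. \<forall>a b c. u a b c = l * \<upsilon> a b c"
proof -
  obtain X where X: "\<And>a b c. u a b c = w (X c) a b" using left by metis
  obtain Y where Y: "\<And>a b c. u a b c = w (Y a) b c" using right by metis
  define U where "U \<alpha> \<beta> \<gamma> = dot \<alpha> (\<lambda>a. dot \<beta> (\<lambda>b. dot \<gamma> (\<lambda>c. u a b c)))" for \<alpha> \<beta> \<gamma>
  have UY: "U \<alpha> \<beta> \<gamma> = dot \<alpha> (\<lambda>a. vol (Y a) \<beta> (Zit \<gamma>))" for \<alpha> \<beta> \<gamma>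
    unfolding U_def Y w_pair ..
  have UX: "U \<alpha> \<beta> \<gamma> = dot \<gamma> (\<lambda>c. vol (X c) \<alpha> (Zit \<beta>))" for \<alpha> \<beta> \<gamma>
  proof -
    have "U \<alpha> \<beta> \<gamma> = dot \<gamma> (\<lambda>c. dot \<alpha> (\<lambda>a. dot \<beta> (\<lambda>b. u a b c)))"
      unfolding U_def dot3 by (simp add: algebra_simps)
    then show ?thesis unfolding X w_pair .
  qed
  \<comment> \<open>With the twists undone, membership in W \<otimes> V and in V \<otimes> W becomes
    alternation in the first two and in the last two arguments.\<close>
  define S where "S \<alpha> \<beta> \<gamma> = U \<alpha> (Zt \<beta>) (Zt (Zt \<gamma>))" for \<alpha> \<beta> \<gamma>
  have "trilinear S"
    unfolding trilinear_def linear_fun_def S_def UY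
    by (simp add: trilinearD[OF trilinear_vol] linear_opD[OF lin(3)] linear_opD[OF lin(4)] inv_t dot3 smul_apply algebra_simps)
  moreover have "S \<alpha> \<alpha> \<gamma> = 0" for \<alpha> \<gamma> unfolding S_def UX inv_t by (simp add: dot_def)
  moreover have "S \<alpha> \<beta> \<beta> = 0" for \<alpha> \<beta> unfolding S_def UY inv_t by (simp add: dot_def)
  ultimately have S: "S x y z = S (idm i0) (idm i1) (idm i2) * vol x y z" for x y z
    by (rule alternating_eq_vol)
  have "u a b c = S (idm i0) (idm i1) (idm i2) * \<upsilon> a b c" for a b c
    using S[of "idm a" "Zit (idm b)" "Zit (Zit (idm c))"]
    unfolding \<upsilon>_def by (simp add: S_def inv_t U_def dot_idm)
  then show ?thesis by blast
qed

text \<open>Contracting the last two slots with \<gamma> and its image under \<open>Zt\<close> kills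
  \<open>W\<close>, while \<upsilon> \<otimes> \<mu> becomes a contraction of \<upsilon> times a
  coordinate of \<zeta> \<mu>. Were that coordinate nonzero, \<upsilon> contracted with \<gamma>
  would vanish, which injectivity of \<open>w\<close> forbids.\<close>

lemma slice_tensor_eq_0:
  assumes "\<And>a b. \<exists>\<xi>. \<forall>c e. \<upsilon> a b c * \<mu> e = w \<xi> c e"
  shows "\<mu> = 0"
proof (rule ccontr)
  assume "\<mu> \<noteq> 0"
  then have "Z \<mu> \<noteq> 0" using inv(2)[of \<mu>] linear_opD(4)[OF lin(2)] by auto
  then obtain i where i: "Z \<mu> i \<noteq> 0" by (auto simp: fun_eq_iff)
  define \<gamma> where "\<gamma> = (idm i :: 'n \<Rightarrow> 'k)"
  have "vol (idm a) (Zit (idm b)) (Zit (Zit \<gamma>)) = 0" for a b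
  proof -
    obtain \<xi> where x: "\<And>c e. \<upsilon> a b c * \<mu> e = w \<xi> c e" using assms by blast
    have "dot \<gamma> (\<upsilon> a b) * dot (Zt \<gamma>) \<mu> = dot \<gamma> (\<lambda>c. dot (Zt \<gamma>) (\<lambda>e. w \<xi> c e))"
      unfolding x[symmetric] dot3 by (simp add: algebra_simps)
    also have "\<dots> = 0" unfolding w_pair inv_t by simp
    finally have "dot \<gamma> (\<upsilon> a b) = 0" using i by (simp add: adj(1)[symmetric] \<gamma>_def dot_idm)
    moreover have "dot \<gamma> (\<upsilon> a b) = vol (idm a) (Zit (idm b)) (Zit (Zit \<gamma>))"
    proof -
      have "linear_fun (\<lambda>x. vol (idm a) (Zit (idm b)) (Zit (Zit x)))"
        by (simp add: linear_fun_def trilinearD[OF trilinear_vol] linear_opD[OF lin(4)])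
      from linear_fun_expand[OF this, of \<gamma>] show ?thesis by (simp add: dot_def \<upsilon>_def)
    qed
    ultimately show ?thesis by simp
  qed
  then have "w (Zit (Zit \<gamma>)) a b = w 0 a b" for a b
    by (simp add: w_def vol_cyc trilinearD[OF trilinear_vol])
  then have "Zit (Zit \<gamma>) = 0" by (rule w_inj)
  then have "Zt (Zt (Zit (Zit \<gamma>))) = 0" by (simp add: linear_opD[OF lin(3)])
  then have "idm i i = (0::'k)" by (simp add: inv_t \<gamma>_def)
  then show False by (simp add: idm_def)
qed

end

text \<open>Tensors are curried, so that freezing some indices by abstraction lets the operator act
  on any two adjacent slots.\<close>

definition tapply :: "('n::finite \<times> 'n \<Rightarrow> 'n \<times> 'n \<Rightarrow> 'k::field) \<Rightarrow> ('n \<Rightarrow> 'n \<Rightarrow> 'k) \<Rightarrow> 'n \<Rightarrow> 'n \<Rightarrow> 'k" where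
  "tapply M t a b = (\<Sum>c\<in>UNIV. \<Sum>d\<in>UNIV. M (a, b) (c, d) * t c d)"

lemma tapply_add: "tapply M (\<lambda>a b. t a b + u a b) a b = tapply M t a b + tapply M u a b"
  by (simp add: tapply_def distrib_left sum.distrib)

lemma tapply_diff: "tapply M (\<lambda>a b. t a b - u a b) a b = tapply M t a b - tapply M u a b"
  by (simp add: tapply_def right_diff_distrib sum_subtractf)

lemma tapply_scale: "tapply M (\<lambda>a b. k * t a b) a b = k * tapply M t a b"
  "tapply M (\<lambda>a b. t a b * k) a b = tapply M t a b * k"
  by (simp_all add: tapply_def sum_distrib_left sum_distrib_right mult_ac)

lemma tapply_sum: "tapply M (\<lambda>a b. \<Sum>i\<in>I. k i * t i a b) a b = (\<Sum>i\<in>I. k i * tapply M (t i) a b)"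
  by (simp add: tapply_def sum_distrib_left sum.swap[of _ I] mult_ac)

definition A12 :: "('n::finite \<times> 'n \<Rightarrow> 'n \<times> 'n \<Rightarrow> 'k::field) \<Rightarrow> ('n \<Rightarrow> 'n \<Rightarrow> 'n \<Rightarrow> 'k) \<Rightarrow> 'n \<Rightarrow> 'n \<Rightarrow> 'n \<Rightarrow> 'k" where
  "A12 M u a b c = tapply M (\<lambda>a b. u a b c) a b"

definition A23 :: "('n::finite \<times> 'n \<Rightarrow> 'n \<times> 'n \<Rightarrow> 'k::field) \<Rightarrow> ('n \<Rightarrow> 'n \<Rightarrow> 'n \<Rightarrow> 'k) \<Rightarrow> 'n \<Rightarrow> 'n \<Rightarrow> 'n \<Rightarrow> 'k" where
  "A23 M u a b c = tapply M (u a) b c"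

text \<open>\<open>M\<close> stands for R - q, and \<open>image\<close> with \<open>onto\<close>
  says that its image is \<open>W\<close>. The braid equation for R = M + q takes the form
  \<open>braid\<close> after \<open>hecke\<close> has been used to replace squares.\<close>

locale hecke_op = twisted i0 i1 i2 Z Zi Zt Zit \<delta>
  for i0 i1 i2 :: "'n::finite" and Z Zi Zt Zit :: "('n \<Rightarrow> 'k::field) \<Rightarrow> 'n \<Rightarrow> 'k" and \<delta> :: 'k +
  fixes M :: "'n \<times> 'n \<Rightarrow> 'n \<times> 'n \<Rightarrow> 'k" and q :: 'k
  assumes q: "q \<noteq> 0"
    and image: "\<And>t. \<exists>\<xi>. \<forall>a b. tapply M t a b = w \<xi> a b"
    and onto: "\<And>\<xi>. \<exists>t. \<forall>a b. tapply M t a b = w \<xi> a b"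
    and hecke: "\<And>t a b. tapply M (tapply M t) a b = - (1 + q) * tapply M t a b"
    and braid: "\<And>u a b c. A12 M (A23 M (A12 M u)) a b c - q * A12 M u a b c
      = A23 M (A12 M (A23 M u)) a b c - q * A23 M u a b c"
begin

abbreviation "s \<equiv> - (1 + q)"

lemma tapply_w: "tapply M (w \<xi>) a b = s * w \<xi> a b"
proof -
  obtain t where "\<forall>a b. tapply M t a b = w \<xi> a b" using onto by blast
  then have "w \<xi> = tapply M t" by (simp add: fun_eq_iff)
  then show ?thesis by (simp only: hecke)
qed

text \<open>\<open>w\<close> identifies covectors with the image of \<open>M\<close>, so \<phi>
  encodes \<open>M\<close>, and the values of \<phi> on decomposable tensors turn it into the
  trilinear form \<open>F\<close>.\<close>

definition \<phi> :: "('n \<Rightarrow> 'n \<Rightarrow> 'k) \<Rightarrow> 'n \<Rightarrow> 'k" where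
  "\<phi> t = (SOME \<xi>. \<forall>a b. tapply M t a b = w \<xi> a b)"

lemma tapply_phi: "tapply M t a b = w (\<phi> t) a b"
  using someI_ex[OF image[of t]] unfolding \<phi>_def by blast

lemma phi_eqI:
  assumes "\<And>a b. tapply M t a b = w \<xi> a b"
  shows "\<phi> t = \<xi>"
  by (rule w_inj) (simp only: tapply_phi[symmetric] assms)

lemma phi_lin: "\<phi> (\<lambda>a b. t a b + u a b) = \<phi> t + \<phi> u" "\<phi> (\<lambda>a b. t a b - u a b) = \<phi> t - \<phi> u"
  "\<phi> (\<lambda>a b. k * t a b) = k *v \<phi> t" "\<phi> (\<lambda>a b. t a b * k) = k *v \<phi> t"
  by (rule phi_eqI, simp add: tapply_add tapply_diff tapply_scale w_linear tapply_phi)+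

lemma phi_w: "\<phi> (w \<xi>) = s *v \<xi>"
  by (rule phi_eqI) (simp add: tapply_w w_linear)

definition F :: "('n \<Rightarrow> 'k) \<Rightarrow> ('n \<Rightarrow> 'k) \<Rightarrow> ('n \<Rightarrow> 'k) \<Rightarrow> 'k" where
  "F x y z = dot (\<phi> (\<lambda>a b. x a * y b)) z"

lemma trilinear_F: "trilinear F"
proof -
  have 1: "\<phi> (\<lambda>a b. (x + x') a * y b) = \<phi> (\<lambda>a b. x a * y b) + \<phi> (\<lambda>a b. x' a * y b)"
    "\<phi> (\<lambda>a b. x a * (y + y') b) = \<phi> (\<lambda>a b. x a * y b) + \<phi> (\<lambda>a b. x a * y' b)"
    "\<phi> (\<lambda>a b. (k *v x) a * y b) = k *v \<phi> (\<lambda>a b. x a * y b)"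
    "\<phi> (\<lambda>a b. x a * (k *v y) b) = k *v \<phi> (\<lambda>a b. x a * y b)" for x x' y y' :: "'n \<Rightarrow> 'k" and k
    unfolding phi_lin(1)[symmetric] phi_lin(3)[symmetric]
    by (simp_all add: smul_apply algebra_simps)
  show ?thesis
    unfolding trilinear_def linear_fun_def F_def 1
    using linear_funD(1,2)[OF linear_fun_dot(1)] linear_funD(1,2)[OF linear_fun_dot(2)] by blast
qed

lemmas F_simps = trilinearD[OF trilinear_F]

lemma phi_surj: "\<exists>t. \<phi> t = \<xi>"
proof -
  obtain t where "\<forall>a b. tapply M t a b = w \<xi> a b" using onto by blast
  then have "\<phi> t = \<xi>" by (intro phi_eqI) simp
  then show ?thesis by blast
qed

lemma dot_phi: "dot (\<phi> t) c = (\<Sum>i\<in>UNIV. F (idm i) (t i) c)"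
proof -
  have "\<phi> t = \<phi> (\<lambda>a b. idm i0 a * t i0 b) + \<phi> (\<lambda>a b. idm i1 a * t i1 b) + \<phi> (\<lambda>a b. idm i2 a * t i2 b)"
    unfolding phi_lin(1)[symmetric] using distinct distinct' UNIV3
    by (intro arg_cong[of _ _ \<phi>] ext) (auto simp: idm_def)
  then show ?thesis by (simp add: F_def sum3 linear_funD(1)[OF linear_fun_dot(2)])
qed

lemma F_nondegenerate:
  assumes "\<And>a b. F a b c = 0"
  shows "c = 0"
proof -
  have "dot \<xi> c = dot \<xi> 0" for \<xi>
  proof -
    obtain t where "\<phi> t = \<xi>" using phi_surj by blast
    then show ?thesis using dot_phi[of t c] assms by (simp add: dot_def)
  qed
  then show ?thesis using dot_eqI[of c 0] by (simp add: dot_commute)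
qed

text \<open>\<open>M\<close> is the scalar s on its image, here on the relation given by
  \<open>w_crs\<close>.\<close>

lemma F_alt: "F x (Zi y) c - F y (Zi x) c = s * vol x y c"
proof -
  have "(\<lambda>a b. x a * Zi y b - y a * Zi x b) = w (crs x y)" by (simp add: w_crs fun_eq_iff)
  then have "\<phi> (\<lambda>a b. x a * Zi y b) - \<phi> (\<lambda>a b. y a * Zi x b) = s *v crs x y"
    unfolding phi_lin(2)[symmetric] by (simp only: phi_w)
  then have "dot (\<phi> (\<lambda>a b. x a * Zi y b) - \<phi> (\<lambda>a b. y a * Zi x b)) c = dot (s *v crs x y) c" by simp
  then show ?thesis
    unfolding F_def vol_def linear_funD[OF linear_fun_dot(2)] .
qed

abbreviation "B12 \<equiv> A12 M"
abbreviation "B23 \<equiv> A23 M"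

text \<open>For u = B12 v the braid equation places B12 B23 u - q u in V \<otimes> W. It lies in W
  \<otimes> V as well, hence on the line of \<upsilon>.\<close>

lemma left_ex:
  assumes "\<And>c. \<exists>\<xi>. \<forall>a b. u a b c = w \<xi> a b"
  shows "\<exists>l. \<forall>a b c. B12 (B23 u) a b c = q * u a b c + l * \<upsilon> a b c"
proof -
  have "\<exists>t. \<forall>a b. tapply M t a b = u a b c" for c using assms[of c] onto by metis
  then obtain t where t: "\<And>a b c. tapply M (t c) a b = u a b c" by metis
  define v where "v a b c = t c a b" for a b c
  have u: "u = B12 v" by (simp add: fun_eq_iff A12_def v_def t)
  have "\<exists>l. \<forall>a b c. B12 (B23 u) a b c - q * u a b c = l * \<upsilon> a b c"
  proof (rule multiple_of_upsilon)
    fix c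
    obtain \<xi> where \<xi>: "\<And>a b. u a b c = w \<xi> a b" using assms by blast
    have "B12 (B23 u) a b c - q * u a b c = w (\<phi> (\<lambda>a b. B23 u a b c) - q *v \<xi>) a b" for a b
      unfolding A12_def tapply_phi w_linear \<xi> ..
    then show "\<exists>\<xi>. \<forall>a b. B12 (B23 u) a b c - q * u a b c = w \<xi> a b" by blast
  next
    fix a
    have "B12 (B23 u) a b c - q * u a b c = w (\<phi> (\<lambda>b c. B12 (B23 v) a b c) - q *v \<phi> (v a)) b c" for b c
    proof -
      have "B12 (B23 u) a b c - q * u a b c = B23 (B12 (B23 v)) a b c - q * B23 v a b c"
        unfolding u by (rule braid)
      then show ?thesis unfolding A23_def[of M "B12 (B23 v)"] A23_def[of M v a] tapply_phi w_linear .
    qed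
    then show "\<exists>\<xi>. \<forall>b c. B12 (B23 u) a b c - q * u a b c = w \<xi> b c" by blast
  qed
  then show ?thesis by (metis add.commute diff_eq_eq)
qed

lemma right_ex:
  assumes "\<And>a. \<exists>\<xi>. \<forall>b c. u a b c = w \<xi> b c"
  shows "\<exists>l. \<forall>a b c. B23 (B12 u) a b c = q * u a b c + l * \<upsilon> a b c"
proof -
  have "\<exists>t. \<forall>b c. tapply M t b c = u a b c" for a using assms[of a] onto by metis
  then obtain v where t: "\<And>a b c. tapply M (v a) b c = u a b c" by metis
  have u: "u = B23 v" by (simp add: fun_eq_iff A23_def t)
  have "\<exists>l. \<forall>a b c. B23 (B12 u) a b c - q * u a b c = l * \<upsilon> a b c"
  proof (rule multiple_of_upsilon)
    fix a
    obtain \<xi> where \<xi>: "\<And>b c. u a b c = w \<xi> b c" using assms by blast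
    have "B23 (B12 u) a b c - q * u a b c = w (\<phi> (B12 u a) - q *v \<xi>) b c" for b c
      unfolding A23_def tapply_phi w_linear \<xi> ..
    then show "\<exists>\<xi>. \<forall>b c. B23 (B12 u) a b c - q * u a b c = w \<xi> b c" by blast
  next
    fix c
    have "B23 (B12 u) a b c - q * u a b c
      = w (\<phi> (\<lambda>a b. B23 (B12 v) a b c) - q *v \<phi> (\<lambda>a b. v a b c)) a b" for a b
    proof -
      have "B23 (B12 u) a b c - q * u a b c = B12 (B23 (B12 v)) a b c - q * B12 v a b c"
        unfolding u by (rule braid[symmetric])
      then show ?thesis unfolding A12_def[of M "B23 (B12 v)"] A12_def[of M v a] tapply_phi w_linear .
    qed
    then show "\<exists>\<xi>. \<forall>a b. B23 (B12 u) a b c - q * u a b c = w \<xi> a b" by blast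
  qed
  then show ?thesis by (metis add.commute diff_eq_eq)
qed

lemma A_lin: "B12 (\<lambda>a b c. t a b c + u a b c) a b c = B12 t a b c + B12 u a b c"
  "B23 (\<lambda>a b c. t a b c + u a b c) a b c = B23 t a b c + B23 u a b c"
  "B12 (\<lambda>a b c. k * t a b c) a b c = k * B12 t a b c"
  "B23 (\<lambda>a b c. k * t a b c) a b c = k * B23 t a b c"
  by (simp_all add: A12_def A23_def tapply_add tapply_scale)

lemma A_sum: "B12 (\<lambda>a b c. \<Sum>i\<in>I. k i * t i a b c) a b c = (\<Sum>i\<in>I. k i * B12 (t i) a b c)"
  "B23 (\<lambda>a b c. \<Sum>i\<in>I. k i * t i a b c) a b c = (\<Sum>i\<in>I. k i * B23 (t i) a b c)"
  by (simp_all add: A12_def A23_def tapply_sum)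

text \<open>The coefficient of \<upsilon> in \<open>left_ex\<close> is linear in \<xi> and in v, so
  it pairs \<xi> with a linear image of v. It is read off at a nonzero entry of \<upsilon>.\<close>

lemma left_map: "\<exists>m. linear_op m \<and> (\<forall>\<xi> v a b c. B12 (B23 (\<lambda>a b c. w \<xi> a b * v c)) a b c
    = q * (w \<xi> a b * v c) + dot \<xi> (m v) * \<upsilon> a b c)"
proof -
  obtain a0 b0 c0 where nz: "\<upsilon> a0 b0 c0 \<noteq> 0" using upsilon_nonzero by blast
  define L where "L \<xi> v a b c = B12 (B23 (\<lambda>a b c. w \<xi> a b * v c)) a b c - q * (w \<xi> a b * v c)" for \<xi> v a b c
  define m where "m v i = L (idm i) v a0 b0 c0 / \<upsilon> a0 b0 c0" for v i
  have ex: "\<exists>l. \<forall>a b c. L \<xi> v a b c = l * \<upsilon> a b c" for \<xi> v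
  proof -
    have "\<exists>\<xi>'. \<forall>a b. w \<xi> a b * v c = w \<xi>' a b" for c
      by (rule exI[of _ "v c *v \<xi>"]) (simp add: w_linear mult.commute)
    then have "\<exists>l. \<forall>a b c. B12 (B23 (\<lambda>a b c. w \<xi> a b * v c)) a b c = q * (w \<xi> a b * v c) + l * \<upsilon> a b c"
      by (rule left_ex)
    then show ?thesis unfolding L_def by (metis add_diff_cancel_left')
  qed
  have L: "L \<xi> v a b c = L \<xi> v a0 b0 c0 / \<upsilon> a0 b0 c0 * \<upsilon> a b c" for \<xi> v a b c
  proof -
    obtain l where "\<And>a b c. L \<xi> v a b c = l * \<upsilon> a b c" using ex by blast
    then show ?thesis using nz by simp
  qed
  have lin1: "linear_fun (\<lambda>\<xi>. L \<xi> v a b c)" for v a b c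
  proof -
    have "(\<lambda>a b c. w (x + y) a b * v c) = (\<lambda>a b c. w x a b * v c + w y a b * v c)"
      "(\<lambda>a b c. w (k *v x) a b * v c) = (\<lambda>a b c. k * (w x a b * v c))" for x y k
      by (simp_all add: w_linear algebra_simps fun_eq_iff)
    then show ?thesis unfolding linear_fun_def L_def
      by (simp add: A_lin[abs_def] A_lin w_linear algebra_simps)
  qed
  have lin2: "linear_fun (\<lambda>v. L \<xi> v a b c)" for \<xi> a b c
  proof -
    have "(\<lambda>a b c. w \<xi> a b * (x + y) c) = (\<lambda>a b c. w \<xi> a b * x c + w \<xi> a b * y c)"
      "(\<lambda>a b c. w \<xi> a b * (k *v x) c) = (\<lambda>a b c. k * (w \<xi> a b * x c))" for x y :: "'n \<Rightarrow> 'k" and k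
      by (simp_all add: smul_apply algebra_simps fun_eq_iff)
    then show ?thesis unfolding linear_fun_def L_def
      by (simp add: A_lin[abs_def] A_lin smul_apply algebra_simps)
  qed
  have "linear_op m"
    unfolding linear_op_def m_def fun_eq_iff
    by (simp add: linear_funD[OF lin2] smul_apply add_divide_distrib)
  moreover have "B12 (B23 (\<lambda>a b c. w \<xi> a b * v c)) a b c
    = q * (w \<xi> a b * v c) + dot \<xi> (m v) * \<upsilon> a b c" for \<xi> v a b c
  proof -
    have "L \<xi> v a b c = dot \<xi> (m v) * \<upsilon> a b c"
      unfolding L[of \<xi> v a b c] dot_def m_def
      by (simp add: linear_fun_expand[OF lin1, of \<xi>] sum_divide_distrib)
    then show ?thesis by (simp add: L_def algebra_simps)
  qed
  ultimately show ?thesis by blast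
qed

lemma right_map: "\<exists>m. linear_op m \<and> (\<forall>\<xi> v a b c. B23 (B12 (\<lambda>a b c. v a * w \<xi> b c)) a b c
    = q * (v a * w \<xi> b c) + dot \<xi> (m v) * \<upsilon> a b c)"
proof -
  obtain a0 b0 c0 where nz: "\<upsilon> a0 b0 c0 \<noteq> 0" using upsilon_nonzero by blast
  define L where "L \<xi> v a b c = B23 (B12 (\<lambda>a b c. v a * w \<xi> b c)) a b c - q * (v a * w \<xi> b c)" for \<xi> v a b c
  define m where "m v i = L (idm i) v a0 b0 c0 / \<upsilon> a0 b0 c0" for v i
  have ex: "\<exists>l. \<forall>a b c. L \<xi> v a b c = l * \<upsilon> a b c" for \<xi> v
  proof -
    have "\<exists>\<xi>'. \<forall>b c. v a * w \<xi> b c = w \<xi>' b c" for a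
      by (rule exI[of _ "v a *v \<xi>"]) (simp add: w_linear)
    then have "\<exists>l. \<forall>a b c. B23 (B12 (\<lambda>a b c. v a * w \<xi> b c)) a b c = q * (v a * w \<xi> b c) + l * \<upsilon> a b c"
      by (rule right_ex)
    then show ?thesis unfolding L_def by (metis add_diff_cancel_left')
  qed
  have L: "L \<xi> v a b c = L \<xi> v a0 b0 c0 / \<upsilon> a0 b0 c0 * \<upsilon> a b c" for \<xi> v a b c
  proof -
    obtain l where "\<And>a b c. L \<xi> v a b c = l * \<upsilon> a b c" using ex by blast
    then show ?thesis using nz by simp
  qed
  have lin1: "linear_fun (\<lambda>\<xi>. L \<xi> v a b c)" for v a b c
  proof -
    have "(\<lambda>a b c. v a * w (x + y) b c) = (\<lambda>a b c. v a * w x b c + v a * w y b c)"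
      "(\<lambda>a b c. v a * w (k *v x) b c) = (\<lambda>a b c. k * (v a * w x b c))" for x y k
      by (simp_all add: w_linear algebra_simps fun_eq_iff)
    then show ?thesis unfolding linear_fun_def L_def
      by (simp add: A_lin[abs_def] A_lin w_linear algebra_simps)
  qed
  have lin2: "linear_fun (\<lambda>v. L \<xi> v a b c)" for \<xi> a b c
  proof -
    have "(\<lambda>a b c. (x + y) a * w \<xi> b c) = (\<lambda>a b c. x a * w \<xi> b c + y a * w \<xi> b c)"
      "(\<lambda>a b c. (k *v x) a * w \<xi> b c) = (\<lambda>a b c. k * (x a * w \<xi> b c))" for x y :: "'n \<Rightarrow> 'k" and k
      by (simp_all add: smul_apply algebra_simps fun_eq_iff)
    then show ?thesis unfolding linear_fun_def L_def
      by (simp add: A_lin[abs_def] A_lin smul_apply algebra_simps)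
  qed
  have "linear_op m"
    unfolding linear_op_def m_def fun_eq_iff
    by (simp add: linear_funD[OF lin2] smul_apply add_divide_distrib)
  moreover have "B23 (B12 (\<lambda>a b c. v a * w \<xi> b c)) a b c
    = q * (v a * w \<xi> b c) + dot \<xi> (m v) * \<upsilon> a b c" for \<xi> v a b c
  proof -
    have "L \<xi> v a b c = dot \<xi> (m v) * \<upsilon> a b c"
      unfolding L[of \<xi> v a b c] dot_def m_def
      by (simp add: linear_fun_expand[OF lin1, of \<xi>] sum_divide_distrib)
    then show ?thesis by (simp add: L_def algebra_simps)
  qed
  ultimately show ?thesis by blast
qed

end

locale hecke_maps = hecke_op i0 i1 i2 Z Zi Zt Zit \<delta> M q
  for i0 i1 i2 :: "'n::finite" and Z Zi Zt Zit :: "('n \<Rightarrow> 'k::field) \<Rightarrow> 'n \<Rightarrow> 'k" and \<delta> :: 'k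
    and M :: "'n \<times> 'n \<Rightarrow> 'n \<times> 'n \<Rightarrow> 'k" and q :: 'k +
  fixes m m' :: "('n \<Rightarrow> 'k) \<Rightarrow> 'n \<Rightarrow> 'k"
  assumes m_lin: "linear_op m" and m'_lin: "linear_op m'"
    and left: "\<And>\<xi> v a b c. A12 M (A23 M (\<lambda>a b c. w \<xi> a b * v c)) a b c
      = q * (w \<xi> a b * v c) + dot \<xi> (m v) * \<upsilon> a b c"
    and right: "\<And>\<xi> v a b c. A23 M (A12 M (\<lambda>a b c. v a * w \<xi> b c)) a b c
      = q * (v a * w \<xi> b c) + dot \<xi> (m' v) * \<upsilon> a b c"
begin

text \<open>Both sides of the braid equation are evaluated at x \<otimes> y \<otimes> z: the terms
  with factor q cancel, and the coefficients of \<upsilon> must agree.\<close>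

lemma F_m: "F x y (m z) = F y z (m' x)"
proof -
  obtain a b c where nz: "\<upsilon> a b c \<noteq> 0" using upsilon_nonzero by blast
  define u where "u a b c = x a * y b * z c" for a b c
  have 1: "B12 u = (\<lambda>a b c. w (\<phi> (\<lambda>a b. x a * y b)) a b * z c)"
    by (simp add: A12_def u_def tapply_scale tapply_phi fun_eq_iff)
  have 2: "B23 u = (\<lambda>a b c. x a * w (\<phi> (\<lambda>a b. y a * z b)) b c)"
    by (simp add: A23_def u_def[abs_def] mult.assoc tapply_scale tapply_phi fun_eq_iff)
  have "B12 (B23 (B12 u)) a b c - q * B12 u a b c = B23 (B12 (B23 u)) a b c - q * B23 u a b c"
    by (rule braid)
  then have "dot (\<phi> (\<lambda>a b. x a * y b)) (m z) * \<upsilon> a b c = dot (\<phi> (\<lambda>a b. y a * z b)) (m' x) * \<upsilon> a b c"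
    unfolding 1 2 left right by simp
  then show ?thesis using nz by (simp add: F_def)
qed

text \<open>This is \<open>left\<close> at \<open>w (crs x y)\<close> \<otimes> v in terms of
  \<open>F\<close>; each of the two applications of \<open>M\<close> contributes one factor.\<close>

lemma F_quadratic:
  "F (Zi y) v d * F x e c - F (Zi y) v e * F x d c - F (Zi x) v d * F y e c + F (Zi x) v e * F y d c
    = q * (vol d e (Z v) * vol x y c) + vol x y (m v) * vol d e (Zi c)"
proof -
  define p where "p x = \<phi> (\<lambda>b c. Zi x b * v c)" for x
  define L where "L \<gamma> = dot (\<phi> (\<lambda>a b. x a * crs (Zit \<gamma>) (p y) b - y a * crs (Zit \<gamma>) (p x) b)) c" for \<gamma>
  define R where "R \<gamma> = q * dot \<gamma> v * dot (crs x y) c + dot (crs x y) (m v) * dot (Zit (Zit \<gamma>)) c" for \<gamma>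
  have L: "L \<gamma> = F x (crs (Zit \<gamma>) (p y)) c - F y (crs (Zit \<gamma>) (p x)) c" for \<gamma>
    unfolding L_def phi_lin F_def linear_funD[OF linear_fun_dot(2)] ..
  have crs_lin: "crs (a + b) z = crs a z + crs b z" "crs (k *v a) z = k *v crs a z" for a b z :: "'n \<Rightarrow> 'k" and k
    by (simp_all add: coords algebra_simps)
  have "L \<gamma> = R \<gamma>" for \<gamma>
  proof (rule linear_fun_eqI[of L R])
    show "linear_fun L" unfolding linear_fun_def L
      by (simp add: linear_opD[OF lin(4)] crs_lin F_simps algebra_simps)
    show "linear_fun R" unfolding linear_fun_def R_def
      by (simp add: linear_opD[OF lin(4)] linear_funD[OF linear_fun_dot(2)] algebra_simps)
    fix i
    have "\<phi> (\<lambda>a b. x a * crs (Zit (idm i)) (p y) b - y a * crs (Zit (idm i)) (p x) b)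
      = (q * v i) *v crs x y + dot (crs x y) (m v) *v Zit (Zit (idm i))"
    proof (rule phi_eqI)
      fix a b
      have 1: "B23 (\<lambda>a b c. w (crs x y) a b * v c) a b c = x a * w (p y) b c - y a * w (p x) b c" for a b c
      proof -
        have "(\<lambda>b c. w (crs x y) a b * v c) = (\<lambda>b c. x a * (Zi y b * v c) - y a * (Zi x b * v c))"
          by (simp add: w_crs fun_eq_iff algebra_simps)
        then show ?thesis unfolding A23_def p_def by (simp only: tapply_diff tapply_scale tapply_phi)
      qed
      have "tapply M (\<lambda>a b. x a * crs (Zit (idm i)) (p y) b - y a * crs (Zit (idm i)) (p x) b) a b
        = B12 (B23 (\<lambda>a b c. w (crs x y) a b * v c)) a b i"
        unfolding A12_def 1 w_eq_crs[of "p y"] w_eq_crs[of "p x"] ..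
      then show "tapply M (\<lambda>a b. x a * crs (Zit (idm i)) (p y) b - y a * crs (Zit (idm i)) (p x) b) a b
        = w ((q * v i) *v crs x y + dot (crs x y) (m v) *v Zit (Zit (idm i))) a b"
        unfolding left w_linear upsilon_left by (simp add: mult_ac)
    qed
    then show "L (idm i) = R (idm i)"
      unfolding L_def R_def by (simp add: linear_funD[OF linear_fun_dot(2)] dot_idm)
  qed
  \<comment> \<open>This covector has \<open>crs d e\<close> as its image under \<open>Zit\<close>,
    so that \<open>crs_crs\<close> splits each term into two products.\<close>
  from this[of "Zt (crs d e)"]
  have "F x (crs (crs d e) (p y)) c - F y (crs (crs d e) (p x)) c
    = q * dot (Zt (crs d e)) v * vol x y c + vol x y (m v) * dot (Zit (crs d e)) c"
    unfolding L R_def inv_t vol_def .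
  moreover have "F x (crs (crs d e) (p y)) c = F (Zi y) v d * F x e c - F (Zi y) v e * F x d c" for x y
  proof -
    have "dot d (p y) = F (Zi y) v d" "dot e (p y) = F (Zi y) v e"
      by (simp_all add: F_def p_def dot_commute)
    then show ?thesis by (simp add: crs_crs F_simps)
  qed
  ultimately show ?thesis
    by (simp add: adj[symmetric] vol_def[of d e] algebra_simps)
qed

text \<open>The vector that splits off on the left of \<upsilon> when v enters from the right, see
  \<open>A34_middle\<close>; the factor \<open>inverse \<delta>\<close> is that of
  \<open>upsilon_right\<close>.\<close>

definition G :: "('n \<Rightarrow> 'k) \<Rightarrow> 'n \<Rightarrow> 'k" where "G v = inverse \<delta> *v Z (m v)"

definition A34 :: "('n \<Rightarrow> 'k) \<Rightarrow> 'n \<Rightarrow> 'n \<Rightarrow> 'n \<Rightarrow> 'n \<Rightarrow> 'k" where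
  "A34 v a b c e = tapply M (\<lambda>c e. \<upsilon> a b c * v e) c e"

lemma G_lin: "linear_op G"
  unfolding G_def[abs_def] by (rule linear_op_scale[OF linear_op_comp[OF lin(1) m_lin]])

lemma A34_middle: "tapply M (\<lambda>b c. A34 v a b c e) b c = q * (\<upsilon> a b c * v e) + G v a * \<upsilon> b c e"
proof -
  have "dot (inverse \<delta> *v Zt (idm a)) (m v) = G v a"
    unfolding linear_funD[OF linear_fun_dot(2)] adj(1)[symmetric] dot_idm G_def smul_apply ..
  then show ?thesis
    using left[of "inverse \<delta> *v Zt (idm a)" v b c e]
    by (simp add: A12_def A23_def A34_def upsilon_right[symmetric])
qed

lemma A34_left: "A34 v a b c e = w (\<lambda>i. \<Sum>x\<in>UNIV. Zit (Zit (idm x)) i * tapply M (\<lambda>c e. idm x c * v e) c e) a b"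
proof -
  have "(\<lambda>c e. \<upsilon> a b c * v e) = (\<lambda>c e. \<Sum>x\<in>UNIV. \<upsilon> a b x * (idm x c * v e))"
    by (simp add: sum_distrib_right[symmetric] mult.assoc[symmetric] sum_idm fun_eq_iff)
  then have "A34 v a b c e = (\<Sum>x\<in>UNIV. \<upsilon> a b x * tapply M (\<lambda>c e. idm x c * v e) c e)"
    unfolding A34_def by (simp only: tapply_sum)
  also have "\<dots> = (\<Sum>x\<in>UNIV. tapply M (\<lambda>c e. idm x c * v e) c e * w (Zit (Zit (idm x))) a b)"
    by (simp add: upsilon_left mult.commute)
  also have "\<dots> = w (\<lambda>i. \<Sum>x\<in>UNIV. tapply M (\<lambda>c e. idm x c * v e) c e * Zit (Zit (idm x)) i) a b"
    by (rule linear_fun_sum[OF linear_fun_w, symmetric]) simp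
  finally show ?thesis by (simp add: mult.commute)
qed

lemma A_upsilon: "tapply M (\<lambda>a b. \<upsilon> a b c) a b = s * \<upsilon> a b c" "tapply M (\<upsilon> a) b c = s * \<upsilon> a b c"
proof -
  have 1: "(\<lambda>a b. \<upsilon> a b c) = w (Zit (Zit (idm c)))" by (simp add: fun_eq_iff upsilon_left)
  show "tapply M (\<lambda>a b. \<upsilon> a b c) a b = s * \<upsilon> a b c"
    unfolding 1 tapply_w upsilon_left[of a b c] ..
  have 2: "\<upsilon> a = w (inverse \<delta> *v Zt (idm a))" by (simp add: fun_eq_iff upsilon_right)
  show "tapply M (\<upsilon> a) b c = s * \<upsilon> a b c" unfolding 2 tapply_w ..
qed

lemma B_upsilon: "B12 \<upsilon> = (\<lambda>a b c. s * \<upsilon> a b c)" "B23 \<upsilon> = (\<lambda>a b c. s * \<upsilon> a b c)"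
  unfolding A12_def[abs_def] A23_def[abs_def] A_upsilon by (rule refl)+

text \<open>\<open>left_ex\<close> in slots 1 to 3, applied to \<open>A34 v\<close>, shows that the
  two sides differ by \<upsilon> \<otimes> \<mu> for some \<mu>. Both sides have their last two
  slots in \<open>W\<close>, so \<mu> = 0 by \<open>slice_tensor_eq_0\<close>.\<close>

lemma G_upsilon: "tapply M (\<lambda>a b. G v a * \<upsilon> b c e) a b = q * A34 v a b c e"
proof -
  have "\<exists>l. \<forall>a b c. B12 (B23 (\<lambda>a b c. A34 v a b c e)) a b c = q * A34 v a b c e + l * \<upsilon> a b c" for e
    by (rule left_ex) (use A34_left in blast)
  then obtain l where l: "\<And>a b c e. B12 (B23 (\<lambda>a b c. A34 v a b c e)) a b c = q * A34 v a b c e + l e * \<upsilon> a b c"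
    by metis
  have 1: "tapply M (\<lambda>a b. G v a * \<upsilon> b c e) a b - q * A34 v a b c e = \<upsilon> a b c * (l e - q * s * v e)" for a b c e
  proof -
    have "B12 (B23 (\<lambda>a b c. A34 v a b c e)) a b c
      = tapply M (\<lambda>a b. (q * v e) * \<upsilon> a b c + G v a * \<upsilon> b c e) a b"
      unfolding A12_def A23_def A34_middle by (simp add: mult_ac)
    also have "\<dots> = q * v e * (s * \<upsilon> a b c) + tapply M (\<lambda>a b. G v a * \<upsilon> b c e) a b"
      unfolding tapply_add tapply_scale A_upsilon ..
    finally show ?thesis unfolding l by (simp add: algebra_simps)
  qed
  have "(\<lambda>e. l e - q * s * v e) = 0"
  proof (rule slice_tensor_eq_0)
    fix a b
    define \<xi> where "\<xi> = (\<lambda>i. \<Sum>x\<in>UNIV. tapply M (\<lambda>a b. G v a * idm x b) a b * (inverse \<delta> *v Zt (idm x)) i)"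
    have "tapply M (\<lambda>a b. G v a * \<upsilon> b c e) a b = w \<xi> c e" for c e
    proof -
      have "(\<lambda>a b. G v a * \<upsilon> b c e) = (\<lambda>a b. \<Sum>x\<in>UNIV. \<upsilon> x c e * (G v a * idm x b))"
        by (simp add: mult.left_commute[of _ "G v _"] sum_distrib_left[symmetric] sum_idm fun_eq_iff)
      then have "tapply M (\<lambda>a b. G v a * \<upsilon> b c e) a b
        = (\<Sum>x\<in>UNIV. \<upsilon> x c e * tapply M (\<lambda>a b. G v a * idm x b) a b)"
        by (simp only: tapply_sum)
      also have "\<dots> = (\<Sum>x\<in>UNIV. tapply M (\<lambda>a b. G v a * idm x b) a b * w (inverse \<delta> *v Zt (idm x)) c e)"
        by (simp only: upsilon_right mult.commute[of "w _ _ _"])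
      also have "\<dots> = w \<xi> c e" unfolding \<xi>_def
        by (rule linear_fun_sum[OF linear_fun_w, symmetric]) simp
      finally show ?thesis .
    qed
    then have "\<upsilon> a b c * (l e - q * s * v e) = w (\<xi> - q *v \<phi> (\<lambda>c e. \<upsilon> a b c * v e)) c e" for c e
      unfolding 1[symmetric] w_linear A34_def tapply_phi by simp
    then show "\<exists>\<xi>. \<forall>c e. \<upsilon> a b c * (l e - q * s * v e) = w \<xi> c e" by blast
  qed
  then have "l e - q * s * v e = 0" by (simp add: fun_eq_iff)
  then show ?thesis using 1[of c e a b] by simp
qed

text \<open>\<open>G_upsilon\<close> in coordinates, with \<upsilon> expanded by
  \<open>upsilon_right\<close> on one side and by \<open>upsilon_left\<close> on the other. This is
  the cyclic symmetry of \<open>F\<close>.\<close>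

lemma F_G: "F (G v) (Z x) y = q * \<delta> * F (Zi (Zi y)) v x"
proof -
  have 1: "inverse \<delta> * F (G v) (Z (idm i)) y = q * F (Zi (Zi y)) v (idm i)" for i
  proof -
    have A: "(inverse \<delta> *v (\<lambda>i. w (\<phi> (\<lambda>a b. G v a * Z (idm i) b)) a b)) = q *v \<phi> (\<lambda>c e. \<upsilon> a b c * v e)" for a b
    proof (rule w_inj)
      fix c e
      have "(\<lambda>a b. G v a * \<upsilon> b c e) = (\<lambda>a b. \<Sum>i\<in>UNIV. (inverse \<delta> * w (idm i) c e) * (G v a * Z (idm i) b))"
      proof (intro ext)
        fix a b
        have "\<upsilon> b c e = (\<Sum>i\<in>UNIV. inverse \<delta> * Z (idm i) b * w (idm i) c e)"
          unfolding upsilon_right linear_fun_expand[OF linear_fun_w, of "inverse \<delta> *v Zt (idm b)"]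
          by (simp add: smul_apply transpose_idm)
        then show "G v a * \<upsilon> b c e = (\<Sum>i\<in>UNIV. (inverse \<delta> * w (idm i) c e) * (G v a * Z (idm i) b))"
          by (simp add: sum_distrib_left mult_ac)
      qed
      then have "q * A34 v a b c e = (\<Sum>i\<in>UNIV. (inverse \<delta> * w (idm i) c e) * w (\<phi> (\<lambda>a b. G v a * Z (idm i) b)) a b)"
        unfolding G_upsilon[symmetric] by (simp only: tapply_sum tapply_phi)
      then show "w (inverse \<delta> *v (\<lambda>i. w (\<phi> (\<lambda>a b. G v a * Z (idm i) b)) a b)) c e = w (q *v \<phi> (\<lambda>c e. \<upsilon> a b c * v e)) c e"
        unfolding w_linear A34_def tapply_phi linear_fun_expand[OF linear_fun_w, of "\<lambda>i. w (\<phi> (\<lambda>a b. G v a * Z (idm i) b)) a b"]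
        by (simp add: sum_distrib_left mult_ac)
    qed
    have B: "inverse \<delta> *v \<phi> (\<lambda>a b. G v a * Z (idm i) b) = q *v (\<lambda>j. \<Sum>c\<in>UNIV. F (idm c) v (idm i) * Zit (Zit (idm c)) j)"
    proof (rule w_inj)
      fix a b
      have lf: "linear_fun (\<lambda>x. F x v (idm i))" using trilinear_F by (simp add: trilinear_def)
      have "inverse \<delta> * w (\<phi> (\<lambda>a b. G v a * Z (idm i) b)) a b = q * F (\<upsilon> a b) v (idm i)"
        using fun_cong[OF A, of a b i] by (simp add: smul_apply F_def dot_idm)
      also have "F (\<upsilon> a b) v (idm i) = (\<Sum>c\<in>UNIV. F (idm c) v (idm i) * w (Zit (Zit (idm c))) a b)"
        unfolding linear_fun_expand[OF lf, of "\<upsilon> a b"] upsilon_left by (simp add: mult.commute)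
      also have "\<dots> = w (\<lambda>j. \<Sum>c\<in>UNIV. F (idm c) v (idm i) * Zit (Zit (idm c)) j) a b"
        by (rule linear_fun_sum[OF linear_fun_w, symmetric]) simp
      finally show "w (inverse \<delta> *v \<phi> (\<lambda>a b. G v a * Z (idm i) b)) a b
        = w (q *v (\<lambda>j. \<Sum>c\<in>UNIV. F (idm c) v (idm i) * Zit (Zit (idm c)) j)) a b"
        by (simp add: w_linear)
    qed
    have lf: "linear_fun (\<lambda>x. F x v (idm i))" using trilinear_F by (simp add: trilinear_def)
    have "inverse \<delta> * F (G v) (Z (idm i)) y = dot (inverse \<delta> *v \<phi> (\<lambda>a b. G v a * Z (idm i) b)) y"
      by (simp add: F_def linear_funD[OF linear_fun_dot(2)])
    also have "\<dots> = q * (\<Sum>c\<in>UNIV. F (idm c) v (idm i) * dot (Zit (Zit (idm c))) y)"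
      unfolding B by (simp add: linear_funD[OF linear_fun_dot(2)] linear_fun_sum[OF linear_fun_dot(2)])
    also have "\<dots> = q * F (Zi (Zi y)) v (idm i)"
      unfolding adj[symmetric] dot_idm linear_fun_expand[OF lf, of "Zi (Zi y)"] by (simp add: mult.commute)
    finally show ?thesis .
  qed
  have "inverse \<delta> * F (G v) (Z x) y = q * F (Zi (Zi y)) v x"
  proof (rule linear_fun_eqI[of "\<lambda>x. inverse \<delta> * F (G v) (Z x) y" "\<lambda>x. q * F (Zi (Zi y)) v x"])
    show "linear_fun (\<lambda>x. inverse \<delta> * F (G v) (Z x) y)" "linear_fun (\<lambda>x. q * F (Zi (Zi y)) v x)"
      unfolding linear_fun_def by (simp_all add: linear_opD[OF lin(1)] F_simps algebra_simps)
  qed (rule 1)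
  then show ?thesis using delta_neq_0 by (simp add: field_simps)
qed

text \<open>B23 B12 of Gv \<otimes> \<upsilon> is known twice: from \<open>right\<close>, and from
  \<open>G_upsilon\<close> followed by \<open>A34_middle\<close>. The comparison makes
  \<open>G\<close> invertible.\<close>

lemma m'_G: "m' (G v) = (q * q) *v Z (Z v)"
proof -
  have "Zi (Zi (m' (G v))) = (q * q) *v v"
  proof
    fix e
    obtain a b c where nz: "\<upsilon> a b c \<noteq> 0" using upsilon_nonzero by blast
    have "B12 (\<lambda>a b c. G v a * \<upsilon> b c e) = (\<lambda>a b c. q * A34 v a b c e)"
      by (simp add: A12_def G_upsilon fun_eq_iff)
    then have 1: "B23 (B12 (\<lambda>a b c. G v a * \<upsilon> b c e)) a b c
      = q * (q * (\<upsilon> a b c * v e) + G v a * \<upsilon> b c e)"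
      by (simp add: A23_def tapply_scale A34_middle)
    have "dot (Zit (Zit (idm e))) (m' (G v)) = Zi (Zi (m' (G v))) e"
      by (simp add: adj[symmetric] dot_idm)
    then have "B23 (B12 (\<lambda>a b c. G v a * \<upsilon> b c e)) a b c
      = q * (G v a * \<upsilon> b c e) + Zi (Zi (m' (G v))) e * \<upsilon> a b c"
      using right[of "G v" "Zit (Zit (idm e))" a b c] by (simp only: upsilon_left[symmetric])
    then have "Zi (Zi (m' (G v))) e * \<upsilon> a b c = q * q * v e * \<upsilon> a b c"
      unfolding 1 by (auto simp: algebra_simps)
    then show "Zi (Zi (m' (G v))) e = ((q * q) *v v) e" using nz by (simp add: smul_apply)
  qed
  then have "Z (Z (Zi (Zi (m' (G v))))) = (q * q) *v Z (Z v)" by (simp add: linear_opD[OF lin(1)])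
  then show ?thesis by (simp add: inv)
qed

text \<open>B12 B23 multiplies \<upsilon> by s^2, while expanding \<upsilon> over a basis and using
  \<open>left\<close> gives q plus the trace; and s^2 - q = 1 + q + q^2.\<close>

lemma trace_m: "(\<Sum>i\<in>UNIV. m (Zi (Zi (idm i))) i) = 1 + q + q\<^sup>2"
proof -
  obtain a b c where nz: "\<upsilon> a b c \<noteq> 0" using upsilon_nonzero by blast
  have u: "\<upsilon> = (\<lambda>a b c. \<Sum>i\<in>UNIV. 1 * (w (idm i) a b * Zi (Zi (idm i)) c))"
  proof (intro ext)
    fix a b c
    show "\<upsilon> a b c = (\<Sum>i\<in>UNIV. 1 * (w (idm i) a b * Zi (Zi (idm i)) c))"
      unfolding upsilon_left linear_fun_expand[OF linear_fun_w, of "Zit (Zit (idm c))"]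
      using adj(2)[of "Zit (idm c)"] adj(2)[of "idm c"]
      by (simp add: dot_idm(2)[symmetric, of "Zit (Zit (idm c))"] dot_idm(1) mult.commute)
  qed
  have s: "B12 (B23 \<upsilon>) a b c = s * s * \<upsilon> a b c"
    by (simp add: B_upsilon A_lin)
  have "B12 (B23 \<upsilon>) a b c = (\<Sum>i\<in>UNIV. 1 * B12 (B23 (\<lambda>a b c. w (idm i) a b * Zi (Zi (idm i)) c)) a b c)"
    by (subst u) (simp only: A_sum[abs_def] A_sum)
  also have "\<dots> = q * (\<Sum>i\<in>UNIV. 1 * (w (idm i) a b * Zi (Zi (idm i)) c)) + (\<Sum>i\<in>UNIV. m (Zi (Zi (idm i))) i) * \<upsilon> a b c"
    unfolding left dot_idm by (simp add: sum.distrib sum_distrib_left sum_distrib_right)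
  also have "\<dots> = q * \<upsilon> a b c + (\<Sum>i\<in>UNIV. m (Zi (Zi (idm i))) i) * \<upsilon> a b c"
    by (simp only: u[symmetric] fun_cong[OF fun_cong[OF fun_cong[OF u]], symmetric])
  finally have "(s * s - q - (\<Sum>i\<in>UNIV. m (Zi (Zi (idm i))) i)) * \<upsilon> a b c = 0"
    unfolding s by (simp add: algebra_simps)
  then have "(\<Sum>i\<in>UNIV. m (Zi (Zi (idm i))) i) = s * s - q" using nz by simp
  then show ?thesis by (simp add: power2_eq_square algebra_simps)
qed

lemma trace_m': "(\<Sum>i\<in>UNIV. m' (Z (idm i)) i) = \<delta> * (1 + q + q\<^sup>2)"
proof -
  obtain a b c where nz: "\<upsilon> a b c \<noteq> 0" using upsilon_nonzero by blast
  have u: "\<upsilon> = (\<lambda>a b c. \<Sum>i\<in>UNIV. inverse \<delta> * (Z (idm i) a * w (idm i) b c))"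
  proof (intro ext)
    fix a b c
    show "\<upsilon> a b c = (\<Sum>i\<in>UNIV. inverse \<delta> * (Z (idm i) a * w (idm i) b c))"
      unfolding upsilon_right linear_fun_expand[OF linear_fun_w, of "inverse \<delta> *v Zt (idm a)"]
      by (simp add: transpose_idm smul_apply mult_ac)
  qed
  have s: "B23 (B12 \<upsilon>) a b c = s * s * \<upsilon> a b c"
    by (simp add: B_upsilon A_lin)
  have "B23 (B12 \<upsilon>) a b c = (\<Sum>i\<in>UNIV. inverse \<delta> * B23 (B12 (\<lambda>a b c. Z (idm i) a * w (idm i) b c)) a b c)"
    by (subst u) (simp only: A_sum[abs_def] A_sum)
  also have "\<dots> = q * (\<Sum>i\<in>UNIV. inverse \<delta> * (Z (idm i) a * w (idm i) b c)) + inverse \<delta> * (\<Sum>i\<in>UNIV. m' (Z (idm i)) i) * \<upsilon> a b c"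
    unfolding right dot_idm by (simp add: sum.distrib sum_distrib_left sum_distrib_right algebra_simps)
  also have "\<dots> = q * \<upsilon> a b c + inverse \<delta> * (\<Sum>i\<in>UNIV. m' (Z (idm i)) i) * \<upsilon> a b c"
    by (simp only: fun_cong[OF fun_cong[OF fun_cong[OF u]], symmetric])
  finally have "(s * s - q - inverse \<delta> * (\<Sum>i\<in>UNIV. m' (Z (idm i)) i)) * \<upsilon> a b c = 0"
    unfolding s by (simp add: algebra_simps)
  then have "inverse \<delta> * (\<Sum>i\<in>UNIV. m' (Z (idm i)) i) = s * s - q" using nz by simp
  then have "(\<Sum>i\<in>UNIV. m' (Z (idm i)) i) = \<delta> * (s * s - q)" using delta_neq_0 by (simp add: field_simps)
  then show ?thesis by (simp add: power2_eq_square algebra_simps)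
qed

end

section \<open>The braiding on five tensor factors and the scalar relating \<open>G\<close> and
  \<zeta>\<close>

context hecke_maps
begin

definition R :: "('n \<Rightarrow> 'n \<Rightarrow> 'k) \<Rightarrow> 'n \<Rightarrow> 'n \<Rightarrow> 'k" where
  "R t a b = tapply M t a b + q * t a b"

lemma R_scale: "R (\<lambda>a b. k * t a b) a b = k * R t a b" "R (\<lambda>a b. t a b * k) a b = R t a b * k"
  by (simp_all add: R_def tapply_scale algebra_simps)

lemma R_add: "R (\<lambda>a b. t a b + u a b) a b = R t a b + R u a b"
  by (simp add: R_def tapply_add algebra_simps)

lemma R_sum: "R t a b = (\<Sum>c\<in>UNIV. \<Sum>d\<in>UNIV. (M (a, b) (c, d) + q * (idm a c * idm b d)) * t c d)"
proof -
  have "(\<Sum>c\<in>UNIV. \<Sum>d\<in>UNIV. idm a c * idm b d * t c d) = (\<Sum>c\<in>UNIV. idm a c * (\<Sum>d\<in>UNIV. idm b d * t c d))"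
    by (simp add: sum_distrib_left mult.assoc)
  then have "t a b = (\<Sum>c\<in>UNIV. \<Sum>d\<in>UNIV. idm a c * idm b d * t c d)" by (simp add: sum_idm)
  then have "R t a b = tapply M t a b + q * (\<Sum>c\<in>UNIV. \<Sum>d\<in>UNIV. idm a c * idm b d * t c d)"
    by (simp only: R_def)
  then show ?thesis
    by (simp add: tapply_def distrib_right sum.distrib sum_distrib_left mult.assoc)
qed

lemma R_commute:
  "R (\<lambda>a b. R (\<lambda>c d. t a b c d) c d) a b = R (\<lambda>c d. R (\<lambda>a b. t a b c d) a b) c d"
proof -
  let ?K = "\<lambda>a b c d. M (a, b) (c, d) + q * (idm a c * idm b d)"
  have "R (\<lambda>a b. R (\<lambda>c d. t a b c d) c d) a b
    = (\<Sum>a'\<in>UNIV. \<Sum>b'\<in>UNIV. \<Sum>c'\<in>UNIV. \<Sum>d'\<in>UNIV. ?K a b a' b' * (?K c d c' d' * t a' b' c' d'))"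
    unfolding R_sum by (simp add: sum_distrib_left)
  also have "\<dots> = (\<Sum>a'\<in>UNIV. \<Sum>c'\<in>UNIV. \<Sum>b'\<in>UNIV. \<Sum>d'\<in>UNIV. ?K a b a' b' * (?K c d c' d' * t a' b' c' d'))"
    by (intro sum.cong refl sum.swap)
  also have "\<dots> = (\<Sum>c'\<in>UNIV. \<Sum>a'\<in>UNIV. \<Sum>b'\<in>UNIV. \<Sum>d'\<in>UNIV. ?K a b a' b' * (?K c d c' d' * t a' b' c' d'))"
    by (rule sum.swap)
  also have "\<dots> = (\<Sum>c'\<in>UNIV. \<Sum>a'\<in>UNIV. \<Sum>d'\<in>UNIV. \<Sum>b'\<in>UNIV. ?K a b a' b' * (?K c d c' d' * t a' b' c' d'))"
    by (intro sum.cong refl sum.swap)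
  also have "\<dots> = (\<Sum>c'\<in>UNIV. \<Sum>d'\<in>UNIV. \<Sum>a'\<in>UNIV. \<Sum>b'\<in>UNIV. ?K a b a' b' * (?K c d c' d' * t a' b' c' d'))"
    by (intro sum.cong refl sum.swap)
  also have "\<dots> = R (\<lambda>c d. R (\<lambda>a b. t a b c d) a b) c d"
    unfolding R_sum by (simp add: sum_distrib_left mult.left_commute)
  finally show ?thesis .
qed

definition R12 :: "('n \<Rightarrow> 'n \<Rightarrow> 'n \<Rightarrow> 'k) \<Rightarrow> 'n \<Rightarrow> 'n \<Rightarrow> 'n \<Rightarrow> 'k" where
  "R12 u a b c = R (\<lambda>a b. u a b c) a b"

definition R23 :: "('n \<Rightarrow> 'n \<Rightarrow> 'n \<Rightarrow> 'k) \<Rightarrow> 'n \<Rightarrow> 'n \<Rightarrow> 'n \<Rightarrow> 'k" where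
  "R23 u a b c = R (\<lambda>b c. u a b c) b c"

lemma R12_B12: "R12 u = (\<lambda>a b c. B12 u a b c + q * u a b c)"
  and R23_B23: "R23 u = (\<lambda>a b c. B23 u a b c + q * u a b c)"
  by (simp_all add: R12_def R23_def A12_def A23_def R_def fun_eq_iff)

lemma B_square: "B12 (B12 u) a b c = s * B12 u a b c" "B23 (B23 u) a b c = s * B23 u a b c"
  unfolding A12_def A23_def
  using hecke[of "\<lambda>a b. u a b c" a b] hecke[of "u a" b c] by (simp_all add: A12_def[abs_def] A23_def[abs_def])

lemma R_braid: "R12 (R23 (R12 u)) a b c = R23 (R12 (R23 u)) a b c"
  using braid[of u a b c]
  by (simp add: R12_B12 R23_B23 A_lin[abs_def] A_lin B_square[abs_def] B_square algebra_simps)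

definition r1 :: "('n \<Rightarrow> 'n \<Rightarrow> 'n \<Rightarrow> 'n \<Rightarrow> 'n \<Rightarrow> 'k) \<Rightarrow> 'n \<Rightarrow> 'n \<Rightarrow> 'n \<Rightarrow> 'n \<Rightarrow> 'n \<Rightarrow> 'k" where
  "r1 t a b c d e = R (\<lambda>a b. t a b c d e) a b"
definition r2 :: "('n \<Rightarrow> 'n \<Rightarrow> 'n \<Rightarrow> 'n \<Rightarrow> 'n \<Rightarrow> 'k) \<Rightarrow> 'n \<Rightarrow> 'n \<Rightarrow> 'n \<Rightarrow> 'n \<Rightarrow> 'n \<Rightarrow> 'k" where
  "r2 t a b c d e = R (\<lambda>b c. t a b c d e) b c"
definition r3 :: "('n \<Rightarrow> 'n \<Rightarrow> 'n \<Rightarrow> 'n \<Rightarrow> 'n \<Rightarrow> 'k) \<Rightarrow> 'n \<Rightarrow> 'n \<Rightarrow> 'n \<Rightarrow> 'n \<Rightarrow> 'n \<Rightarrow> 'k" where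
  "r3 t a b c d e = R (\<lambda>c d. t a b c d e) c d"
definition r4 :: "('n \<Rightarrow> 'n \<Rightarrow> 'n \<Rightarrow> 'n \<Rightarrow> 'n \<Rightarrow> 'k) \<Rightarrow> 'n \<Rightarrow> 'n \<Rightarrow> 'n \<Rightarrow> 'n \<Rightarrow> 'n \<Rightarrow> 'k" where
  "r4 t a b c d e = R (\<lambda>d e. t a b c d e) d e"

lemma r_braid: "r1 (r2 (r1 t)) = r2 (r1 (r2 t))" "r2 (r3 (r2 t)) = r3 (r2 (r3 t))"
  "r3 (r4 (r3 t)) = r4 (r3 (r4 t))"
proof -
  show "r1 (r2 (r1 t)) = r2 (r1 (r2 t))"
  proof (intro ext)
    fix a b c d e
    show "r1 (r2 (r1 t)) a b c d e = r2 (r1 (r2 t)) a b c d e"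
      using R_braid[of "\<lambda>a b c. t a b c d e" a b c]
      unfolding r1_def r2_def R12_def R23_def .
  qed
  show "r2 (r3 (r2 t)) = r3 (r2 (r3 t))"
  proof (intro ext)
    fix a b c d e
    show "r2 (r3 (r2 t)) a b c d e = r3 (r2 (r3 t)) a b c d e"
      using R_braid[of "\<lambda>b c d. t a b c d e" b c d]
      unfolding r2_def r3_def R12_def R23_def .
  qed
  show "r3 (r4 (r3 t)) = r4 (r3 (r4 t))"
  proof (intro ext)
    fix a b c d e
    show "r3 (r4 (r3 t)) a b c d e = r4 (r3 (r4 t)) a b c d e"
      using R_braid[of "\<lambda>c d e. t a b c d e" c d e]
      unfolding r3_def r4_def R12_def R23_def .
  qed
qed

lemma r_commute: "r1 (r3 t) = r3 (r1 t)" "r1 (r4 t) = r4 (r1 t)" "r2 (r4 t) = r4 (r2 t)"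
proof -
  show "r1 (r3 t) = r3 (r1 t)" unfolding r1_def r3_def
    by (intro ext) (rule R_commute[of "\<lambda>a b c d. t a b c d e" for e])
  show "r1 (r4 t) = r4 (r1 t)" unfolding r1_def r4_def
    by (intro ext) (rule R_commute[of "\<lambda>a b d e. t a b c d e" for c])
  show "r2 (r4 t) = r4 (r2 t)" unfolding r2_def r4_def
    by (intro ext) (rule R_commute[of "\<lambda>b c d e. t a b c d e" for a])
qed

text \<open>Dragging two strands across three others by X = r2 r3 r4 r1 r2 r3 carries their crossing
  from the last two positions to the first two, so that r1 X = X r4.\<close>

lemma r_shift: "r1 (r2 (r3 (r4 (r1 (r2 (r3 t)))))) = r2 (r3 (r4 (r1 (r2 (r3 (r4 t))))))"
proof -
  have "r1 (r2 (r3 (r4 (r1 (r2 (r3 t)))))) = r1 (r2 (r1 (r3 (r4 (r2 (r3 t))))))" by (simp only: r_commute)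
  also have "\<dots> = r2 (r1 (r2 (r3 (r4 (r2 (r3 t))))))" by (rule r_braid(1))
  also have "\<dots> = r2 (r1 (r2 (r3 (r2 (r4 (r3 t))))))" by (simp only: r_commute)
  also have "\<dots> = r2 (r1 (r3 (r2 (r3 (r4 (r3 t))))))" by (simp only: r_braid(2))
  also have "\<dots> = r2 (r1 (r3 (r2 (r4 (r3 (r4 t))))))" by (simp only: r_braid(3))
  also have "\<dots> = r2 (r3 (r4 (r1 (r2 (r3 (r4 t))))))" by (simp only: r_commute)
  finally show ?thesis .
qed

text \<open>Dragging \<open>v\<close> across \<open>\<upsilon>\<close> by the braiding applies \<open>q G\<close> to \<open>v\<close>; this makes \<open>G \<otimes> G\<close>
  commute with \<open>R\<close>.\<close>

lemma drag:
  "R (\<lambda>a b. R (\<lambda>b c. R (\<lambda>c e. \<upsilon> a b c * v e) c e) b c) a b = q * (G v a * \<upsilon> b c e)"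
proof -
  have 3: "R (\<lambda>c e. \<upsilon> a b c * v e) c e = A34 v a b c e + q * (\<upsilon> a b c * v e)" for a b c e
    by (simp add: R_def A34_def)
  have 2: "R (\<lambda>b c. A34 v a b c e + q * (\<upsilon> a b c * v e)) b c = G v a * \<upsilon> b c e + q * A34 v a b c e" for a b c
  proof -
    have "R (\<lambda>b c. A34 v a b c e) b c = q * (\<upsilon> a b c * v e) + G v a * \<upsilon> b c e + q * A34 v a b c e"
      by (simp add: R_def A34_middle)
    moreover have "R (\<lambda>b c. q * (\<upsilon> a b c * v e)) b c = - q * (\<upsilon> a b c * v e)"
      unfolding R_scale using A_upsilon(2)[of a b c] by (simp add: R_def algebra_simps)
    ultimately show ?thesis unfolding R_add by simp
  qed
  have "R (\<lambda>a b. A34 v a b c e) a b = - A34 v a b c e"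
  proof -
    obtain \<xi> where "\<And>a b. A34 v a b c e = w \<xi> a b" using A34_left by blast
    then show ?thesis by (simp add: R_def tapply_w algebra_simps)
  qed
  then show ?thesis unfolding 3 2 R_add R_scale
    by (simp add: R_def G_upsilon algebra_simps)
qed

definition GG :: "('n \<Rightarrow> 'n \<Rightarrow> 'k) \<Rightarrow> 'n \<Rightarrow> 'n \<Rightarrow> 'k" where
  "GG t a b = G (\<lambda>e. G (\<lambda>d. t d e) a) b"

text \<open>\<open>r_shift\<close> is applied to \<upsilon> \<otimes> t. By \<open>drag\<close>, the
  long braid moves both factors of t past \<upsilon> and applies q G to each, so a crossing of the
  two factors may come before or after.\<close>

lemma GG_R: "R (GG t) a b = GG (R t) a b"
proof -
  obtain c d e where nz: "\<upsilon> c d e \<noteq> 0" using upsilon_nonzero by blast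
  have 1: "r1 (r2 (r3 (\<lambda>a b c d e. \<upsilon> a b c * y d e))) = (\<lambda>a b c d e. q * (G (\<lambda>d. y d e) a * \<upsilon> b c d))" for y
    unfolding r1_def r2_def r3_def by (intro ext) (simp only: drag)
  have 2: "r2 (r3 (r4 (\<lambda>a b c d e. g a e * \<upsilon> b c d))) = (\<lambda>a b c d e. q * (G (g a) b * \<upsilon> c d e))" for g
    unfolding r2_def r3_def r4_def by (intro ext) (simp add: mult.commute[of "g _ _"] drag)
  have 3: "r2 (r3 (r4 (r1 (r2 (r3 (\<lambda>a b c d e. \<upsilon> a b c * y d e)))))) = (\<lambda>a b c d e. q * q * (GG y a b * \<upsilon> c d e))" for y
  proof -
    have "r2 (r3 (r4 (r1 (r2 (r3 (\<lambda>a b c d e. \<upsilon> a b c * y d e))))))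
      = r2 (r3 (r4 (\<lambda>a b c d e. (q *v (\<lambda>e. G (\<lambda>d. y d e) a)) e * \<upsilon> b c d)))"
      unfolding 1 by (simp add: smul_apply mult.assoc)
    then show ?thesis unfolding 2 linear_opD[OF G_lin] by (simp add: GG_def smul_apply mult.assoc)
  qed
  have 4: "r4 (\<lambda>a b c d e. \<upsilon> a b c * t d e) = (\<lambda>a b c d e. \<upsilon> a b c * R t d e)"
    by (intro ext) (simp add: r4_def R_scale)
  have "r1 (\<lambda>a b c d e. q * q * (GG t a b * \<upsilon> c d e)) = (\<lambda>a b c d e. q * q * (GG (R t) a b * \<upsilon> c d e))"
    unfolding 3[symmetric] r_shift 4 ..
  then have "r1 (\<lambda>a b c d e. q * q * (GG t a b * \<upsilon> c d e)) a b c d e = q * q * (GG (R t) a b * \<upsilon> c d e)"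
    by (simp add: fun_eq_iff)
  then have "q * q * (R (GG t) a b * \<upsilon> c d e) = q * q * (GG (R t) a b * \<upsilon> c d e)"
    unfolding r1_def R_scale by (simp add: R_scale)
  then show ?thesis using nz q by simp
qed

lemma GG_A: "tapply M (GG t) a b = GG (tapply M t) a b"
proof -
  have "GG (R t) a b = GG (tapply M t) a b + q * GG t a b"
  proof -
    have 1: "(\<lambda>d. R t d e) = (\<lambda>d. tapply M t d e) + q *v (\<lambda>d. t d e)" for e
      by (simp add: R_def smul_apply fun_eq_iff)
    have "(\<lambda>e. G (\<lambda>d. R t d e) a) = (\<lambda>e. G (\<lambda>d. tapply M t d e) a) + q *v (\<lambda>e. G (\<lambda>d. t d e) a)"
      unfolding 1 linear_opD[OF G_lin] by (simp add: smul_apply fun_eq_iff)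
    then show ?thesis unfolding GG_def by (simp add: linear_opD[OF G_lin] smul_apply)
  qed
  then show ?thesis using GG_R[of t a b] by (simp add: R_def)
qed

definition Gi :: "('n \<Rightarrow> 'k) \<Rightarrow> 'n \<Rightarrow> 'k" where
  "Gi x = inverse (q * q) *v Zi (Zi (m' x))"

lemma Gi_lin: "linear_op Gi"
  unfolding Gi_def[abs_def] by (rule linear_op_scale[OF linear_op_comp[OF lin(2) linear_op_comp[OF lin(2) m'_lin]]])

lemma Gi_G: "Gi (G x) = x"
  using q by (intro ext) (simp add: Gi_def m'_G linear_opD[OF lin(2)] inv smul_apply field_simps)

lemma G_Gi: "G (Gi x) = x"
  by (rule left_inverse_right_inverse[OF G_lin Gi_lin Gi_G])

text \<open>G \<otimes> G preserves \<open>W\<close>. On the relations of \<open>w_crs\<close> this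
  says that x \<otimes> H y - y \<otimes> H x is alternating for H = \<zeta> G \<zeta>^-1 G^-1, and
  then H must be a scalar.\<close>

lemma Z_G: "\<exists>c. \<forall>x. Z (G (Zi x)) = c *v G x"
proof -
  define H where "H x = Z (G (Zi (Gi x)))" for x
  have H: "linear_op H" unfolding H_def[abs_def]
    by (rule linear_op_comp[OF lin(1) linear_op_comp[OF G_lin linear_op_comp[OF lin(2) Gi_lin]]])
  have pair: "dot \<gamma> x * dot \<gamma> (H y) = dot \<gamma> y * dot \<gamma> (H x)" for x y \<gamma>
  proof -
    obtain t where t: "\<And>a b. tapply M t a b = w (crs (Gi x) (Gi y)) a b" using onto by blast
    have "GG (tapply M t) a b = x a * G (Zi (Gi y)) b - y a * G (Zi (Gi x)) b" for a b
    proof -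
      have 1: "(\<lambda>d. tapply M t d e) = Zi (Gi y) e *v Gi x - Zi (Gi x) e *v Gi y" for e
        by (simp add: t w_crs smul_apply fun_eq_iff)
      have 2: "(\<lambda>e. G (\<lambda>d. tapply M t d e) a) = x a *v Zi (Gi y) - y a *v Zi (Gi x)"
        unfolding 1 linear_opD[OF G_lin] G_Gi by (simp add: smul_apply fun_eq_iff)
      show ?thesis unfolding GG_def 2 linear_opD[OF G_lin] by (simp add: smul_apply)
    qed
    then have "w (\<phi> (GG t)) a b = x a * G (Zi (Gi y)) b - y a * G (Zi (Gi x)) b" for a b
      using GG_A[of t a b] by (simp add: tapply_phi)
    then have "dot \<gamma> (\<lambda>a. dot (Zt \<gamma>) (\<lambda>b. x a * G (Zi (Gi y)) b - y a * G (Zi (Gi x)) b)) = vol (\<phi> (GG t)) \<gamma> (Zit (Zt \<gamma>))"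
      using w_pair[of \<gamma> "Zt \<gamma>" "\<phi> (GG t)"] by simp
    then have "dot \<gamma> x * dot (Zt \<gamma>) (G (Zi (Gi y))) - dot \<gamma> y * dot (Zt \<gamma>) (G (Zi (Gi x))) = 0"
      unfolding inv_t by (simp add: dot3 algebra_simps)
    then show ?thesis by (simp add: adj(1)[symmetric] H_def)
  qed
  \<comment> \<open>Otherwise some \<open>crs x z\<close> annihilates x but not H x, and
    \<open>pair\<close> fails for this covector and any y that it does not annihilate.\<close>
  have "crs x (H x) = 0" for x
  proof (rule ccontr)
    assume "crs x (H x) \<noteq> 0"
    then obtain z where z: "vol x (H x) z \<noteq> 0" using crs_neq_0D by blast
    then have "vol x z (H x) \<noteq> 0" by (simp add: vol_swap(2)[of x z "H x"])
    then have "crs x z \<noteq> 0" by (auto simp: vol_def[of x z] dot_def)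
    then obtain y where "vol x z y \<noteq> 0" using crs_neq_0D by blast
    moreover have "vol x z x * vol x z (H y) = vol x z y * vol x z (H x)"
      unfolding vol_def by (rule pair)
    ultimately show False using z by (simp add: vol_swap(2)[of x z "H x"])
  qed
  then obtain c where "\<And>x. H x = c *v x" using scalar_op[OF H] by blast
  then have "Z (G (Zi x)) = c *v G x" for x using H_def[of "G x"] by (simp add: Gi_G)
  then show ?thesis by blast
qed

end

section \<open>The normalized forms and the twist scalar\<close>

context hecke_maps
begin

text \<open>By \<open>rho_G\<close>, \<rho> is (q / \<delta>) \<zeta>^3 G^-1; this normalization
  makes \<open>T_cyc0\<close> free of coefficients.\<close>

definition \<rho> :: "('n \<Rightarrow> 'k) \<Rightarrow> 'n \<Rightarrow> 'k" where
  "\<rho> x = inverse (q * \<delta>) *v Z (m' x)"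

definition \<rho>i :: "('n \<Rightarrow> 'k) \<Rightarrow> 'n \<Rightarrow> 'k" where
  "\<rho>i x = inverse q *v Z (m (Zi (Zi (Zi x))))"

lemma rho_lin: "linear_op \<rho>"
  unfolding \<rho>_def[abs_def] by (rule linear_op_scale[OF linear_op_comp[OF lin(1) m'_lin]])

lemma rhoi_lin: "linear_op \<rho>i"
  unfolding \<rho>i_def[abs_def]
  by (rule linear_op_scale[OF linear_op_comp[OF lin(1) linear_op_comp[OF m_lin
    linear_op_comp[OF lin(2) linear_op_comp[OF lin(2) lin(2)]]]]])

lemma smul_smul: "a *v (b *v x) = (a * b) *v x" and smul_one: "1 *v x = x"
  by (simp_all add: smul_def mult.assoc)

lemma m_rhoi: "m x = q *v Zi (\<rho>i (Z (Z (Z x))))"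
  using q by (simp add: \<rho>i_def inv linear_opD[OF lin(2)] smul_smul smul_one)

lemma m'_rho: "m' x = (q * \<delta>) *v Zi (\<rho> x)"
  using q delta_neq_0
  by (simp add: \<rho>_def inv linear_opD[OF lin(2)] smul_smul smul_one del: inverse_mult_distrib)

lemma Gi_rho: "q *v Gi x = \<delta> *v Zi (Zi (Zi (\<rho> x)))"
proof -
  have "q * (inverse (q * q) * (q * \<delta>)) = \<delta>" using q by (simp add: field_simps)
  then show ?thesis by (simp only: Gi_def m'_rho linear_opD[OF lin(2)] smul_smul mult.assoc)
qed

lemma rho_G: "\<rho> (G x) = (q * inverse \<delta>) *v Z (Z (Z x))"
proof -
  have "inverse (q * \<delta>) * (q * q) = q * inverse \<delta>" using q delta_neq_0 by (simp add: field_simps)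
  then show ?thesis by (simp only: \<rho>_def m'_G linear_opD[OF lin(1)] smul_smul)
qed

lemma rhoi_G: "\<rho>i x = (inverse q * \<delta>) *v G (Zi (Zi (Zi x)))"
  using delta_neq_0 by (simp add: \<rho>i_def G_def smul_smul mult.assoc)

lemma rho_rhoi: "\<rho> (\<rho>i x) = x" "\<rho>i (\<rho> x) = x"
proof -
  show *: "\<rho> (\<rho>i x) = x" for x
    using q delta_neq_0
    by (simp add: rhoi_G linear_opD[OF rho_lin] rho_G smul_smul inv) (simp add: smul_one field_simps)
  show "\<rho>i (\<rho> x) = x" by (rule left_inverse_right_inverse[OF rhoi_lin rho_lin *])
qed

text \<open>\<open>\<rho>i\<close> is a multiple of G \<zeta>^-3, so \<open>Z_G\<close> carries
  over; \<kappa> is the inverse of the scalar found there.\<close>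

lemma ex_twist_scalar: "\<exists>\<kappa>. \<kappa> \<noteq> 0 \<and> (\<forall>x. \<rho> (Zi x) = \<kappa> *v Zi (\<rho> x)) \<and> (\<forall>x. Zi (\<rho>i x) = \<kappa> *v \<rho>i (Zi x))"
proof -
  obtain c where c: "\<And>x. Z (G (Zi x)) = c *v G x" using Z_G by blast
  have "c \<noteq> 0"
  proof
    assume "c = 0"
    then have "Gi (Zi (Z (G (Zi (idm i0))))) = Gi (Zi 0)" using c[of "idm i0"]
      by (simp add: smul_def zero_fun_def)
    then have "Z (Zi (idm i0)) = Z 0" by (simp add: inv Gi_G linear_opD[OF lin(2)] linear_opD[OF Gi_lin])
    then have "idm i0 = (0 :: 'n \<Rightarrow> 'k)" by (simp add: inv linear_opD[OF lin(1)])
    then have "idm i0 i0 = (0 :: 'k)" by simp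
    then show False by (simp add: idm_def)
  qed
  have GZ: "G (Zi x) = c *v Zi (G x)" for x
    using arg_cong[OF c, of Zi x] by (simp add: inv linear_opD[OF lin(2)])
  have 1: "\<rho>i (Zi x) = c *v Zi (\<rho>i x)" for x
    by (simp add: rhoi_G GZ linear_opD[OF lin(2)] smul_smul mult_ac)
  have 2: "Zi (\<rho> y) = c *v \<rho> (Zi y)" for y
    using arg_cong[OF 1, of \<rho> "\<rho> y"] by (simp add: rho_rhoi linear_opD[OF rho_lin])
  have "\<rho> (Zi x) = inverse c *v Zi (\<rho> x)" "Zi (\<rho>i x) = inverse c *v \<rho>i (Zi x)" for x
    unfolding 1 2 smul_smul using \<open>c \<noteq> 0\<close> by (simp_all add: smul_one)
  then show ?thesis using \<open>c \<noteq> 0\<close> by (intro exI[of _ "inverse c"]) simp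
qed

text \<open>\<open>T k\<close> is the form \<open>(x, y, z) \<mapsto> F x (Zi y) z\<close> transformed by \<open>\<zeta>\<^sup>k\<close> and normalized by
  \<open>\<delta>\<^sup>k\<close>, so that the goal \<open>R (\<zeta> \<otimes> \<zeta>) = (\<zeta> \<otimes> \<zeta>) R\<close> reads \<open>T 1 = T 0\<close>.\<close>
primrec T :: "nat \<Rightarrow> ('n \<Rightarrow> 'k) \<Rightarrow> ('n \<Rightarrow> 'k) \<Rightarrow> ('n \<Rightarrow> 'k) \<Rightarrow> 'k" where
  "T 0 x y z = F x (Zi y) z"
| "T (Suc k) x y z = \<delta> * T k (Zi x) (Zi y) (Zi z)"

lemma trilinear_T: "trilinear (T k)"
proof (induction k)
  case 0
  show ?case unfolding trilinear_def linear_fun_def by (simp add: F_simps linear_opD[OF lin(2)])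
next
  case (Suc k)
  show ?case unfolding trilinear_def linear_fun_def
    by (simp add: trilinearD[OF Suc] linear_opD[OF lin(2)] algebra_simps)
qed

lemma T_alt: "T k a b c - T k b a c = s * vol a b c"
proof (induction k arbitrary: a b c)
  case 0
  show ?case by (simp only: T.simps F_alt)
next
  case (Suc k)
  have "T (Suc k) a b c - T (Suc k) b a c = \<delta> * (s * vol (Zi a) (Zi b) (Zi c))"
    unfolding T.simps right_diff_distrib[symmetric] Suc ..
  then show ?case using delta_neq_0 by (simp add: vol_Zi)
qed

lemma T_cyc0: "T 0 a b c = T 2 c (\<rho> a) b"
proof -
  have "F (G (Gi a)) (Z (Zi (Zi b))) c = \<delta> * F (Zi (Zi c)) (q *v Gi a) (Zi (Zi b))"
    unfolding F_G F_simps by simp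
  then show ?thesis
    unfolding Gi_rho by (simp add: G_Gi inv numeral_2_eq_2 F_simps)
qed

lemma m_ZiZi:
  assumes "\<forall>x. Zi (\<rho>i x) = \<kappa> *v \<rho>i (Zi x)"
  shows "m (Zi (Zi c)) = (q * \<kappa>) *v \<rho>i c"
  using assms by (simp add: m_rhoi inv smul_smul)

lemma m'_Z:
  assumes "\<kappa> \<noteq> 0" "\<forall>x. \<rho> (Zi x) = \<kappa> *v Zi (\<rho> x)"
  shows "m' (Z c) = (q * \<delta> * inverse \<kappa>) *v \<rho> c"
proof -
  have "\<rho> c = \<kappa> *v Zi (\<rho> (Z c))" using assms(2)[rule_format, of "Z c"] by (simp add: inv)
  then have "inverse \<kappa> *v \<rho> c = Zi (\<rho> (Z c))" using assms(1) by (simp add: smul_smul smul_one)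
  then show ?thesis by (simp add: m'_rho smul_smul[symmetric])
qed

lemma T_J0:
  assumes "\<forall>x. Zi (\<rho>i x) = \<kappa> *v \<rho>i (Zi x)"
  shows "\<kappa> * T 0 a b c = T 1 b (\<rho> c) (\<rho> a)"
proof -
  have "F a (Zi b) (m (Zi (Zi (\<rho> c)))) = F (Zi b) (Zi (Zi (\<rho> c))) (m' a)" by (rule F_m)
  then have "q * (\<kappa> * F a (Zi b) c) = q * (\<delta> * F (Zi b) (Zi (Zi (\<rho> c))) (Zi (\<rho> a)))"
    unfolding m_ZiZi[OF assms] m'_rho[of a] rho_rhoi(2) F_simps(10) by (simp only: mult.assoc)
  then show ?thesis using q by simp
qed

lemma T_II0:
  assumes "\<forall>x. Zi (\<rho>i x) = \<kappa> *v \<rho>i (Zi x)"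
  shows "T 1 y v d * T 0 x e c - T 1 y v e * T 0 x d c - T 1 x v d * T 0 y e c + T 1 x v e * T 0 y d c
    = q * (vol x y c * vol d e v + \<kappa> * vol x y (\<rho>i v) * vol d e c)"
proof -
  let ?v = "Zi (Zi v)"
  have "\<delta> * (F (Zi y) ?v (Zi d) * F x (Zi e) c - F (Zi y) ?v (Zi e) * F x (Zi d) c
      - F (Zi x) ?v (Zi d) * F y (Zi e) c + F (Zi x) ?v (Zi e) * F y (Zi d) c)
    = \<delta> * (q * (vol (Zi d) (Zi e) (Z ?v) * vol x y c) + vol x y (m ?v) * vol (Zi d) (Zi e) (Zi c))"
    by (simp only: F_quadratic)
  also have "\<dots> = q * (vol x y c * vol d e v + \<kappa> * vol x y (\<rho>i v) * vol d e c)"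
    unfolding m_ZiZi[OF assms] inv vol_Zi trilinearD[OF trilinear_vol]
    using delta_neq_0 by (simp add: field_simps)
  finally show ?thesis by (simp add: algebra_simps)
qed

lemma trace_rho:
  assumes "\<kappa> \<noteq> 0" "\<forall>x. \<rho> (Zi x) = \<kappa> *v Zi (\<rho> x)" "\<forall>x. Zi (\<rho>i x) = \<kappa> *v \<rho>i (Zi x)"
  shows "q * (\<Sum>i\<in>UNIV. \<rho> (idm i) i) = \<kappa> * (1 + q + q\<^sup>2)"
    "q * \<kappa> * (\<Sum>i\<in>UNIV. \<rho>i (idm i) i) = 1 + q + q\<^sup>2"
proof -
  have "\<delta> * (q * inverse \<kappa> * (\<Sum>i\<in>UNIV. \<rho> (idm i) i)) = \<delta> * (1 + q + q\<^sup>2)"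
    using trace_m' unfolding m'_Z[OF assms(1,2)] by (simp add: smul_apply sum_distrib_left mult_ac)
  then have "q * inverse \<kappa> * (\<Sum>i\<in>UNIV. \<rho> (idm i) i) = 1 + q + q\<^sup>2" using delta_neq_0 by simp
  then show "q * (\<Sum>i\<in>UNIV. \<rho> (idm i) i) = \<kappa> * (1 + q + q\<^sup>2)"
    using assms(1) by (simp add: field_simps)
  show "q * \<kappa> * (\<Sum>i\<in>UNIV. \<rho>i (idm i) i) = 1 + q + q\<^sup>2"
    using trace_m unfolding m_ZiZi[OF assms(3)] by (simp add: smul_apply sum_distrib_left)
qed

lemma T_nonzero: "\<exists>a b c. T 0 a b c \<noteq> 0"
proof (rule ccontr)
  assume "\<not> ?thesis"
  then have "T 0 a (Z b) c = 0" for a b c by blast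
  then have "F a b c = 0" for a b c by (simp add: inv)
  then have "idm i0 = (0 :: 'n \<Rightarrow> 'k)" by (rule F_nondegenerate)
  then have "idm i0 i0 = (0 :: 'k)" by simp
  then show False by (simp add: idm_def)
qed

text \<open>\<open>I\<close> and \<open>J\<close> transport the cyclic symmetry and
  \<open>F_m\<close> to level k, where moving \<zeta>^-1 past \<rho> costs powers of \<kappa>.
  Composed in the two possible orders they give T_0 = T_3 and T_0 = \<kappa>^3 T_3, with \<rho> in
  all arguments on the right; so \<kappa>^3 = 1. Three uses of \<open>I\<close> give T_0 = T_6 and
  \<open>K\<close> three levels up gives T_3 = T_6, again with \<rho> in all arguments.\<close>

lemma T_relations:
  assumes k0: "\<kappa> \<noteq> 0" and kr: "\<forall>x. \<rho> (Zi x) = \<kappa> *v Zi (\<rho> x)" and kri: "\<forall>x. Zi (\<rho>i x) = \<kappa> *v \<rho>i (Zi x)"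
  shows "T k a b c = \<kappa> ^ k * T (Suc (Suc k)) c (\<rho> a) b" "\<kappa> ^ 3 = 1" "T (Suc (Suc (Suc k))) = T k"
    "T 0 (\<rho> a) (\<rho> b) (\<rho> c) = T 0 a b c"
proof -
  note tl = trilinearD[OF trilinear_T]
  have kr': "\<rho> (Zi x) = \<kappa> *v Zi (\<rho> x)" for x using kr by blast
  have I: "T k a b c = \<kappa> ^ k * T (Suc (Suc k)) c (\<rho> a) b" for k a b c
  proof (induction k arbitrary: a b c)
    case 0
    then show ?case using T_cyc0[of a b c] by (simp add: numeral_2_eq_2)
  next
    case (Suc k)
    have "T (Suc k) a b c = \<delta> * (\<kappa> ^ k * T (Suc (Suc k)) (Zi c) (\<rho> (Zi a)) (Zi b))"
      by (simp only: T.simps(2)[of k] Suc)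
    also have "\<dots> = \<kappa> ^ Suc k * T (Suc (Suc (Suc k))) c (\<rho> a) b"
      unfolding kr' tl T.simps(2)[of "Suc (Suc k)"] by simp
    finally show ?case .
  qed
  then show "T k a b c = \<kappa> ^ k * T (Suc (Suc k)) c (\<rho> a) b" .
  have J: "\<kappa> * T k a b c = (\<kappa> * \<kappa>) ^ k * T (Suc k) b (\<rho> c) (\<rho> a)" for k a b c
  proof (induction k arbitrary: a b c)
    case 0
    then show ?case using T_J0[OF kri, of a b c] by simp
  next
    case (Suc k)
    have "\<kappa> * T (Suc k) a b c = \<delta> * (\<kappa> * T k (Zi a) (Zi b) (Zi c))" by simp
    also have "\<dots> = \<delta> * ((\<kappa> * \<kappa>) ^ k * T (Suc k) (Zi b) (\<rho> (Zi c)) (\<rho> (Zi a)))" by (simp only: Suc)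
    also have "\<dots> = (\<kappa> * \<kappa>) ^ Suc k * T (Suc (Suc k)) b (\<rho> c) (\<rho> a)"
      unfolding kr' tl T.simps(2)[of "Suc k"] by simp
    finally show ?case .
  qed
  have K: "T 0 a b c = T (Suc (Suc (Suc 0))) (\<rho> a) (\<rho> b) (\<rho> c)" for a b c
  proof -
    have "\<kappa> * T 0 a b c = \<kappa> * T (Suc (Suc (Suc 0))) (\<rho> a) (\<rho> b) (\<rho> c)"
      using J[of 0 a b c] I[of "Suc 0" b "\<rho> c" "\<rho> a"] by (simp del: T.simps)
    then show ?thesis using k0 by simp
  qed
  have K': "T 0 a b c = \<kappa> ^ 3 * T (Suc (Suc (Suc 0))) (\<rho> a) (\<rho> b) (\<rho> c)" for a b c
  proof -
    have "\<kappa> * T 0 a b c = \<kappa> * (\<kappa> ^ 3 * T (Suc (Suc (Suc 0))) (\<rho> a) (\<rho> b) (\<rho> c))"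
      using J[of "Suc (Suc 0)" c "\<rho> a" b] I[of 0 a b c]
      by (simp add: power3_eq_cube mult.assoc del: T.simps)
    then show ?thesis using k0 by simp
  qed
  obtain a0 b0 c0 where nz: "T 0 a0 b0 c0 \<noteq> 0" using T_nonzero by blast
  have "(\<kappa> ^ 3 - 1) * T 0 a0 b0 c0 = 0" using K[of a0 b0 c0] K'[of a0 b0 c0] by (simp add: algebra_simps)
  then show k3: "\<kappa> ^ 3 = 1" using nz by simp
  have k6: "\<kappa> * (\<kappa> * (\<kappa> * x)) = x" for x using k3 by (simp add: power3_eq_cube mult.assoc[symmetric])
  have P: "T (Suc (Suc (Suc 0))) a b c = T 0 a b c" for a b c
  proof -
    have "T 0 a b c = T (Suc (Suc (Suc (Suc (Suc (Suc 0)))))) (\<rho> a) (\<rho> b) (\<rho> c)"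
      using I[of 0 a b c] I[of "Suc (Suc 0)" c "\<rho> a" b] I[of "Suc (Suc (Suc (Suc 0)))" b "\<rho> c" "\<rho> a"]
      by (simp add: k6 mult.assoc del: T.simps)
    moreover have "T (Suc (Suc (Suc 0))) a b c = T (Suc (Suc (Suc (Suc (Suc (Suc 0)))))) (\<rho> a) (\<rho> b) (\<rho> c)"
    proof -
      have "T (Suc (Suc (Suc 0))) a b c
        = \<delta> * (\<delta> * (\<delta> * T (Suc (Suc (Suc 0))) (\<rho> (Zi (Zi (Zi a)))) (\<rho> (Zi (Zi (Zi b)))) (\<rho> (Zi (Zi (Zi c))))))"
        unfolding K[symmetric] by (simp only: T.simps(2))
      also have "\<dots> = T (Suc (Suc (Suc (Suc (Suc (Suc 0)))))) (\<rho> a) (\<rho> b) (\<rho> c)"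
        unfolding kr' linear_opD[OF lin(2)] smul_smul tl
        unfolding T.simps(2)[of "Suc (Suc (Suc (Suc (Suc 0))))"] T.simps(2)[of "Suc (Suc (Suc (Suc 0)))"]
          T.simps(2)[of "Suc (Suc (Suc 0))"]
        by (simp add: mult.assoc mult.left_commute[of \<delta> \<kappa>] k6 del: T.simps)
      finally show ?thesis .
    qed
    ultimately show ?thesis by simp
  qed
  have "T (Suc (Suc (Suc k))) a b c = T k a b c" for k a b c
  proof (induction k arbitrary: a b c)
    case 0
    then show ?case by (rule P)
  next
    case (Suc k)
    then show ?case by (simp only: T.simps(2)[of k] T.simps(2)[of "Suc (Suc (Suc k))"])
  qed
  then show "T (Suc (Suc (Suc k))) = T k" by (simp add: fun_eq_iff del: T.simps)
  show "T 0 (\<rho> a) (\<rho> b) (\<rho> c) = T 0 a b c" using K[of a b c] by (simp only: P)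
qed

text \<open>Conjugation by \<zeta> multiplies \<rho> by a scalar but keeps its trace, so \<kappa>
  \<noteq> 1 makes the trace 0 and 1 + q + q^2 = 0. Then \<rho> fixes some \<open>e\<close>, and
  \<zeta>^-1 e, \<zeta>^-2 e are eigenvectors for \<kappa>, \<kappa>^2, which
  \<open>twist_scalar_contradiction\<close> excludes.\<close>

lemma twist_scalar_eq_1:
  assumes k0: "\<kappa> \<noteq> 0" and kr: "\<forall>x. \<rho> (Zi x) = \<kappa> *v Zi (\<rho> x)" and kri: "\<forall>x. Zi (\<rho>i x) = \<kappa> *v \<rho>i (Zi x)"
  shows "\<kappa> = 1"
proof (rule ccontr)
  assume k1: "\<kappa> \<noteq> 1"
  note rel = T_relations[OF k0 kr kri]
  let ?t = "\<Sum>i\<in>UNIV. \<rho> (idm i) i"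
  have "inverse \<delta> * ?t = \<kappa> * (inverse \<delta> * ?t)"
    using trace_vol[OF rho_lin, of "Zi (idm i0)" "Zi (idm i1)" "Zi (idm i2)"]
      trace_vol[OF rho_lin, of "idm i0" "idm i1" "idm i2"]
    unfolding kr[rule_format] trilinearD[OF trilinear_vol] vol_Zi vol_basis by algebra
  then have "(\<kappa> - 1) * ?t = 0" using delta_neq_0 by (simp add: field_simps)
  then have t: "?t = 0" using k1 by simp
  then have q3: "1 + q + q\<^sup>2 = 0" using trace_rho(1)[OF k0 kr kri] k0 by simp
  then have ti: "(\<Sum>i\<in>UNIV. \<rho>i (idm i) i) = 0" using trace_rho(2)[OF k0 kr kri] k0 q by simp
  have s0: "s \<noteq> 0"
  proof
    assume "s = 0"
    then have "1 + q = 0" by (simp only: neg_equal_0_iff_equal)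
    then show False using q3 q by simp
  qed
  have det_rho: "vol (\<rho> a) (\<rho> b) (\<rho> c) = vol a b c" for a b c
  proof -
    have "s * vol (\<rho> a) (\<rho> b) (\<rho> c) = s * vol a b c"
      unfolding T_alt[of 0, symmetric] rel(4) ..
    then show ?thesis using s0 by (simp only: mult_cancel_left) simp
  qed
  obtain e where e: "e \<noteq> 0" "\<rho> e = e"
  proof (rule ex_fixed_vector[OF rho_lin rhoi_lin rho_rhoi, of 0])
    show "vol (\<rho> x) y z + vol x (\<rho> y) z + vol x y (\<rho> z) = 0 * vol x y z" for x y z
      using trace_vol[OF rho_lin, of x y z] t by simp
    show "vol (\<rho>i x) y z + vol x (\<rho>i y) z + vol x y (\<rho>i z) = 0 * vol x y z" for x y z
      using trace_vol[OF rhoi_lin, of x y z] ti by simp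
  qed (use det_rho that in auto)
  have Zi0: "Zi x \<noteq> 0" if "x \<noteq> 0" for x
    using that inv(1)[of x] linear_opD(4)[OF lin(1)] by auto
  show False
  proof (rule twist_scalar_contradiction[of \<kappa> q "T 0" "T 1" "T 2" \<rho> \<rho>i e "Zi e" "Zi (Zi e)"])
    show "T 0 a b c - T 0 b a c = s * vol a b c" "T 1 a b c - T 1 b a c = s * vol a b c"
      "T 2 a b c - T 2 b a c = s * vol a b c" for a b c by (rule T_alt)+
    show "T 0 a b c = T 2 c (\<rho> a) b" for a b c by (rule T_cyc0)
    show "T 1 a b c = \<kappa> * T 0 c (\<rho> a) b" for a b c
      using rel(1)[of "Suc 0" a b c] rel(3)[of 0] by (simp del: T.simps)
    show "T 2 a b c = \<kappa>\<^sup>2 * T 1 c (\<rho> a) b" for a b c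
      using rel(1)[of "Suc (Suc 0)" a b c] rel(3)[of "Suc 0"] by (simp add: numeral_2_eq_2 del: T.simps)
    show "\<rho> (Zi e) = \<kappa> *v Zi e" "\<rho> (Zi (Zi e)) = \<kappa>\<^sup>2 *v Zi (Zi e)"
      using kr e(2) by (simp_all add: linear_opD[OF lin(2)] smul_smul power2_eq_square)
  qed (use k1 q3 rel(2) trilinear_T T_II0[OF kri] rho_lin rho_rhoi e Zi0 in \<open>simp_all del: T.simps\<close>)
qed

lemma F_invariant:
  assumes two: "(2::'k) \<noteq> 0"
  shows "F (Z x) (Z y) (Z z) = \<delta> * F x y z"
proof -
  obtain \<kappa> where k: "\<kappa> \<noteq> 0" "\<forall>x. \<rho> (Zi x) = \<kappa> *v Zi (\<rho> x)" "\<forall>x. Zi (\<rho>i x) = \<kappa> *v \<rho>i (Zi x)"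
    using ex_twist_scalar by blast
  have k1: "\<kappa> = 1" by (rule twist_scalar_eq_1[OF k])
  note rel = T_relations[OF k, unfolded k1]
  have ri: "\<rho>i (Zi x) = Zi (\<rho>i x)" for x using k(3) by (simp add: k1 smul_one)
  define t where "t = (1 + q + q\<^sup>2) / q"
  have tr: "(\<Sum>i\<in>UNIV. \<rho> (idm i) i) = t" "(\<Sum>i\<in>UNIV. \<rho>i (idm i) i) = t"
    using trace_rho[OF k] q by (simp_all add: k1 t_def field_simps)
  \<comment> \<open>Transforming all vectors by \<zeta>^-1 brings \<delta>^2 from the two forms
    against \<delta>^-2 from the two volumes. As \<kappa> = 1, \<open>\<rho>i\<close> commutes with
    \<zeta>^-1.\<close>
  have II: "T (Suc k) y v d * T k x e c - T (Suc k) y v e * T k x d c - T (Suc k) x v d * T k y e c + T (Suc k) x v e * T k y d c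
    = q * (vol x y c * vol d e v + vol x y (\<rho>i v) * vol d e c)" for k x y v c d e
  proof (induction k arbitrary: x y v c d e)
    case 0
    then show ?case using T_II0[OF k(3), of y v d x e c] by (simp add: k1)
  next
    case (Suc k)
    have "T (Suc (Suc k)) y v d * T (Suc k) x e c - T (Suc (Suc k)) y v e * T (Suc k) x d c
        - T (Suc (Suc k)) x v d * T (Suc k) y e c + T (Suc (Suc k)) x v e * T (Suc k) y d c
      = \<delta> * \<delta> * (q * (vol (Zi x) (Zi y) (Zi c) * vol (Zi d) (Zi e) (Zi v) + vol (Zi x) (Zi y) (\<rho>i (Zi v)) * vol (Zi d) (Zi e) (Zi c)))"
      unfolding Suc[symmetric] T.simps(2)[of "Suc k"] T.simps(2)[of k, of x] T.simps(2)[of k, of y]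
      by (simp only: algebra_simps)
    also have "\<dots> = q * (vol x y c * vol d e v + vol x y (\<rho>i v) * vol d e c)"
      unfolding ri vol_Zi using delta_neq_0 by (simp add: field_simps)
    finally show ?case .
  qed
  interpret forms: cyclic_forms i0 i1 i2 T \<rho> \<rho>i q t
  proof
    show "q * t = 1 + q + q\<^sup>2" using q by (simp add: t_def)
    show "vol (\<rho> x) y z + vol x (\<rho> y) z + vol x y (\<rho> z) = t * vol x y z" for x y z
      using trace_vol[OF rho_lin, of x y z] tr by simp
    show "vol (\<rho>i x) y z + vol x (\<rho>i y) z + vol x y (\<rho>i z) = t * vol x y z" for x y z
      using trace_vol[OF rhoi_lin, of x y z] tr by simp
    show "T k a b c = T (Suc (Suc k)) c (\<rho> a) b" for k a b c
      using rel(1)[of k a b c] by (simp del: T.simps)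
  qed (use two q trilinear_T T_nonzero rho_lin rhoi_lin rho_rhoi rel(3) T_alt II in \<open>simp_all del: T.simps\<close>)
  have "T 1 (Z x) (Z (Z y)) (Z z) = T 0 (Z x) (Z (Z y)) (Z z)" by (simp only: forms.forms_equal)
  then show ?thesis by (simp add: inv)
qed

text \<open>By \<open>F_invariant\<close>, \<phi> carries \<zeta> \<otimes> \<zeta> to \<delta>
  times the inverse transpose, and in \<open>w\<close> the volume form absorbs \<delta>. The nested
  \<open>dot\<close> is an entry of (\<zeta> \<otimes> \<zeta>) M (x \<otimes> y).\<close>

lemma tapply_Z_Z:
  assumes two: "(2::'k) \<noteq> 0"
  shows "tapply M (\<lambda>a b. Z x a * Z y b) a b
    = dot (Zt (idm a)) (\<lambda>a'. dot (Zt (idm b)) (\<lambda>b'. tapply M (\<lambda>a b. x a * y b) a' b'))"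
proof -
  let ?\<xi> = "\<phi> (\<lambda>a b. x a * y b)"
  have "\<phi> (\<lambda>a b. Z x a * Z y b) = \<delta> *v Zit ?\<xi>"
  proof (rule dot_eqI)
    fix c
    have "dot (\<phi> (\<lambda>a b. Z x a * Z y b)) c = F (Z x) (Z y) (Z (Zi c))" by (simp add: F_def inv)
    also have "\<dots> = \<delta> * F x y (Zi c)" by (rule F_invariant[OF two])
    also have "\<dots> = dot (\<delta> *v Zit ?\<xi>) c"
      unfolding linear_funD[OF linear_fun_dot(2)] adj(2)[symmetric] F_def ..
    finally show "dot (\<phi> (\<lambda>a b. Z x a * Z y b)) c = dot (\<delta> *v Zit ?\<xi>) c" .
  qed
  then have "tapply M (\<lambda>a b. Z x a * Z y b) a b = \<delta> * vol (Zit ?\<xi>) (Zit (Zt (idm a))) (Zit (idm b))"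
    by (simp add: tapply_phi w_def inv_t trilinearD[OF trilinear_vol])
  also have "\<dots> = vol ?\<xi> (Zt (idm a)) (Zit (Zt (idm b)))"
    unfolding vol_Zit using delta_neq_0 by (simp add: inv_t)
  also have "\<dots> = dot (Zt (idm a)) (\<lambda>a'. dot (Zt (idm b)) (\<lambda>b'. w ?\<xi> a' b'))"
    by (rule w_pair[symmetric])
  finally show ?thesis by (simp only: tapply_phi)
qed

end

section \<open>Matrices, ideals and the main theorem\<close>

lemma sum_pair: "(\<Sum>p\<in>UNIV. f p) = (\<Sum>a\<in>UNIV. \<Sum>b\<in>UNIV. f (a :: 'a::finite, b :: 'b::finite))"
  by (simp add: sum.cartesian_product)

lemma sum_mult_sum2:
  "(\<Sum>i\<in>A. \<Sum>j\<in>B. \<Sum>l\<in>C. f i * g j l) = (\<Sum>i\<in>A. f i) * (\<Sum>j\<in>B. \<Sum>l\<in>C. (g j l :: 'a::semiring_0))"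
  by (simp only: sum_distrib_right) (simp only: sum_distrib_left)

lemma mapply_mmul: "mapply (mmul A B) t = mapply A (mapply B t)"
proof
  fix i
  have "mapply (mmul A B) t i = (\<Sum>j\<in>UNIV. \<Sum>l\<in>UNIV. A i l * B l j * t j)"
    by (simp add: mapply_def mmul_def sum_distrib_right)
  also have "\<dots> = (\<Sum>l\<in>UNIV. \<Sum>j\<in>UNIV. A i l * B l j * t j)" by (rule sum.swap)
  finally show "mapply (mmul A B) t i = mapply A (mapply B t) i"
    by (simp add: mapply_def sum_distrib_left mult.assoc)
qed

lemma mapply_idm: "mapply idm t = t" "mapply A (idm j) i = A i j"
  by (simp_all add: mapply_def sum_idm fun_eq_iff)

lemma mapply_eqI:
  assumes "\<And>t. mapply A t = mapply B t"
  shows "A = B"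
proof (intro ext)
  fix i j
  show "A i j = B i j" using fun_cong[OF assms[of "idm j"], of i] by (simp add: mapply_idm)
qed

lemma mmul_assoc:
  fixes A B C :: "'i::finite \<Rightarrow> 'i \<Rightarrow> 'k::field"
  shows "mmul (mmul A B) C = mmul A (mmul B C)"
  by (rule mapply_eqI) (simp only: mapply_mmul)

lemma mmul_idm:
  fixes A :: "'i::finite \<Rightarrow> 'i \<Rightarrow> 'k::field"
  shows "mmul idm A = A" "mmul A idm = A"
  by (rule mapply_eqI, simp only: mapply_mmul mapply_idm)+

lemma mapply_linear: "linear_op (mapply A)"
  unfolding linear_op_def
  by (simp add: mapply_def smul_def fun_eq_iff distrib_left sum.distrib sum_distrib_left mult_ac)

lemma mapply_shift: "mapply (\<lambda>i j. A i j + k * idm i j) t = mapply A t + k *v t"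
  "mapply (\<lambda>i j. A i j - k * idm i j) t = mapply A t - k *v t"
proof -
  have "(\<Sum>j\<in>UNIV. k * idm i j * t j) = k * t i" for i
    by (simp add: sum_distrib_left[symmetric] mult.assoc sum_idm)
  then show "mapply (\<lambda>i j. A i j + k * idm i j) t = mapply A t + k *v t"
    "mapply (\<lambda>i j. A i j - k * idm i j) t = mapply A t - k *v t"
    by (simp_all add: mapply_def smul_apply fun_eq_iff distrib_right left_diff_distrib sum.distrib sum_subtractf)
qed

lemma mapply_pair: "mapply M t (a, b) = tapply M (\<lambda>a b. t (a, b)) a b"
  by (simp add: mapply_def tapply_def sum_pair)

lemma tensor_op_mmul: "mmul (tensor_op A B) (tensor_op C D) = tensor_op (mmul A C) (mmul B D)"
  by (simp add: fun_eq_iff mmul_def tensor_op_def sum_pair sum_product mult_ac)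

lemma tensor_op_idm: "tensor_op idm idm = idm"
  by (auto simp: fun_eq_iff tensor_op_def idm_def)

definition tensor_op3 :: "('n \<Rightarrow> 'n \<Rightarrow> 'k::field) \<Rightarrow> ('n \<Rightarrow> 'n \<Rightarrow> 'k) \<Rightarrow> ('n \<Rightarrow> 'n \<Rightarrow> 'k) \<Rightarrow> 'n \<times> 'n \<times> 'n \<Rightarrow> 'n \<times> 'n \<times> 'n \<Rightarrow> 'k" where
  "tensor_op3 A B C = (\<lambda>(a, b, c) (a', b', c'). A a a' * B b b' * C c c')"

lemma tensor_op3_mmul:
  fixes A :: "'n::finite \<Rightarrow> 'n \<Rightarrow> 'k::field"
  shows "mmul (tensor_op3 A B C) (tensor_op3 A' B' C') = tensor_op3 (mmul A A') (mmul B B') (mmul C C')"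
proof -
  have "(\<Sum>i\<in>UNIV. \<Sum>j\<in>UNIV. \<Sum>l\<in>UNIV. (f i * g j * h l) * (f' i * g' j * h' l))
    = (\<Sum>i\<in>UNIV. f i * f' i) * (\<Sum>j\<in>UNIV. g j * g' j) * (\<Sum>l\<in>UNIV. h l * (h' l :: 'k))"
    for f f' g g' h h' :: "'n \<Rightarrow> 'k"
  proof -
    have eq: "(f i * g j * h l) * (f' i * g' j * h' l) = (f i * f' i) * ((g j * g' j) * (h l * h' l))" for i j l
      by (simp only: mult_ac)
    show ?thesis
      by (simp only: eq sum_mult_sum2 sum_product[symmetric]) (simp only: mult.assoc)
  qed
  then show ?thesis by (simp add: fun_eq_iff mmul_def tensor_op3_def sum_pair)
qed

lemma
  fixes A B :: "'n::finite \<times> 'n \<Rightarrow> 'n \<times> 'n \<Rightarrow> 'k::field"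
  shows R_12_mmul: "mmul (R_12 A) (R_12 B) = R_12 (mmul A B)"
    and R_23_mmul: "mmul (R_23 A) (R_23 B) = R_23 (mmul A B)"
proof -
  have "(\<Sum>i\<in>UNIV. \<Sum>j\<in>UNIV. \<Sum>l\<in>UNIV. (f i j * idm c l) * (g i j * idm l e))
    = (\<Sum>i\<in>UNIV. \<Sum>j\<in>UNIV. f i j * g i j) * (idm c e :: 'k)"
    for f g :: "'n \<Rightarrow> 'n \<Rightarrow> 'k" and c e :: 'n
  proof -
    have "(\<Sum>l\<in>UNIV. (f i j * idm c l) * (g i j * idm l e)) = f i j * g i j * idm c e" for i j
    proof -
      have "(\<Sum>l\<in>UNIV. (f i j * idm c l) * (g i j * idm l e)) = f i j * g i j * (\<Sum>l\<in>UNIV. idm c l * idm l e)"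
        by (simp add: sum_distrib_left mult_ac)
      then show ?thesis by (simp add: sum_idm)
    qed
    then show ?thesis by (simp add: sum_distrib_right)
  qed
  then show "mmul (R_12 A) (R_12 B) = R_12 (mmul A B)"
    by (simp add: fun_eq_iff mmul_def R_12_def sum_pair)
  have "(\<Sum>l\<in>UNIV. \<Sum>i\<in>UNIV. \<Sum>j\<in>UNIV. (idm c l * f i j) * (idm l e * g i j))
    = (idm c e :: 'k) * (\<Sum>i\<in>UNIV. \<Sum>j\<in>UNIV. f i j * g i j)"
    for f g :: "'n \<Rightarrow> 'n \<Rightarrow> 'k" and c e :: 'n
  proof -
    have "(\<Sum>l\<in>UNIV. \<Sum>i\<in>UNIV. \<Sum>j\<in>UNIV. (idm c l * f i j) * (idm l e * g i j))
      = (\<Sum>l\<in>UNIV. \<Sum>i\<in>UNIV. \<Sum>j\<in>UNIV. (idm c l * idm l e) * (f i j * g i j))"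
      by (simp only: mult_ac)
    also have "\<dots> = (\<Sum>l\<in>UNIV. idm c l * idm l e) * (\<Sum>i\<in>UNIV. \<Sum>j\<in>UNIV. f i j * g i j)"
      by (rule sum_mult_sum2)
    finally have "(\<Sum>l\<in>UNIV. \<Sum>i\<in>UNIV. \<Sum>j\<in>UNIV. (idm c l * f i j) * (idm l e * g i j))
      = (\<Sum>l\<in>UNIV. idm c l * idm l e) * (\<Sum>i\<in>UNIV. \<Sum>j\<in>UNIV. f i j * g i j)" .
    then show ?thesis by (simp add: sum_idm)
  qed
  then show "mmul (R_23 A) (R_23 B) = R_23 (mmul A B)"
    by (simp add: fun_eq_iff mmul_def R_23_def sum_pair)
qed

lemma R_12_tensor_op: "R_12 (tensor_op A B) = tensor_op3 A B idm"
  and R_23_tensor_op: "R_23 (tensor_op A B) = tensor_op3 idm A B"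
  by (simp_all add: fun_eq_iff R_12_def R_23_def tensor_op_def tensor_op3_def mult.assoc)

lemma R_23_first:
  fixes A :: "'n::finite \<Rightarrow> 'n \<Rightarrow> 'k::field"
  shows "mmul (R_23 X) (tensor_op3 A idm idm) = mmul (tensor_op3 A idm idm) (R_23 X)"
proof -
  have "(\<Sum>i\<in>UNIV. \<Sum>j\<in>UNIV. \<Sum>l\<in>UNIV. (idm a i * f j l) * (g i * idm j b * idm l c)) = (g a * f b c :: 'k)"
    and "(\<Sum>i\<in>UNIV. \<Sum>j\<in>UNIV. \<Sum>l\<in>UNIV. (g i * idm b j * idm c l) * (idm i a * f j l)) = (g a * f b c :: 'k)"
    for f :: "'n \<Rightarrow> 'n \<Rightarrow> 'k" and g and a b c :: 'n
  proof -
    have "(\<Sum>i\<in>UNIV. \<Sum>j\<in>UNIV. \<Sum>l\<in>UNIV. (idm a i * f j l) * (g i * idm j b * idm l c))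
      = (\<Sum>i\<in>UNIV. \<Sum>j\<in>UNIV. \<Sum>l\<in>UNIV. (idm a i * g i) * (f j l * idm l c * idm j b))"
      by (simp only: mult_ac)
    also have "\<dots> = (\<Sum>i\<in>UNIV. idm a i * g i) * (\<Sum>j\<in>UNIV. (\<Sum>l\<in>UNIV. f j l * idm l c) * idm j b)"
      by (simp only: sum_mult_sum2 sum_distrib_right[of _ _ "idm _ b"])
    finally show "(\<Sum>i\<in>UNIV. \<Sum>j\<in>UNIV. \<Sum>l\<in>UNIV. (idm a i * f j l) * (g i * idm j b * idm l c)) = g a * f b c"
      by (simp only: sum_idm)
    have "(\<Sum>i\<in>UNIV. \<Sum>j\<in>UNIV. \<Sum>l\<in>UNIV. (g i * idm b j * idm c l) * (idm i a * f j l))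
      = (\<Sum>i\<in>UNIV. \<Sum>j\<in>UNIV. \<Sum>l\<in>UNIV. (g i * idm i a) * (idm b j * (idm c l * f j l)))"
      by (simp only: mult_ac)
    also have "\<dots> = (\<Sum>i\<in>UNIV. g i * idm i a) * (\<Sum>j\<in>UNIV. idm b j * (\<Sum>l\<in>UNIV. idm c l * f j l))"
      by (simp only: sum_mult_sum2 sum_distrib_left[of "idm b _"])
    finally show "(\<Sum>i\<in>UNIV. \<Sum>j\<in>UNIV. \<Sum>l\<in>UNIV. (g i * idm b j * idm c l) * (idm i a * f j l)) = g a * f b c"
      by (simp add: sum_idm)
  qed
  then show ?thesis by (simp add: fun_eq_iff mmul_def R_23_def tensor_op3_def sum_pair)
qed

lemma
  fixes R :: "'n::finite \<times> 'n \<Rightarrow> 'n \<times> 'n \<Rightarrow> 'k::field"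
  shows mapply_R_12: "mapply (R_12 R) u (a, b, c) = A12 R (\<lambda>a b c. u (a, b, c)) a b c"
    and mapply_R_23: "mapply (R_23 R) u (a, b, c) = A23 R (\<lambda>a b c. u (a, b, c)) a b c"
proof -
  have 1: "(\<Sum>l\<in>UNIV. f * idm c l * v l) = f * v c" for f and v :: "'n \<Rightarrow> 'k"
    by (simp add: sum_distrib_left[symmetric] mult.assoc sum_idm)
  show "mapply (R_12 R) u (a, b, c) = A12 R (\<lambda>a b c. u (a, b, c)) a b c"
    by (simp add: mapply_def R_12_def A12_def tapply_def sum_pair 1)
  have "mapply (R_23 R) u (a, b, c) = (\<Sum>l\<in>UNIV. idm a l * (\<Sum>i\<in>UNIV. \<Sum>j\<in>UNIV. R (b, c) (i, j) * u (l, i, j)))"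
    by (simp add: mapply_def R_23_def sum_pair sum_distrib_left mult.assoc)
  then show "mapply (R_23 R) u (a, b, c) = A23 R (\<lambda>a b c. u (a, b, c)) a b c"
    by (simp add: sum_idm A23_def tapply_def)
qed

text \<open>The generators have degree 2, so up to this degree a product a x b involves only the
  constant terms of a and b. The degree 2 part thus stays in any subspace containing the
  generators.\<close>

lemma gen_ideal_degree_le_2:
  assumes zero: "(\<lambda>p. 0) \<in> U" and add: "\<And>t u. t \<in> U \<Longrightarrow> u \<in> U \<Longrightarrow> (\<lambda>p. t p + u p) \<in> U"
    and scale: "\<And>c t. t \<in> U \<Longrightarrow> (\<lambda>p. c * t p) \<in> U" and S: "S \<subseteq> U"
    and x: "x \<in> gen_ideal (emb2 ` S)"
  shows "x [] = 0 \<and> (\<forall>a. x [a] = 0) \<and> (\<lambda>(a, b). x [a, b]) \<in> U"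
  using x
proof induction
  case (gen g)
  then obtain t where "g = emb2 t" "t \<in> S" by blast
  then show ?case using S by (auto simp: emb2_def)
next
  case zero
  then show ?case using assms(1) by (simp add: case_prod_unfold)
next
  case (add x y)
  then show ?case using assms(2)[of "\<lambda>(a, b). x [a, b]" "\<lambda>(a, b). y [a, b]"] by (simp add: case_prod_unfold)
next
  case (mult x a b)
  have "tmul x b [c, d] = x [c, d] * b []" "tmul x b [c] = 0" "tmul x b [] = 0" for c d
    using mult.IH by (simp_all add: tmul_def numeral_2_eq_2)
  then have "tmul a (tmul x b) [c, d] = (a [] * b []) * x [c, d]" "tmul a (tmul x b) [c] = 0"
    "tmul a (tmul x b) [] = 0" for c d
    by (simp_all add: tmul_def[of a] mult_ac)
  then show ?case using mult.IH scale[of "\<lambda>(a, b). x [a, b]" "a [] * b []"] by (simp add: case_prod_unfold)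
qed

lemma R_relations_subspace:
  "(\<lambda>p. 0) \<in> R_relations q R"
  "t \<in> R_relations q R \<Longrightarrow> u \<in> R_relations q R \<Longrightarrow> (\<lambda>p. t p + u p) \<in> R_relations q R"
  "t \<in> R_relations q R \<Longrightarrow> (\<lambda>p. c * t p) \<in> R_relations q R"
proof -
  let ?f = "mapply (\<lambda>i j. R i j - q * idm i j)"
  note lin = linear_opD[OF mapply_linear[of "\<lambda>i j. R i j - q * idm i j"]]
  have "(\<lambda>p. 0) = ?f 0" unfolding lin(4) by (simp add: zero_fun_def)
  then show "(\<lambda>p. 0) \<in> R_relations q R" unfolding R_relations_def mimage_def by blast
  show "(\<lambda>p. t p + u p) \<in> R_relations q R" if tu: "t \<in> R_relations q R" "u \<in> R_relations q R"
  proof -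
    obtain t' u' where t: "t = ?f t'" "u = ?f u'" using tu unfolding R_relations_def mimage_def by blast
    then have "(\<lambda>p. t p + u p) = ?f (t' + u')" unfolding t lin(1) by (simp only: plus_fun_def)
    then show ?thesis unfolding R_relations_def mimage_def by (simp only: rangeI)
  qed
  show "(\<lambda>p. c * t p) \<in> R_relations q R" if tu: "t \<in> R_relations q R"
  proof -
    obtain t' where t: "t = ?f t'" using tu unfolding R_relations_def mimage_def by blast
    then have "(\<lambda>p. c * t p) = ?f (c *v t')" unfolding t lin(2) by (simp only: smul_def)
    then show ?thesis unfolding R_relations_def mimage_def by (simp only: rangeI)
  qed
qed

lemma emb2_pair: "(\<lambda>(a, b). emb2 t [a, b]) = t"
  by (simp add: emb2_def)

lemma emb2_in_kernel_SR: "emb2 t \<in> kernel_SR q R \<longleftrightarrow> t \<in> R_relations q R"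
proof
  assume "emb2 t \<in> kernel_SR q R"
  then have "(\<lambda>(a, b). emb2 t [a, b]) \<in> R_relations q R"
    unfolding kernel_SR_def
    using gen_ideal_degree_le_2[of "R_relations q R" "R_relations q R"] R_relations_subspace by blast
  then show "t \<in> R_relations q R" by (simp only: emb2_pair)
next
  assume "t \<in> R_relations q R"
  then show "emb2 t \<in> kernel_SR q R" unfolding kernel_SR_def by (intro gen_ideal.gen imageI)
qed

text \<open>In characteristic \<open>\<noteq> 2\<close> the diagonal entries of such a tensor vanish.\<close>
definition skew :: "('n \<times> 'n \<Rightarrow> 'k::field) set" where
  "skew = {t. \<forall>a b. t (a, b) = - t (b, a)}"

lemma skew_subspace: "(\<lambda>p. 0) \<in> skew" "t \<in> skew \<Longrightarrow> u \<in> skew \<Longrightarrow> (\<lambda>p. t p + u p) \<in> skew"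
  "t \<in> skew \<Longrightarrow> (\<lambda>p. c * t p) \<in> skew"
proof -
  show "(\<lambda>p. 0) \<in> skew" by (simp add: skew_def)
  show "(\<lambda>p. t p + u p) \<in> skew" if "t \<in> skew" "u \<in> skew"
    unfolding skew_def
  proof (intro CollectI allI)
    fix a b
    have "t (a, b) = - t (b, a)" "u (a, b) = - u (b, a)" using that unfolding skew_def by blast+
    then show "t (a, b) + u (a, b) = - (t (b, a) + u (b, a))" by simp
  qed
  show "(\<lambda>p. c * t p) \<in> skew" if "t \<in> skew"
    unfolding skew_def
  proof (intro CollectI allI)
    fix a b
    have "t (a, b) = - t (b, a)" using that unfolding skew_def by blast
    then show "c * t (a, b) = - (c * t (b, a))" by simp
  qed
qed

lemma alt_tensors_skew: "alt_tensors \<subseteq> skew"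
  by (auto simp: alt_tensors_def skew_def)

lemma mapply_tensor_op_skew:
  assumes "t \<in> skew"
  shows "mapply (tensor_op A A) t \<in> skew"
  unfolding skew_def
proof (intro CollectI allI)
  fix a b
  have t: "t (c, d) = - t (d, c)" for c d using assms unfolding skew_def by blast
  have "mapply (tensor_op A A) t (a, b) = (\<Sum>c\<in>UNIV. \<Sum>d\<in>UNIV. A a c * A b d * t (c, d))"
    by (simp add: mapply_def tensor_op_def sum_pair)
  also have "\<dots> = (\<Sum>d\<in>UNIV. \<Sum>c\<in>UNIV. A a c * A b d * t (c, d))" by (rule sum.swap)
  also have "\<dots> = (\<Sum>d\<in>UNIV. \<Sum>c\<in>UNIV. - (A b d * A a c * t (d, c)))"
    by (intro sum.cong refl) (subst t, simp)
  also have "\<dots> = - mapply (tensor_op A A) t (b, a)"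
    by (simp add: mapply_def tensor_op_def sum_pair sum_negf)
  finally show "mapply (tensor_op A A) t (a, b) = - mapply (tensor_op A A) t (b, a)" .
qed

lemma lists_length_2: "{u :: 'n list. length u = 2} = (\<lambda>(c, d). [c, d]) ` UNIV"
proof
  show "{u :: 'n list. length u = 2} \<subseteq> (\<lambda>(c, d). [c, d]) ` UNIV"
  proof
    fix u :: "'n list"
    assume "u \<in> {u. length u = 2}"
    then obtain c d where "u = [c, d]" by (auto simp: numeral_2_eq_2 length_Suc_conv)
    then have "u = (\<lambda>(c, d). [c, d]) (c, d)" by simp
    then show "u \<in> (\<lambda>(c, d). [c, d]) ` UNIV" by blast
  qed
qed auto

lemma emb2_eq_0: "length u \<noteq> 2 \<Longrightarrow> emb2 t u = 0"
  by (auto simp: emb2_def split: list.split)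

lemma fin_supp_emb2: "fin_supp (emb2 (t :: 'n::finite \<times> 'n \<Rightarrow> 'k::zero))"
proof -
  have "{w. emb2 t w \<noteq> 0} \<subseteq> {w. length w = 2}" using emb2_eq_0[of _ t] by blast
  moreover have "finite {w :: 'n list. length w = 2}" unfolding lists_length_2 by simp
  ultimately show ?thesis unfolding fin_supp_def by (rule finite_subset)
qed

text \<open>Through this degree 2 computation the isomorphism of algebras becomes W = (1 \<otimes>
  \<zeta>^-1) \<Lambda>^2 V.\<close>

lemma twist_tensor_emb2: "twist_tensor \<zeta> (emb2 t) = emb2 (mapply (tensor_op idm \<zeta>) t)"
proof
  fix w :: "'a list"
  show "twist_tensor \<zeta> (emb2 t) w = emb2 (mapply (tensor_op idm \<zeta>) t) w"
  proof (cases "length w = 2")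
    case False
    then have "twist_tensor \<zeta> (emb2 t) w = 0"
      unfolding twist_tensor_def by (intro sum.neutral) (simp add: emb2_eq_0)
    then show ?thesis using False by (simp add: emb2_eq_0)
  next
    case True
    then obtain a b where w: "w = [a, b]" by (auto simp: numeral_2_eq_2 length_Suc_conv)
    have "inj (\<lambda>(c, d). [c, d :: 'a])" by (auto simp: inj_def)
    then have "twist_tensor \<zeta> (emb2 t) w = (\<Sum>p\<in>UNIV. idm a (fst p) * \<zeta> b (snd p) * t p)"
      unfolding twist_tensor_def True lists_length_2
      by (simp add: sum.reindex w numeral_2_eq_2 mmul_idm emb2_def case_prod_unfold lessThan_Suc mult_ac)
    then show ?thesis by (simp add: w emb2_def mapply_def tensor_op_def case_prod_unfold)
  qed
qed

context three
begin

lemma skew_decompose: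
  assumes t: "t \<in> (skew :: ('n \<times> 'n \<Rightarrow> 'k::field) set)" and two: "(2::'k) \<noteq> 0"
  obtains u v w where "u \<in> alt_tensors" "v \<in> alt_tensors" "w \<in> alt_tensors"
    "t = (\<lambda>p. u p + (v p + w p))"
proof -
  define e where "e i j k = (\<lambda>(c, d). (k * idm i c) * idm j d - idm j c * (k * idm i d))" for i j :: 'n and k :: 'k
  have alt: "e i j k \<in> alt_tensors" for i j k
    unfolding alt_tensors_def e_def by (rule CollectI, rule exI[of _ "\<lambda>c. k * idm i c"], rule exI[of _ "idm j"]) simp
  have sk: "t (a, b) = - t (b, a)" for a b using t unfolding skew_def by blast
  have d: "t (a, a) = 0" for a
  proof -
    have "2 * t (a, a) = 0" using sk[of a a] by (simp add: eq_neg_iff_add_eq_0)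
    then show ?thesis using two by simp
  qed
  have "t p = e i0 i1 (t (i0, i1)) p + (e i1 i2 (t (i1, i2)) p + e i2 i0 (t (i2, i0)) p)" for p
  proof -
    obtain a b where p: "p = (a, b)" by (cases p)
    have "\<forall>a b. t (a, b) = e i0 i1 (t (i0, i1)) (a, b) + (e i1 i2 (t (i1, i2)) (a, b) + e i2 i0 (t (i2, i0)) (a, b))"
      unfolding all3 e_def using distinct distinct' sk[of i1 i0] sk[of i2 i1] sk[of i0 i2]
      by (simp add: d idm_def)
    then show ?thesis unfolding p by blast
  qed
  then show thesis using that alt by blast
qed

lemma emb2_in_kernel_S:
  assumes "(2::'k::field) \<noteq> 0"
  shows "emb2 (t :: 'n \<times> 'n \<Rightarrow> 'k) \<in> kernel_S \<longleftrightarrow> t \<in> skew"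
proof
  assume "emb2 t \<in> kernel_S"
  then have "(\<lambda>(a, b). emb2 t [a, b]) \<in> skew"
    unfolding kernel_S_def
    using gen_ideal_degree_le_2[of skew alt_tensors, OF skew_subspace alt_tensors_skew] by blast
  then show "t \<in> skew" by (simp only: emb2_pair)
next
  assume "t \<in> skew"
  then obtain u v w where uvw: "u \<in> alt_tensors" "v \<in> alt_tensors" "w \<in> alt_tensors"
    and t: "t = (\<lambda>p. u p + (v p + w p))" using skew_decompose assms by blast
  have emb2_add: "emb2 (\<lambda>p. x p + y p) = (\<lambda>w. emb2 x w + emb2 y w)" for x y :: "'n \<times> 'n \<Rightarrow> 'k"
    by (auto simp: emb2_def fun_eq_iff split: list.split)
  show "emb2 t \<in> kernel_S"
    unfolding t emb2_add kernel_S_def using uvw by (intro gen_ideal.add gen_ideal.gen imageI)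
qed

lemma lin_span_alt_tensors:
  assumes "(2::'k::field) \<noteq> 0"
  shows "lin_span alt_tensors = (skew :: ('n \<times> 'n \<Rightarrow> 'k) set)"
proof
  have sum_skew: "(\<lambda>p. \<Sum>s\<in>F. c s * s p) \<in> skew" if "finite F" "F \<subseteq> alt_tensors"
    for F :: "('n \<times> 'n \<Rightarrow> 'k) set" and c
    using that
  proof (induction F rule: finite_induct)
    case empty
    then show ?case by (simp add: skew_def)
  next
    case (insert x F)
    then have "(\<lambda>p. c x * x p) \<in> skew" "(\<lambda>p. \<Sum>s\<in>F. c s * s p) \<in> skew"
      using alt_tensors_skew skew_subspace(3) by blast+
    from skew_subspace(2)[OF this] show ?case using insert by simp
  qed
  then show "lin_span alt_tensors \<subseteq> (skew :: ('n \<times> 'n \<Rightarrow> 'k) set)"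
    unfolding lin_span_def by blast
  have single: "u \<in> lin_span alt_tensors" if "u \<in> alt_tensors" for u :: "'n \<times> 'n \<Rightarrow> 'k"
    unfolding lin_span_def using that by (intro CollectI exI[of _ "{u}"] exI[of _ "\<lambda>_. 1"]) simp
  have add: "(\<lambda>p. x p + y p) \<in> lin_span alt_tensors"
    if "x \<in> lin_span alt_tensors" "y \<in> lin_span alt_tensors" for x y :: "'n \<times> 'n \<Rightarrow> 'k"
  proof -
    obtain A c where A: "finite A" "A \<subseteq> alt_tensors" "x = (\<lambda>p. \<Sum>s\<in>A. c s * s p)"
      using \<open>x \<in> _\<close> unfolding lin_span_def by blast
    obtain B d where B: "finite B" "B \<subseteq> alt_tensors" "y = (\<lambda>p. \<Sum>s\<in>B. d s * s p)"
      using \<open>y \<in> _\<close> unfolding lin_span_def by blast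
    \<comment> \<open>Coefficients are extended by 0 so that two overlapping combinations add over
      the union.\<close>
    define e where "e s = (if s \<in> A then c s else 0) + (if s \<in> B then d s else 0)" for s
    have "x p = (\<Sum>s\<in>A \<union> B. (if s \<in> A then c s else 0) * s p)" for p
      unfolding A(3) using A(1) B(1) by (intro sum.mono_neutral_cong_left) auto
    moreover have "y p = (\<Sum>s\<in>A \<union> B. (if s \<in> B then d s else 0) * s p)" for p
      unfolding B(3) using A(1) B(1) by (intro sum.mono_neutral_cong_left) auto
    ultimately have "(\<lambda>p. x p + y p) = (\<lambda>p. \<Sum>s\<in>A \<union> B. e s * s p)"
      by (simp add: e_def distrib_right sum.distrib)
    then show ?thesis unfolding lin_span_def using A B
      by (intro CollectI exI[of _ "A \<union> B"] exI[of _ e]) simp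
  qed
  show "(skew :: ('n \<times> 'n \<Rightarrow> 'k) set) \<subseteq> lin_span alt_tensors"
  proof
    fix t :: "'n \<times> 'n \<Rightarrow> 'k"
    assume "t \<in> skew"
    then obtain u v w where uvw: "u \<in> alt_tensors" "v \<in> alt_tensors" "w \<in> alt_tensors"
      and t: "t = (\<lambda>p. u p + (v p + w p))" using skew_decompose assms by blast
    show "t \<in> lin_span alt_tensors" unfolding t by (intro add single uvw)
  qed
qed

text \<open>In dimension 3 the general skew matrix is that of a cross product; \<xi> is the covector
  fed to \<open>w\<close>.\<close>

lemma skew_iff_crs:
  assumes two: "(2::'k::field) \<noteq> 0"
  shows "(t :: 'n \<times> 'n \<Rightarrow> 'k) \<in> skew \<longleftrightarrow> (\<exists>\<xi>. \<forall>a b. t (a, b) = crs \<xi> (idm a) b)"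
proof
  assume t: "t \<in> skew"
  have sk: "t (a, b) = - t (b, a)" for a b using t unfolding skew_def by blast
  have d: "t (a, a) = 0" for a
  proof -
    have "2 * t (a, a) = 0" using sk[of a a] by (simp add: eq_neg_iff_add_eq_0)
    then show ?thesis using two by simp
  qed
  define \<xi> where "\<xi> = (\<lambda>i. if i = i0 then t (i1, i2) else if i = i1 then t (i2, i0) else t (i0, i1))"
  have "\<forall>a b. t (a, b) = crs \<xi> (idm a) b"
    unfolding all3 crs_nth \<xi>_def using distinct distinct' sk[of i1 i0] sk[of i2 i1] sk[of i0 i2]
    by (simp add: d idm_def)
  then show "\<exists>\<xi>. \<forall>a b. t (a, b) = crs \<xi> (idm a) b" by blast
next
  assume "\<exists>\<xi>. \<forall>a b. t (a, b) = crs \<xi> (idm a) b"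
  then obtain \<xi> where "\<And>a b. t (a, b) = crs \<xi> (idm a) b" by blast
  then have t: "t (a, b) = vol \<xi> (idm a) (idm b)" for a b by (simp add: vol_def dot_idm)
  show "t \<in> skew"
    unfolding skew_def
  proof (intro CollectI allI)
    fix a b
    show "t (a, b) = - t (b, a)" unfolding t by (rule vol_swap(2))
  qed
qed

end

lemma dot_mapply: "dot x (mapply A y) = dot (mapply (\<lambda>i j. A j i) x) y"
proof -
  have "dot x (mapply A y) = (\<Sum>i\<in>UNIV. \<Sum>j\<in>UNIV. x i * A i j * y j)"
    by (simp add: dot_def mapply_def sum_distrib_left mult.assoc)
  also have "\<dots> = (\<Sum>j\<in>UNIV. \<Sum>i\<in>UNIV. x i * A i j * y j)" by (rule sum.swap)
  also have "\<dots> = (\<Sum>j\<in>UNIV. (\<Sum>i\<in>UNIV. A i j * x i) * y j)"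
    by (simp only: sum_distrib_right mult.commute[of "x _"])
  finally show ?thesis by (simp only: dot_def mapply_def)
qed

text \<open>On the standard basis the determinant expansion is symmetric under transposition, so the
  factor supplied by \<open>ex_det\<close> is \<open>d\<close> again.\<close>

lemma (in three) vol_mapply_transpose:
  fixes A :: "'n \<Rightarrow> 'n \<Rightarrow> 'k::field"
  assumes "\<And>x y z. vol (mapply A x) (mapply A y) (mapply A z) = d * vol x y z"
  shows "vol (mapply (\<lambda>i j. A j i) x) (mapply (\<lambda>i j. A j i) y) (mapply (\<lambda>i j. A j i) z) = d * vol x y z"
proof -
  let ?B = "\<lambda>i j. A j i"
  obtain c where c: "\<And>x y z. vol (mapply ?B x) (mapply ?B y) (mapply ?B z) = c * vol x y z"
    using ex_det[OF mapply_linear[of ?B]] by blast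
  have "vol (mapply ?B (idm i0)) (mapply ?B (idm i1)) (mapply ?B (idm i2))
    = vol (mapply A (idm i0)) (mapply A (idm i1)) (mapply A (idm i2))"
    unfolding vol_def dot3 crs_nth mapply_idm by (simp add: algebra_simps)
  then have "c = d" unfolding assms c vol_basis by simp
  then show ?thesis using c by simp
qed

lemma mapply_right_factor: "mapply (tensor_op idm A) t (a, b) = mapply A (\<lambda>d. t (a, d)) b"
proof -
  have "mapply (tensor_op idm A) t (a, b) = (\<Sum>c\<in>UNIV. idm a c * (\<Sum>d\<in>UNIV. A b d * t (c, d)))"
    by (simp add: mapply_def tensor_op_def sum_pair sum_distrib_left mult.assoc)
  then show ?thesis by (simp add: sum_idm mapply_def)
qed

text \<open>The Hecke relation reads M (M + 1 + q) = 0. Expanding the braid equation for M + q and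
  replacing M^2, the linear terms combine to -q times each copy of M.\<close>

lemma hecke_symmetry_shift:
  fixes R :: "('n::finite \<times> 'n) \<Rightarrow> ('n \<times> 'n) \<Rightarrow> 'k::field"
  assumes "hecke_symmetry q R"
  defines "M \<equiv> \<lambda>i j. R i j - q * idm i j"
  shows "tapply M (tapply M t) a b = - (1 + q) * tapply M t a b"
    and "A12 M (A23 M (A12 M u)) a b c - q * A12 M u a b c
      = A23 M (A12 M (A23 M u)) a b c - q * A23 M u a b c"
proof -
  have R: "R = (\<lambda>i j. M i j + q * idm i j)" by (simp add: M_def fun_eq_iff)
  have hecke: "mapply M (mapply M T) p = - (1 + q) * mapply M T p" for T p
  proof -
    have "mmul M (\<lambda>i j. M i j + (1 + q) * idm i j) = (\<lambda>i j. 0)"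
      using assms(1) unfolding hecke_symmetry_def M_def by (simp add: algebra_simps)
    then have "mapply M (mapply (\<lambda>i j. M i j + (1 + q) * idm i j) T) = 0"
      unfolding mapply_mmul[symmetric] by (simp add: mapply_def[abs_def] zero_fun_def)
    then have "mapply M (mapply M T) + (1 + q) *v mapply M T = 0"
      unfolding mapply_shift linear_opD[OF mapply_linear[of M]] .
    then have "(mapply M (mapply M T) + (1 + q) *v mapply M T) p = 0" by simp
    then show ?thesis by (simp add: smul_apply algebra_simps eq_neg_iff_add_eq_0)
  qed
  have tM: "tapply M t a b = mapply M (\<lambda>(a, b). t a b) (a, b)" for t a b
    by (simp add: mapply_pair)
  have tM': "(\<lambda>(a, b). tapply M t a b) = mapply M (\<lambda>(a, b). t a b)" for t
    by (simp add: fun_eq_iff mapply_pair)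
  show tt: "tapply M (tapply M t) a b = - (1 + q) * tapply M t a b" for t a b
    unfolding tM[of "tapply M t"] tM' hecke unfolding tM ..
  have "mapply (mmul (R_12 R) (mmul (R_23 R) (R_12 R))) T = mapply (mmul (R_23 R) (mmul (R_12 R) (R_23 R))) T" for T
    using assms(1) unfolding hecke_symmetry_def by simp
  from fun_cong[OF this[unfolded mapply_mmul], of "\<lambda>(a, b, c). u a b c" "(a, b, c)"]
  have "A12 R (A23 R (A12 R u)) a b c = A23 R (A12 R (A23 R u)) a b c"
    by (simp add: mapply_R_12 mapply_R_23)
  moreover have tR: "tapply R t a b = tapply M t a b + q * t a b" for t a b
  proof -
    have "tapply R t a b = mapply R (\<lambda>(a, b). t a b) (a, b)" by (simp add: mapply_pair)
    then show ?thesis by (simp add: R mapply_shift smul_apply mapply_pair)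
  qed
  have A12R: "A12 R u = (\<lambda>a b c. A12 M u a b c + q * u a b c)"
    and A23R: "A23 R u = (\<lambda>a b c. A23 M u a b c + q * u a b c)" for u
    by (simp_all add: A12_def A23_def tR fun_eq_iff)
  have lin: "A12 M (\<lambda>a b c. t a b c + u a b c) = (\<lambda>a b c. A12 M t a b c + A12 M u a b c)"
    "A23 M (\<lambda>a b c. t a b c + u a b c) = (\<lambda>a b c. A23 M t a b c + A23 M u a b c)"
    "A12 M (\<lambda>a b c. k * t a b c) = (\<lambda>a b c. k * A12 M t a b c)"
    "A23 M (\<lambda>a b c. k * t a b c) = (\<lambda>a b c. k * A23 M t a b c)" for t u k
    by (simp_all add: A12_def A23_def tapply_add tapply_scale fun_eq_iff)
  have sq: "A12 M (A12 M u) = (\<lambda>a b c. - (1 + q) * A12 M u a b c)"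
    "A23 M (A23 M u) = (\<lambda>a b c. - (1 + q) * A23 M u a b c)" for u
    by (simp_all add: A12_def[abs_def] A23_def[abs_def] tt fun_eq_iff)
  ultimately show "A12 M (A23 M (A12 M u)) a b c - q * A12 M u a b c
      = A23 M (A12 M (A23 M u)) a b c - q * A23 M u a b c"
    unfolding A12R A23R lin sq by (simp add: algebra_simps)
qed

lemma commute_of_tapply:
  fixes M :: "('n::finite \<times> 'n) \<Rightarrow> ('n \<times> 'n) \<Rightarrow> 'k::field"
  assumes "\<And>x y a b. tapply M (\<lambda>a b. mapply \<zeta> x a * mapply \<zeta> y b) a b
    = dot (mapply (\<lambda>i j. \<zeta> j i) (idm a)) (\<lambda>a'. dot (mapply (\<lambda>i j. \<zeta> j i) (idm b))
        (\<lambda>b'. tapply M (\<lambda>a b. x a * y b) a' b'))"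
  shows "mmul M (tensor_op \<zeta> \<zeta>) = mmul (tensor_op \<zeta> \<zeta>) M"
proof (intro ext)
  fix p r :: "'n \<times> 'n"
  obtain a b c d where pr: "p = (a, b)" "r = (c, d)" by (cases p, cases r)
  have "tapply M (\<lambda>a b. idm c a * idm d b) a' b' = M (a', b') (c, d)" for a' b'
  proof -
    have "tapply M (\<lambda>a b. idm c a * idm d b) a' b' = (\<Sum>x\<in>UNIV. idm c x * (\<Sum>y\<in>UNIV. idm d y * M (a', b') (x, y)))"
      by (simp add: tapply_def sum_distrib_left mult_ac)
    then show ?thesis by (simp add: sum_idm)
  qed
  then show "mmul M (tensor_op \<zeta> \<zeta>) p r = mmul (tensor_op \<zeta> \<zeta>) M p r"
    using assms[of "idm c" "idm d" a b] unfolding pr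
    by (simp add: mapply_idm tapply_def mmul_def tensor_op_def sum_pair dot_def sum_distrib_left mult.assoc)
qed

lemma mmul_shift:
  fixes A B :: "'i::finite \<Rightarrow> 'i \<Rightarrow> 'k::field"
  shows "mmul (\<lambda>i j. A i j + k * idm i j) B = (\<lambda>i j. mmul A B i j + k * B i j)"
    "mmul B (\<lambda>i j. A i j + k * idm i j) = (\<lambda>i j. mmul B A i j + k * B i j)"
proof -
  have 1: "(\<Sum>j\<in>UNIV. k * idm i j * B j l) = k * B i l" "(\<Sum>j\<in>UNIV. B i j * (k * idm j l)) = k * B i l" for i l
  proof -
    show "(\<Sum>j\<in>UNIV. k * idm i j * B j l) = k * B i l"
      by (simp add: sum_distrib_left[symmetric] mult.assoc sum_idm)
    have "(\<Sum>j\<in>UNIV. B i j * (k * idm j l)) = k * (\<Sum>j\<in>UNIV. B i j * idm j l)"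
      by (simp add: sum_distrib_left mult_ac)
    then show "(\<Sum>j\<in>UNIV. B i j * (k * idm j l)) = k * B i l" by (simp add: sum_idm)
  qed
  show "mmul (\<lambda>i j. A i j + k * idm i j) B = (\<lambda>i j. mmul A B i j + k * B i j)"
    "mmul B (\<lambda>i j. A i j + k * idm i j) = (\<lambda>i j. mmul B A i j + k * B i j)"
    by (simp_all add: mmul_def fun_eq_iff distrib_left distrib_right sum.distrib 1)
qed

theorem theorem1p1:
  fixes q :: "'k::field"
    and \<zeta> :: "'n::finite \<Rightarrow> 'n \<Rightarrow> 'k"
    and R :: "('n \<times> 'n) \<Rightarrow> ('n \<times> 'n) \<Rightarrow> 'k"
  assumes "card (UNIV :: 'n set) = 3"
    and "(2::'k) \<noteq> 0"
    and "q \<noteq> 0"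
    and "invertible_mat \<zeta>"
    and "hecke_symmetry q R"
    and "id_extends_to_iso q R \<zeta>"
  shows "mmul R (tensor_op \<zeta> \<zeta>) = mmul (tensor_op \<zeta> \<zeta>) R
    \<and> (\<exists>R1. hecke_symmetry q R1
         \<and> mmul R1 (tensor_op \<zeta> \<zeta>) = mmul (tensor_op \<zeta> \<zeta>) R1
         \<and> R = twist_R \<zeta> R1
         \<and> R_relations q R1 = lin_span alt_tensors)"
proof -
  note two = \<open>(2::'k) \<noteq> 0\<close> and q = \<open>q \<noteq> 0\<close> and Hecke = \<open>hecke_symmetry q R\<close>
  obtain i0 i1 i2 :: 'n where "UNIV = {i0, i1, i2}" "i0 \<noteq> i1" "i1 \<noteq> i2" "i0 \<noteq> i2"
    using \<open>card UNIV = 3\<close> unfolding card_3_iff by metis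
  then interpret three i0 i1 i2 by unfold_locales auto
  define \<zeta>i where "\<zeta>i = minv \<zeta>"
  have zinv: "mmul \<zeta> \<zeta>i = idm" "mmul \<zeta>i \<zeta> = idm"
    using someI_ex[OF \<open>invertible_mat \<zeta>\<close>[unfolded invertible_mat_def]] unfolding \<zeta>i_def minv_def by auto
  have zinv': "mapply \<zeta> (mapply \<zeta>i x) = x" "mapply \<zeta>i (mapply \<zeta> x) = x" for x
    unfolding mapply_mmul[symmetric] zinv mapply_idm by (rule refl)+
  define M where "M = (\<lambda>i j. R i j - q * idm i j)"
  have R: "R = (\<lambda>i j. M i j + q * idm i j)" by (simp add: M_def fun_eq_iff)
  have rel: "t \<in> R_relations q R \<longleftrightarrow> mapply (tensor_op idm \<zeta>) t \<in> skew" for t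
    using \<open>id_extends_to_iso q R \<zeta>\<close> emb2_in_kernel_SR[of t q R] emb2_in_kernel_S[OF two]
    unfolding id_extends_to_iso_def kernel_S_twisted_def
    by (simp add: fin_supp_emb2 twist_tensor_emb2)
  obtain \<delta> where det: "\<And>x y z. vol (mapply \<zeta> x) (mapply \<zeta> y) (mapply \<zeta> z) = \<delta> * vol x y z"
    using ex_det[OF mapply_linear[of \<zeta>]] by blast
  interpret twisted i0 i1 i2 "mapply \<zeta>" "mapply \<zeta>i" "mapply (\<lambda>i j. \<zeta> j i)" "mapply (\<lambda>i j. \<zeta>i j i)" \<delta>
    by unfold_locales
      (auto intro: mapply_linear dot_mapply det vol_mapply_transpose[OF det] simp: zinv')
  interpret hecke_op i0 i1 i2 "mapply \<zeta>" "mapply \<zeta>i" "mapply (\<lambda>i j. \<zeta> j i)" "mapply (\<lambda>i j. \<zeta>i j i)" \<delta> M q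
  proof
    fix t :: "'n \<Rightarrow> 'n \<Rightarrow> 'k"
    define T where "T = mapply M (\<lambda>(a, b). t a b)"
    have "T \<in> R_relations q R" unfolding T_def R_relations_def mimage_def M_def by blast
    then obtain \<xi> where \<xi>: "\<And>a b. mapply \<zeta> (\<lambda>d. T (a, d)) b = crs \<xi> (idm a) b"
      unfolding rel skew_iff_crs[OF two] mapply_right_factor by blast
    have "T (a, b) = w \<xi> a b" for a b
    proof -
      have "mapply \<zeta> (\<lambda>d. T (a, d)) = crs \<xi> (idm a)" using \<xi> by blast
      then have "(\<lambda>d. T (a, d)) = w \<xi> a" unfolding w_Zi by (metis zinv'(2))
      then show ?thesis by (metis)
    qed
    then show "\<exists>\<xi>. \<forall>a b. tapply M t a b = w \<xi> a b" by (auto simp: T_def mapply_pair)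
  next
    fix \<xi>
    define T where "T = (\<lambda>(a, b). w \<xi> a b)"
    have "mapply (tensor_op idm \<zeta>) T (a, b) = crs \<xi> (idm a) b" for a b
      unfolding mapply_right_factor T_def by (simp add: w_Zi zinv')
    then have "T \<in> R_relations q R" unfolding rel skew_iff_crs[OF two] by blast
    then obtain t where "T = mapply M t" unfolding R_relations_def mimage_def M_def by blast
    then have "tapply M (\<lambda>a b. t (a, b)) a b = w \<xi> a b" for a b
      unfolding mapply_pair[symmetric] T_def by (metis case_prod_conv)
    then show "\<exists>t. \<forall>a b. tapply M t a b = w \<xi> a b" by blast
  next
    show "tapply M (tapply M t) a b = - (1 + q) * tapply M t a b" for t a b
      unfolding M_def by (rule hecke_symmetry_shift(1)[OF Hecke])
    show "A12 M (A23 M (A12 M u)) a b c - q * A12 M u a b c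
      = A23 M (A12 M (A23 M u)) a b c - q * A23 M u a b c" for u a b c
      unfolding M_def by (rule hecke_symmetry_shift(2)[OF Hecke])
  qed (rule q)
  obtain m m' where "linear_op m" "linear_op m'"
    "\<And>\<xi> v a b c. A12 M (A23 M (\<lambda>a b c. w \<xi> a b * v c)) a b c = q * (w \<xi> a b * v c) + dot \<xi> (m v) * \<upsilon> a b c"
    "\<And>\<xi> v a b c. A23 M (A12 M (\<lambda>a b c. v a * w \<xi> b c)) a b c = q * (v a * w \<xi> b c) + dot \<xi> (m' v) * \<upsilon> a b c"
    using left_map right_map by metis
  then interpret maps: hecke_maps i0 i1 i2 "mapply \<zeta>" "mapply \<zeta>i" "mapply (\<lambda>i j. \<zeta> j i)" "mapply (\<lambda>i j. \<zeta>i j i)" \<delta> M q m m'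
    by unfold_locales
  have commM: "mmul M (tensor_op \<zeta> \<zeta>) = mmul (tensor_op \<zeta> \<zeta>) M"
    by (rule commute_of_tapply) (rule maps.tapply_Z_Z[OF two])
  have comm: "mmul R (tensor_op \<zeta> \<zeta>) = mmul (tensor_op \<zeta> \<zeta>) R"
    unfolding R mmul_shift commM ..
  define P where "P = tensor_op \<zeta> (idm :: 'n \<Rightarrow> 'n \<Rightarrow> 'k)"
  define Pi where "Pi = tensor_op \<zeta>i (idm :: 'n \<Rightarrow> 'n \<Rightarrow> 'k)"
  have PPi: "mmul P Pi = idm" "mmul Pi P = idm"
    by (simp_all add: P_def Pi_def tensor_op_mmul zinv mmul_idm tensor_op_idm)
  have cancel: "mmul P (mmul Pi X) = X" "mmul Pi (mmul P X) = X" for X :: "'n \<times> 'n \<Rightarrow> 'n \<times> 'n \<Rightarrow> 'k"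
    by (simp_all add: mmul_assoc[symmetric] PPi mmul_idm)
  \<comment> \<open>The solution of R = (R1)_\<zeta> for R1.\<close>
  define R1 where "R1 = mmul Pi (mmul R P)"
  have PZ: "mmul P (tensor_op \<zeta> \<zeta>) = mmul (tensor_op \<zeta> \<zeta>) P"
    "mmul Pi (tensor_op \<zeta> \<zeta>) = mmul (tensor_op \<zeta> \<zeta>) Pi"
    by (simp_all add: P_def Pi_def tensor_op_mmul mmul_idm zinv)
  have comm1: "mmul R1 (tensor_op \<zeta> \<zeta>) = mmul (tensor_op \<zeta> \<zeta>) R1"
  proof -
    have "mmul R1 (tensor_op \<zeta> \<zeta>) = mmul Pi (mmul (mmul R (tensor_op \<zeta> \<zeta>)) P)"
      by (simp add: R1_def mmul_assoc PZ)
    also have "\<dots> = mmul (mmul Pi (tensor_op \<zeta> \<zeta>)) (mmul R P)"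
      by (simp add: comm mmul_assoc)
    finally show ?thesis by (simp add: PZ R1_def mmul_assoc)
  qed
  have twist: "R = twist_R \<zeta> R1"
    unfolding twist_R_def \<zeta>i_def[symmetric] P_def[symmetric] Pi_def[symmetric] R1_def
    by (simp add: mmul_assoc cancel PPi mmul_idm)
  have R1_shift: "(\<lambda>i j. R1 i j + k * idm i j) = mmul Pi (mmul (\<lambda>i j. R i j + k * idm i j) P)" for k
  proof -
    have "mmul Pi (mmul (\<lambda>i j. R i j + k * idm i j) P) = mmul Pi (mmul P (\<lambda>i j. mmul Pi (mmul R P) i j + k * idm i j))"
      by (simp only: mmul_shift cancel)
    then show ?thesis by (simp only: cancel R1_def)
  qed
  have R1_minus: "(\<lambda>i j. R1 i j - q * idm i j) = mmul Pi (mmul M P)"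
    using R1_shift[of "- q"] by (simp add: M_def)
  \<comment> \<open>Untwisting by \<zeta> \<otimes> 1 replaces 1 \<otimes> \<zeta> in
    \<open>rel\<close> by \<zeta> \<otimes> \<zeta>, which maps skew tensors onto skew
    tensors.\<close>
  have relations1: "R_relations q R1 = lin_span alt_tensors"
  proof -
    have mP: "mapply P (mapply Pi x) = x" "mapply Pi (mapply P x) = x" for x
      unfolding mapply_mmul[symmetric] PPi mapply_idm by (rule refl)+
    have "t \<in> R_relations q R1 \<longleftrightarrow> mapply P t \<in> R_relations q R" for t
    proof
      assume "t \<in> R_relations q R1"
      then obtain u where "t = mapply Pi (mapply M (mapply P u))"
        unfolding R_relations_def mimage_def R1_minus mapply_mmul by blast
      then show "mapply P t \<in> R_relations q R"
        unfolding R_relations_def mimage_def M_def[symmetric] by (simp add: mP)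
    next
      assume "mapply P t \<in> R_relations q R"
      then obtain u where "mapply P t = mapply M u"
        unfolding R_relations_def mimage_def M_def[symmetric] by blast
      then have "t = mapply Pi (mapply M (mapply P (mapply Pi u)))" by (metis mP)
      then show "t \<in> R_relations q R1"
        unfolding R_relations_def mimage_def R1_minus mapply_mmul by blast
    qed
    moreover have "mapply (tensor_op idm \<zeta>) (mapply P t) = mapply (tensor_op \<zeta> \<zeta>) t" for t
      unfolding P_def mapply_mmul[symmetric] tensor_op_mmul mmul_idm ..
    moreover have "mapply (tensor_op \<zeta> \<zeta>) t \<in> skew \<longleftrightarrow> t \<in> skew" for t
    proof
      assume "mapply (tensor_op \<zeta> \<zeta>) t \<in> skew"
      then have "mapply (tensor_op \<zeta>i \<zeta>i) (mapply (tensor_op \<zeta> \<zeta>) t) \<in> skew" by (rule mapply_tensor_op_skew)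
      then show "t \<in> skew" unfolding mapply_mmul[symmetric] tensor_op_mmul zinv tensor_op_idm mapply_idm .
    qed (rule mapply_tensor_op_skew)
    ultimately show ?thesis unfolding lin_span_alt_tensors[OF two] by (auto simp: rel)
  qed
  have hecke1: "hecke_symmetry q R1"
  proof -
    have "mmul (\<lambda>i j. R1 i j - q * idm i j) (\<lambda>i j. R1 i j + idm i j)
      = mmul Pi (mmul (mmul M (\<lambda>i j. R i j + idm i j)) P)"
      using R1_shift[of 1] by (simp add: R1_minus mmul_assoc cancel)
    also have "mmul M (\<lambda>i j. R i j + idm i j) = (\<lambda>i j. 0)"
      using Hecke unfolding hecke_symmetry_def M_def by blast
    also have "mmul Pi (mmul (\<lambda>i j. 0) P) = (\<lambda>i j. 0)" by (simp add: mmul_def fun_eq_iff)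
    finally have quadratic: "mmul (\<lambda>i j. R1 i j - q * idm i j) (\<lambda>i j. R1 i j + idm i j) = (\<lambda>i j. 0)" .
    define \<zeta>2 where "\<zeta>2 = mmul \<zeta> \<zeta>"
    define \<zeta>2i where "\<zeta>2i = mmul \<zeta>i \<zeta>i"
    define Q where "Q = tensor_op3 \<zeta>2 \<zeta> (idm :: 'n \<Rightarrow> 'n \<Rightarrow> 'k)"
    define Qi where "Qi = tensor_op3 \<zeta>2i \<zeta>i (idm :: 'n \<Rightarrow> 'n \<Rightarrow> 'k)"
    have t3_idm: "tensor_op3 idm idm idm = (idm :: 'n \<times> 'n \<times> 'n \<Rightarrow> _ \<Rightarrow> 'k)"
      by (auto simp: tensor_op3_def idm_def fun_eq_iff)
    have inv2: "mmul \<zeta>2 \<zeta>2i = idm" "mmul \<zeta>2i \<zeta>2 = idm"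
    proof -
      have "mmul \<zeta>2 \<zeta>2i = mmul \<zeta> (mmul (mmul \<zeta> \<zeta>i) \<zeta>i)" "mmul \<zeta>2i \<zeta>2 = mmul \<zeta>i (mmul (mmul \<zeta>i \<zeta>) \<zeta>)"
        by (simp_all only: \<zeta>2_def \<zeta>2i_def mmul_assoc)
      then show "mmul \<zeta>2 \<zeta>2i = idm" "mmul \<zeta>2i \<zeta>2 = idm" by (simp_all add: zinv mmul_idm)
    qed
    have QQi: "mmul Q Qi = idm" "mmul Qi Q = idm"
      by (simp_all add: Q_def Qi_def tensor_op3_mmul zinv inv2 mmul_idm t3_idm)
    text \<open>Conjugation by \<open>\<zeta>\<^sup>2 \<otimes> \<zeta> \<otimes> 1\<close> turns both copies of \<open>R1\<close> into the copies of \<open>R\<close>.\<close>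
    have Q12: "mmul Q (R_12 R1) = mmul (R_12 R) Q"
    proof -
      have Q: "Q = mmul (tensor_op3 \<zeta> \<zeta> idm) (tensor_op3 \<zeta> idm idm)"
        by (simp add: Q_def \<zeta>2_def tensor_op3_mmul mmul_idm)
      have R12: "R_12 R1 = mmul (tensor_op3 \<zeta>i idm idm) (mmul (R_12 R) (tensor_op3 \<zeta> idm idm))"
        unfolding R1_def R_12_mmul[symmetric] P_def Pi_def R_12_tensor_op ..
      have "mmul Q (R_12 R1) = mmul (tensor_op3 \<zeta> \<zeta> idm) (mmul (mmul (tensor_op3 \<zeta> idm idm) (tensor_op3 \<zeta>i idm idm)) (mmul (R_12 R) (tensor_op3 \<zeta> idm idm)))"
        by (simp only: Q R12 mmul_assoc)
      also have "\<dots> = mmul (mmul (R_12 (tensor_op \<zeta> \<zeta>)) (R_12 R)) (tensor_op3 \<zeta> idm idm)"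
        by (simp add: tensor_op3_mmul zinv mmul_idm t3_idm R_12_tensor_op mmul_assoc)
      \<comment> \<open>Here \<zeta> \<otimes> \<zeta> has to pass R, which \<open>comm\<close>
        provides; in \<open>Q23\<close> the remaining factor \<zeta>^2 acts on the slot that
        \<open>R_23 R\<close> leaves alone.\<close>
      also have "mmul (R_12 (tensor_op \<zeta> \<zeta>)) (R_12 R) = mmul (R_12 R) (R_12 (tensor_op \<zeta> \<zeta>))"
        by (simp only: R_12_mmul comm)
      finally show ?thesis by (simp only: R_12_tensor_op mmul_assoc Q)
    qed
    have Q23: "mmul Q (R_23 R1) = mmul (R_23 R) Q"
    proof -
      have Q: "Q = mmul (tensor_op3 \<zeta>2 idm idm) (tensor_op3 idm \<zeta> idm)"
        by (simp add: Q_def tensor_op3_mmul mmul_idm)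
      have R23: "R_23 R1 = mmul (tensor_op3 idm \<zeta>i idm) (mmul (R_23 R) (tensor_op3 idm \<zeta> idm))"
        unfolding R1_def R_23_mmul[symmetric] P_def Pi_def R_23_tensor_op ..
      have "mmul Q (R_23 R1) = mmul (tensor_op3 \<zeta>2 idm idm) (mmul (mmul (tensor_op3 idm \<zeta> idm) (tensor_op3 idm \<zeta>i idm)) (mmul (R_23 R) (tensor_op3 idm \<zeta> idm)))"
        by (simp only: Q R23 mmul_assoc)
      also have "\<dots> = mmul (mmul (tensor_op3 \<zeta>2 idm idm) (R_23 R)) (tensor_op3 idm \<zeta> idm)"
        by (simp add: tensor_op3_mmul zinv mmul_idm t3_idm mmul_assoc)
      finally show ?thesis by (simp only: R_23_first[symmetric] mmul_assoc Q)
    qed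
    have Q12': "mmul Q (mmul (R_12 R1) X) = mmul (R_12 R) (mmul Q X)"
      and Q23': "mmul Q (mmul (R_23 R1) X) = mmul (R_23 R) (mmul Q X)"
      for X :: "'n \<times> 'n \<times> 'n \<Rightarrow> 'n \<times> 'n \<times> 'n \<Rightarrow> 'k"
      by (simp_all only: mmul_assoc[symmetric] Q12 Q23)
    have "mmul Q (mmul (R_12 R1) (mmul (R_23 R1) (R_12 R1))) = mmul Q (mmul (R_23 R1) (mmul (R_12 R1) (R_23 R1)))"
    proof -
      have "mmul (mmul (R_12 R) (mmul (R_23 R) (R_12 R))) Q = mmul (mmul (R_23 R) (mmul (R_12 R) (R_23 R))) Q"
        using Hecke unfolding hecke_symmetry_def by simp
      then show ?thesis by (simp only: Q12' Q23' Q12 Q23 mmul_assoc)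
    qed
    then have "mmul Qi (mmul Q (mmul (R_12 R1) (mmul (R_23 R1) (R_12 R1))))
      = mmul Qi (mmul Q (mmul (R_23 R1) (mmul (R_12 R1) (R_23 R1))))" by simp
    then have "mmul (R_12 R1) (mmul (R_23 R1) (R_12 R1)) = mmul (R_23 R1) (mmul (R_12 R1) (R_23 R1))"
      unfolding mmul_assoc[symmetric, of Qi Q] QQi mmul_idm .
    with quadratic show ?thesis unfolding hecke_symmetry_def by blast
  qed
  show ?thesis using comm hecke1 comm1 twist relations1 by blast
qed

end
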